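(* Let $N\ge3$, $R>0$, $p\in\big(\frac{N+2}{N},\frac{N+2}{N-2}\big)$, and let $u\in H^1_0(B_R)$ be a positive ground state of $-\Delta u+u=\big(\int_{B_R}G(x,y)|u(y)|^pdy\big)|u|^{p-2}u$ in $B_R$. Then either $u$ is radially symmetric with respect to the origin, or there exists $M\in O(N)$ such that $u_M$ is axially symmetric with respect to the $x_N$-axis (i.e. $u_M$ is constant on each set $\{x:|x|=\alpha,\ x_N=h\}$) and, for every $\alpha\in(0,R]$, the function $\theta\mapsto u_M(\alpha\cos\theta,0,\dots,0,\alpha\sin\theta)$ is nonincreasing on $[\pi/2,3\pi/2]$.
   Context: $B_R$ is the ball of radius $R$ centered at $0$ in $\mathbb{R}^N$; $O(N)$ is the orthogonal group, $u_M(x):=u(M^{-1}x)$. For $x\ne y$, $G(x,y)=|x-y|^{2-N}-\Big(\frac{1}{R}\sqrt{|x|^2|y|^2-2R^2\,x\cdot y+R^4}\Big)^{2-N}$. The energy functional on $H^1_0(B_R)$ is $I(u)=\frac12\int_{B_R}(|\nabla u|^2+u^2)dx-\frac1{2p}\int_{B_R}\int_{B_R}G(x,y)|u(y)|^p|u(x)|^pdxdy$; a ground state is a nonzero critical point of $I$ with minimal energy among all nonzero critical points, and positive means $u>0$ in the interior of $B_R$ (ground states are $C^2$ up to the boundary). *)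

theory Defs
  imports "HOL-Analysis.Analysis"
begin

class idx = finite + wellorder

text \<open>Dimension N = CARD of the index type; points of R^N are real vectors indexed by a finite well-ordered
  index type so that the coordinates x_1 and x_N are the least / greatest index.\<close>

definition first_idx :: "'n::idx" where
  "first_idx = (LEAST i. True)"

definition last_idx :: "'n::idx" where
  "last_idx = (GREATEST i. True)"

text \<open>The Green function of the Dirichlet Laplacian on B_R (up to constants).\<close>
definition greenG :: "real \<Rightarrow> real^'n::idx \<Rightarrow> real^'n::idx \<Rightarrow> real" where
  "greenG R x y =
     norm (x - y) powr (2 - real CARD('n::idx))
     - ((1 / R) * sqrt ((norm x)^2 * (norm y)^2 - 2 * R^2 * (x \<bullet> y) + R^4)) powr (2 - real CARD('n::idx))"

definition C1c_ball :: "real \<Rightarrow> (real^'n::idx \<Rightarrow> real) \<Rightarrow> (real^'n::idx \<Rightarrow> real^'n::idx) \<Rightarrow> bool" where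
  "C1c_ball R \<phi> D \<longleftrightarrow>
     (\<forall>x. (\<phi> has_derivative (\<lambda>h. D x \<bullet> h)) (at x)) \<and> continuous_on UNIV D \<and>
     (\<exists>K. compact K \<and> K \<subseteq> ball 0 R \<and> (\<forall>x. x \<notin> K \<longrightarrow> \<phi> x = 0))"

text \<open>u \<in> H^1_0(B_R) with weak gradient g: u is the H^1-limit of C^1_c(B_R) functions
  (the closure of C^1_c(B_R) in H^1 equals that of C^\<infinity>_c(B_R)).\<close>
definition H10_grad :: "real \<Rightarrow> (real^'n::idx \<Rightarrow> real) \<Rightarrow> (real^'n::idx \<Rightarrow> real^'n::idx) \<Rightarrow> bool" where
  "H10_grad R u g \<longleftrightarrow>
     u \<in> borel_measurable lborel \<and> g \<in> borel_measurable lborel \<and>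
     (\<exists>\<phi> D. (\<forall>k. C1c_ball R (\<phi> k) (D k)) \<and>
        (\<forall>k. integrable lborel (\<lambda>x. (\<phi> k x - u x)^2 + (norm (D k x - g x))^2)) \<and>
        (\<lambda>k. LINT x|lborel. (\<phi> k x - u x)^2 + (norm (D k x - g x))^2) \<longlonglongrightarrow> 0)"

definition H10 :: "real \<Rightarrow> (real^'n::idx \<Rightarrow> real) \<Rightarrow> bool" where
  "H10 R u \<longleftrightarrow> (\<exists>g. H10_grad R u g)"

definition wgrad :: "real \<Rightarrow> (real^'n::idx \<Rightarrow> real) \<Rightarrow> real^'n::idx \<Rightarrow> real^'n::idx" where
  "wgrad R u = (SOME g. H10_grad R u g)"

definition energyI :: "real \<Rightarrow> real \<Rightarrow> (real^'n::idx \<Rightarrow> real) \<Rightarrow> real" where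
  "energyI R p u =
     (1/2) * (LINT x:ball 0 R|lborel. (norm (wgrad R u x))^2 + (u x)^2)
     - (1 / (2 * p)) * (LINT x:ball 0 R|lborel. LINT y:ball 0 R|lborel.
           greenG R x y * \<bar>u y\<bar> powr p * \<bar>u x\<bar> powr p)"

definition critical_point :: "real \<Rightarrow> real \<Rightarrow> (real^'n::idx \<Rightarrow> real) \<Rightarrow> bool" where
  "critical_point R p u \<longleftrightarrow> H10 R u \<and>
     (\<forall>v. H10 R v \<longrightarrow> ((\<lambda>t. energyI R p (\<lambda>x. u x + t * v x)) has_real_derivative 0) (at 0))"

definition nonzero_on_ball :: "real \<Rightarrow> (real^'n::idx \<Rightarrow> real) \<Rightarrow> bool" where
  "nonzero_on_ball R u \<longleftrightarrow> \<not> (AE x in lborel. x \<in> ball 0 R \<longrightarrow> u x = 0)"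

definition ground_state :: "real \<Rightarrow> real \<Rightarrow> (real^'n::idx \<Rightarrow> real) \<Rightarrow> bool" where
  "ground_state R p u \<longleftrightarrow> critical_point R p u \<and> nonzero_on_ball R u \<and>
     (\<forall>w::real^'n::idx \<Rightarrow> real. critical_point R p w \<and> nonzero_on_ball R w \<longrightarrow> energyI R p u \<le> energyI R p w)"

definition rotate_fun :: "real^'n::idx^'n::idx \<Rightarrow> (real^'n::idx \<Rightarrow> real) \<Rightarrow> real^'n::idx \<Rightarrow> real" where
  "rotate_fun M u x = u (matrix_inv M *v x)"

end

theory Submission
  imports Defs
begin

text \<open>
  The first alternative always holds: every positive bounded solution is radial, by the method of moving
  planes. With \<open>V = \<integral> G(\<cdot>, y) u(y)\<^sup>p dy\<close> the equation becomes the cooperative system \<open>-\<Delta>u + u = V u\<^sup>p\<^sup>-\<^sup>1\<close>, where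
  \<open>V\<close> is known explicitly. Let \<open>\<sigma>\<close> be the reflection in the plane \<open>x \<bullet> e = l\<close>, \<open>l > 0\<close>, and \<open>\<Sigma>\<close> the cap \<open>x \<bullet> e > l\<close>
  of the ball.

  Writing \<open>G(x, y) = k(|x-y|\<^sup>2) - k(|x-y|\<^sup>2 + s(x) s(y) / R\<^sup>2)\<close> with \<open>s = R\<^sup>2 - |x|\<^sup>2\<close> and \<open>k\<close> convex decreasing, one sees
  that \<open>V - V \<circ> \<sigma>\<close> is bounded on \<open>\<Sigma>\<close> by the potential of \<open>(u\<^sup>p - (u \<circ> \<sigma>)\<^sup>p)\<^sup>+\<close>. Testing the weak equation with the
  cube of \<open>\<phi> = (u - u \<circ> \<sigma>)\<^sup>+\<close> then gives \<open>\<integral>|\<nabla>\<phi>\<^sup>2|\<^sup>2 \<le> C \<integral>\<phi>\<^sup>4\<close>, and the Poincare inequality forces \<open>\<phi> = 0\<close> as soon as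
  the set \<open>{\<phi> > 0}\<close> has small measure. If \<open>u \<le> u \<circ> \<sigma>\<close> on \<open>\<Sigma>\<close>, the part of the ball whose reflection lies outside the
  ball makes \<open>V < V \<circ> \<sigma>\<close>, whence \<open>u < u \<circ> \<sigma>\<close> on \<open>\<Sigma>\<close> by comparison with a bump function. So the set of admissible
  levels \<open>l\<close> is open and closed in \<open>(0, R]\<close>; letting \<open>l \<rightarrow> 0\<close> yields symmetry in every hyperplane through the origin.

  For \<open>p < 2\<close> the power \<open>u\<^sup>p\<^sup>-\<^sup>1\<close> is not Lipschitz at the boundary; this is compensated by \<open>V \<le> C s\<close> and the
  Hopf-type bound \<open>u \<ge> c s\<close>.
\<close>

section \<open>Reflections and Lebesgue measure\<close>

text \<open>The equation is available only in weak form and the solution only as a continuous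
  function in H^1_0, so every comparison is made by inserting a test function. Three requirements
  shape these test functions. They must be limits of C^1 functions with compact support in the ball,
  so a positive part enters only through a C^1 function of it with bounded derivative. Both the test
  function on the cap and its mirror image must be admissible: \<open>l \<ge> 0\<close> keeps the
  mirror image inside the ball, and positivity of the solution allows nonnegative approximants, for
  which the truncated difference vanishes near the sphere. Finally, mirror points may leave the
  ball, so the solution and the Green kernel are extended by zero. The smallness threshold for the
  bad set depends neither on the direction nor on the level of the hyperplane. Openness of the
  admissible levels therefore needs only that the measures of the bad sets tend to 0, which
  strictness inside the cap and continuity provide.\<close>

definition hrefl :: "'a::euclidean_space \<Rightarrow> real \<Rightarrow> 'a \<Rightarrow> 'a" where
  "hrefl e l x = x - (2 * (x \<bullet> e - l)) *\<^sub>R e"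

lemma hrefl_inner: "norm e = 1 \<Longrightarrow> hrefl e l x \<bullet> e = 2 * l - x \<bullet> e"
  by (simp add: hrefl_def inner_diff_left dot_square_norm)

lemma hrefl_hrefl [simp]: "norm e = 1 \<Longrightarrow> hrefl e l (hrefl e l x) = x"
  unfolding hrefl_def[of e l "hrefl e l x"] hrefl_inner by (simp add: hrefl_def algebra_simps)

lemma hrefl_diff: "hrefl e l x - hrefl e l y = hrefl e 0 (x - y)"
  by (simp add: hrefl_def algebra_simps inner_diff_left)

lemma hrefl_eq_plus: "hrefl e l x = (2 * l) *\<^sub>R e + hrefl e 0 x"
  by (simp add: hrefl_def algebra_simps)

lemma hrefl_adjoint: "hrefl e 0 x \<bullet> y = x \<bullet> hrefl e 0 y"
  by (simp add: hrefl_def algebra_simps inner_diff_left inner_diff_right inner_commute)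

lemma norm_hrefl_0 [simp]: "norm e = 1 \<Longrightarrow> norm (hrefl e 0 x) = norm x"
  by (metis norm_eq_sqrt_inner hrefl_adjoint hrefl_hrefl)

lemma dist_hrefl: "norm e = 1 \<Longrightarrow> norm (hrefl e l x - hrefl e l y) = norm (x - y)"
  by (simp add: hrefl_diff)

lemma dist_hrefl_swap: "norm e = 1 \<Longrightarrow> norm (hrefl e l x - y) = norm (x - hrefl e l y)"
  using dist_hrefl[of e l x "hrefl e l y"] by simp

text \<open>The subtracted term shows that for \<open>l \<ge> 0\<close> the reflection brings points
  beyond the plane closer to the origin, so a cap of the ball is reflected into the ball.\<close>

lemma norm_hrefl_sq: "norm e = 1 \<Longrightarrow> (norm (hrefl e l x))\<^sup>2 = (norm x)\<^sup>2 - 4 * l * (x \<bullet> e - l)"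
proof -
  assume "norm e = 1"
  then have "e \<bullet> e = 1" by (simp add: norm_eq_1)
  then show ?thesis
    unfolding power2_norm_eq_inner hrefl_def
    by (simp only: inner_diff_left inner_diff_right inner_scaleR_left inner_scaleR_right inner_commute[of e x])
       (simp add: algebra_simps power2_eq_square)
qed

text \<open>The correction is four times the product of the signed distances to the plane: for two
  points on the same side, reflecting one of them increases the distance.\<close>

lemma dist_hrefl_sq: "norm e = 1 \<Longrightarrow>
  (norm (x - hrefl e l y))\<^sup>2 = (norm (x - y))\<^sup>2 + 4 * (x \<bullet> e - l) * (y \<bullet> e - l)"
proof -
  assume "norm e = 1"
  then have "e \<bullet> e = 1" by (simp add: norm_eq_1)
  then show ?thesis
    unfolding power2_norm_eq_inner hrefl_def
    by (simp only: inner_diff_left inner_diff_right inner_scaleR_left inner_scaleR_right inner_commute[of e x] inner_commute[of e y] inner_commute[of y x])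
       (simp add: algebra_simps power2_eq_square)
qed

lemma hrefl_fixed: "x \<bullet> e = l \<Longrightarrow> hrefl e l x = x"
  by (simp add: hrefl_def)

lemma linear_hrefl_0: "linear (hrefl e 0)"
  by (rule linearI) (simp_all add: hrefl_def algebra_simps inner_add_left)

lemma continuous_on_hrefl [continuous_intros]:
  "continuous_on S f \<Longrightarrow> continuous_on S (\<lambda>x. hrefl e l (f x))"
  unfolding hrefl_def by (intro continuous_intros)

lemma continuous_hrefl: "continuous_on S (hrefl e l)"
  using continuous_on_hrefl[OF continuous_on_id] by simp

lemma hrefl_measurable [measurable]: "hrefl e l \<in> borel_measurable borel"
  by (intro borel_measurable_continuous_onI continuous_hrefl)

lemma has_derivative_hrefl: "(hrefl e l has_derivative hrefl e 0) (at x)"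
proof -
  have "((\<lambda>x. (2 * l) *\<^sub>R e + hrefl e 0 x) has_derivative (\<lambda>h. 0 + hrefl e 0 h)) (at x)"
    by (intro has_derivative_add has_derivative_const linear_imp_has_derivative linear_hrefl_0)
  then show ?thesis
    unfolding hrefl_eq_plus[of e l, abs_def] by simp
qed

text \<open>The linear part is orthogonal and an involution, so preimages of boxes are orthogonal
  images and keep their measure; the general reflection is the linear one followed by the
  translation by \<open>(2 * l) *\<^sub>R e\<close>.\<close>

lemma lborel_distr_hrefl:
  fixes e :: "real^'n::{finite,wellorder}"
  assumes e: "norm e = 1"
  shows "distr lborel borel (hrefl e l) = lborel"
proof -
  have ot: "orthogonal_transformation (hrefl e 0)"
    using e by (simp add: orthogonal_transformation linear_hrefl_0)
  have 0: "lborel = distr lborel borel (hrefl e 0)"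
  proof (rule lborel_eqI)
    fix a b :: "real^'n::{finite,wellorder}" assume ab: "\<And>i. i \<in> Basis \<Longrightarrow> a \<bullet> i \<le> b \<bullet> i"
    have vi: "hrefl e 0 -` box a b = hrefl e 0 ` box a b"
      using e by (auto intro!: image_eqI[of _ _ "hrefl e 0 _"])
    have mb: "box a b \<in> lmeasurable" by simp
    have m1: "hrefl e 0 ` box a b \<in> lmeasurable"
      by (rule measurable_orthogonal_image[OF ot mb])
    have vs: "hrefl e 0 -` box a b \<in> sets borel"
      using measurable_sets[OF hrefl_measurable, of "box a b" e 0] by simp
    have "emeasure (distr lborel borel (hrefl e 0)) (box a b) = emeasure lborel (hrefl e 0 -` box a b)"
      by (subst emeasure_distr) auto
    also have "\<dots> = emeasure lebesgue (hrefl e 0 -` box a b)"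
      using vs by simp
    also have "\<dots> = emeasure lebesgue (hrefl e 0 ` box a b)" by (simp add: vi)
    also have "\<dots> = ennreal (measure lebesgue (hrefl e 0 ` box a b))"
      using m1 by (simp add: emeasure_eq_measure2)
    also have "\<dots> = ennreal (measure lebesgue (box a b))"
      by (subst measure_orthogonal_image[OF ot mb]) (rule refl)
    also have "\<dots> = emeasure lborel (box a b)"
      using mb by (simp add: emeasure_eq_measure2)
    also have "\<dots> = (\<Prod>i\<in>Basis. (b - a) \<bullet> i)"
      using ab by (rule emeasure_lborel_box)
    finally show "emeasure (distr lborel borel (hrefl e 0)) (box a b) = ennreal (\<Prod>i\<in>Basis. (b - a) \<bullet> i)" .
  qed simp
  have "distr lborel borel (hrefl e l) = distr (distr lborel borel (hrefl e 0)) borel ((+) ((2 * l) *\<^sub>R e))"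
  proof -
    have "(+) ((2 * l) *\<^sub>R e) \<circ> hrefl e 0 = hrefl e l"
      by (rule ext) (simp only: comp_def hrefl_eq_plus[of e l])
    then show ?thesis by (subst distr_distr) auto
  qed
  then show ?thesis
    using 0 lborel_distr_plus by metis
qed

lemma nn_integral_hrefl:
  fixes e :: "real^'n::{finite,wellorder}"
  assumes "norm e = 1" "f \<in> borel_measurable borel"
  shows "(\<integral>\<^sup>+x. f (hrefl e l x) \<partial>lborel) = (\<integral>\<^sup>+x. f x \<partial>lborel)"
  using nn_integral_distr[of "hrefl e l" lborel borel f] lborel_distr_hrefl[OF assms(1), of l] assms by simp

lemma integral_hrefl:
  fixes e :: "real^'n::{finite,wellorder}" and f :: "_ \<Rightarrow> real"
  assumes "norm e = 1" "f \<in> borel_measurable borel"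
  shows "(LINT x|lborel. f (hrefl e l x)) = (LINT x|lborel. f x)"
  using integral_distr[of "hrefl e l" lborel borel f] lborel_distr_hrefl[OF assms(1), of l] assms by simp

lemma integrable_hrefl:
  fixes e :: "real^'n::{finite,wellorder}" and f :: "_ \<Rightarrow> real"
  assumes "norm e = 1" "integrable lborel f"
  shows "integrable lborel (\<lambda>x. f (hrefl e l x))"
  using integrable_distr[of "hrefl e l" lborel borel f] lborel_distr_hrefl[OF assms(1), of l] assms by simp

lemma AE_hrefl:
  fixes e :: "real^'n::{finite,wellorder}"
  assumes e: "norm e = 1" and P: "AE x in lborel. P x"
  shows "AE x in lborel. P (hrefl e l x)"
proof -
  have "AE x in distr lborel borel (hrefl e l). P x"
    using P unfolding lborel_distr_hrefl[OF e] .
  from AE_distrD[OF _ this] show ?thesis by simp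
qed

lemma nn_integral_translate:
  fixes c :: "'a::euclidean_space"
  assumes "f \<in> borel_measurable borel"
  shows "(\<integral>\<^sup>+x. f (x + c) \<partial>lborel) = (\<integral>\<^sup>+x. f x \<partial>lborel)"
  using nn_integral_distr[of "(+) c" lborel borel f] lborel_distr_plus[of c] assms by (simp add: add.commute)

lemma integrable_compact_support:
  fixes f :: "'a::euclidean_space \<Rightarrow> 'b::{banach, second_countable_topology}"
  assumes "continuous_on UNIV f" "compact K" "\<And>x. x \<notin> K \<Longrightarrow> f x = 0"
  shows "integrable lborel f"
proof -
  have "integrable lborel (\<lambda>x. indicator K x *\<^sub>R f x)"
    using assms(1,2) by (intro borel_integrable_compact) (auto intro: continuous_on_subset)
  also have "(\<lambda>x. indicator K x *\<^sub>R f x) = f"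
    using assms(3) by (auto simp: fun_eq_iff indicator_def)
  finally show ?thesis .
qed

text \<open>Dyadic shells: on the n-th one the integrand is a constant, and the resulting geometric
  series converges because the exponent exceeds minus the dimension.\<close>
lemma integrable_norm_powr:
  fixes r a :: real
  assumes r: "r > 0" and a: "a \<le> 0" "a > - real DIM('a)"
  shows "integrable lborel (\<lambda>z::'a::euclidean_space. indicator (ball 0 r) z * norm z powr a)"
proof (rule integrableI_bounded)
  let ?N = "real DIM('a)"
  define c where "c = measure lborel (ball (0::'a) 1)"
  \<comment> \<open>Halving the radius multiplies the volume by \<open>2 powr (- ?N)\<close> and the
    bound for the integrand by \<open>2 powr (- a)\<close>; the product is the ratio of the
    geometric series.\<close>
  define q where "q = 2 powr (- a - ?N)"
  have q: "0 < q" "q < 1" using a by (auto simp: q_def powr_less_one)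
  have "(\<integral>\<^sup>+(z::'a). ennreal (norm (indicator (ball 0 r) z * norm z powr a)) \<partial>lborel)
     \<le> (\<integral>\<^sup>+z. (\<Sum>n. ennreal ((r / 2^(Suc n)) powr a) * indicator (ball (0::'a) (r / 2^n)) z) \<partial>lborel)"
  proof (intro nn_integral_mono)
    fix z :: 'a
    show "ennreal (norm (indicator (ball 0 r) z * norm z powr a))
       \<le> (\<Sum>n. ennreal ((r / 2^(Suc n)) powr a) * indicator (ball (0::'a) (r / 2^n)) z)"
    proof (cases "z \<noteq> 0 \<and> z \<in> ball 0 r")
      case True
      obtain m where "inverse 2 ^ m < norm z / r"
        using real_arch_pow_inv[of "norm z / r" "inverse 2"] True r by (auto simp: divide_pos_pos)
      then have ex: "\<exists>m. r / 2^m \<le> norm z" using r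
        by (intro exI[of _ m]) (simp add: field_simps)
      \<comment> \<open>The shell containing \<open>z\<close>: with \<open>m = Suc n\<close>, the
        point lies in the ball of radius \<open>r / 2^n\<close> but outside the one of radius
        \<open>r / 2^(Suc n)\<close>.\<close>
      define m where "m = (LEAST m. r / 2^m \<le> norm z)"
      have m1: "r / 2^m \<le> norm z" unfolding m_def by (rule LeastI_ex[OF ex])
      have "m \<noteq> 0" using m1 True by (intro notI) simp
      then obtain n where n: "m = Suc n" by (cases m) auto
      have n2: "norm z < r / 2^n"
        using not_less_Least[of n "\<lambda>m. r / 2^m \<le> norm z"] n by (simp add: m_def)
      have "ennreal (norm (indicator (ball 0 r) z * norm z powr a)) = ennreal (norm z powr a)"
        using True by simp
      also have "\<dots> \<le> ennreal ((r / 2^(Suc n)) powr a)"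
        using m1 n r a by (intro ennreal_leI powr_mono2') auto
      also have "\<dots> = (\<Sum>j\<in>{n}. ennreal ((r / 2^(Suc j)) powr a) * indicator (ball (0::'a) (r / 2^j)) z)"
        using n2 by simp
      also have "\<dots> \<le> (\<Sum>n. ennreal ((r / 2^(Suc n)) powr a) * indicator (ball (0::'a) (r / 2^n)) z)"
        by (rule sum_le_suminf) auto
      finally show ?thesis .
    qed auto
  qed
  also have "\<dots> = (\<Sum>n. \<integral>\<^sup>+z. ennreal ((r / 2^(Suc n)) powr a) * indicator (ball (0::'a) (r / 2^n)) z \<partial>lborel)"
    apply (rule nn_integral_suminf)
    apply (intro borel_measurable_times_ennreal borel_measurable_const borel_measurable_indicator)
    apply simp
    done
  also have "\<dots> = (\<Sum>n. ennreal ((r/2) powr a * r powr ?N * c * q ^ n))"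
  proof (intro suminf_cong)
    fix n
    have "(\<integral>\<^sup>+z. ennreal ((r / 2^(Suc n)) powr a) * indicator (ball (0::'a) (r / 2^n)) z \<partial>lborel)
        = ennreal ((r / 2^(Suc n)) powr a) * emeasure lborel (ball (0::'a) (r / 2^n))"
      by (subst nn_integral_cmult_indicator) auto
    also have "emeasure lborel (ball (0::'a) (r / 2^n)) = ennreal (measure lborel (ball (0::'a) (r / 2^n)))"
      using emeasure_lborel_ball_finite[of "0::'a" "r/2^n"] by (intro emeasure_eq_ennreal_measure) auto
    also have "measure lborel (ball (0::'a) (r / 2^n)) = (r / 2^n) ^ DIM('a) * c"
      unfolding c_def using r by (intro content_ball_conv_unit_ball) auto
    also have "ennreal ((r / 2^(Suc n)) powr a) * ennreal ((r / 2^n) ^ DIM('a) * c)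
        = ennreal ((r / 2^(Suc n)) powr a * ((r / 2^n) ^ DIM('a) * c))"
      by (simp add: ennreal_mult')
    also have "(r / 2^(Suc n)) powr a * ((r / 2^n) ^ DIM('a) * c) = (r/2) powr a * r powr ?N * c * q ^ n"
    proof -
      have 1: "(r / 2^(Suc n)) powr a = (r/2) powr a * (2 powr (- a)) ^ n"
      proof -
        have "r / 2^(Suc n) = (r/2) * 2 powr (- real n)"
          by (simp add: powr_minus powr_realpow field_simps)
        then have "(r / 2^(Suc n)) powr a = (r/2) powr a * (2 powr (- real n)) powr a"
          using r by (simp only: powr_mult)
        also have "(2 powr (- real n)) powr a = (2 powr (- a)) ^ n"
          by (simp add: powr_powr powr_power mult.commute)
        finally show ?thesis .
      qed
      have 2: "(r / 2^n) ^ DIM('a) = r powr ?N * (2 powr (- ?N)) ^ n"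
        using r by (simp add: power_divide powr_realpow powr_minus field_simps power_mult[symmetric] mult.commute)
      show ?thesis unfolding 1 2 q_def
        by (simp add: power_mult_distrib[symmetric] powr_add[symmetric] mult.assoc mult.left_commute)
    qed
    finally show "(\<integral>\<^sup>+z. ennreal ((r / 2^(Suc n)) powr a) * indicator (ball (0::'a) (r / 2^n)) z \<partial>lborel)
       = ennreal ((r/2) powr a * r powr ?N * c * q ^ n)" .
  qed
  also have "\<dots> = ennreal (\<Sum>n. (r/2) powr a * r powr ?N * c * q ^ n)"
    using q by (intro suminf_ennreal2) (auto simp: c_def intro!: summable_mult summable_geometric)
  also have "\<dots> < \<infinity>" by simp
  finally show "(\<integral>\<^sup>+(z::'a). ennreal (norm (indicator (ball 0 r) z * norm z powr a)) \<partial>lborel) < \<infinity>" .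
qed (auto intro!: borel_measurable_times borel_measurable_indicator powr_real_measurable)

section \<open>Continuously differentiable functions of compact support\<close>

lemma mult_self_le: "a * b \<le> a\<^sup>2 + (b::real)\<^sup>2"
  using sum_squares_bound[of a b] zero_le_power2[of a] zero_le_power2[of b] by linarith

lemma ball_pred [measurable]: "Measurable.pred borel (\<lambda>x. x \<in> ball (c::'a::euclidean_space) r)"
  by (simp add: pred_def)

text \<open>Outside the compact set the function is locally constant, so the same set also carries
  the gradient.\<close>

lemma C1c_ballE:
  assumes "C1c_ball R \<phi> D"
  obtains K where "compact K" "K \<subseteq> ball 0 R" "\<And>x. x \<notin> K \<Longrightarrow> \<phi> x = 0" "\<And>x. x \<notin> K \<Longrightarrow> D x = 0"
proof -
  from assms obtain K where K: "compact K" "K \<subseteq> ball 0 R" "\<And>x. x \<notin> K \<Longrightarrow> \<phi> x = 0"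
    unfolding C1c_ball_def by blast
  have "D x = 0" if x: "x \<notin> K" for x
  proof -
    have "(\<phi> has_derivative (\<lambda>h. D x \<bullet> h)) (at x)"
      using assms by (simp add: C1c_ball_def)
    moreover have "(\<phi> has_derivative (\<lambda>h. 0)) (at x)"
    proof (rule has_derivative_transform_within_open)
      show "((\<lambda>x. 0) has_derivative (\<lambda>h. 0)) (at x)" by simp
      show "open (- K)" using K(1) by (simp add: open_Compl compact_imp_closed)
      show "x \<in> - K" using x by simp
      show "\<And>y. y \<in> - K \<Longrightarrow> 0 = \<phi> y" using K(3) by simp
    qed
    ultimately have "(\<lambda>h. D x \<bullet> h) = (\<lambda>h. 0)" by (rule has_derivative_unique)
    then have "D x \<bullet> D x = 0" by meson
    then show ?thesis by simp
  qed
  with K that show thesis by blast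
qed

lemma C1c_ballD:
  assumes "C1c_ball R \<phi> D"
  shows "(\<phi> has_derivative (\<lambda>h. D x \<bullet> h)) (at x)" "continuous_on UNIV D" "continuous_on UNIV \<phi>"
    "\<phi> \<in> borel_measurable borel" "D \<in> borel_measurable borel"
    "x \<notin> ball 0 R \<Longrightarrow> \<phi> x = 0" "x \<notin> ball 0 R \<Longrightarrow> D x = 0"
proof -
  obtain K where K: "compact K" "K \<subseteq> ball 0 R" "\<And>x. x \<notin> K \<Longrightarrow> \<phi> x = 0" "\<And>x. x \<notin> K \<Longrightarrow> D x = 0"
    using C1c_ballE[OF assms] by metis
  show d: "(\<phi> has_derivative (\<lambda>h. D x \<bullet> h)) (at x)" for x
    using assms by (simp add: C1c_ball_def)
  show D: "continuous_on UNIV D" using assms by (simp add: C1c_ball_def)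
  show c: "continuous_on UNIV \<phi>"
    using d by (meson has_derivative_continuous continuous_at_imp_continuous_on)
  show "\<phi> \<in> borel_measurable borel" "D \<in> borel_measurable borel"
    using c D by (auto intro: borel_measurable_continuous_onI)
  show "x \<notin> ball 0 R \<Longrightarrow> \<phi> x = 0" "x \<notin> ball 0 R \<Longrightarrow> D x = 0"
    using K(2-4) by blast+
qed

lemma bounded_compact_support:
  fixes f :: "'a::euclidean_space \<Rightarrow> 'b::real_normed_vector"
  assumes "continuous_on UNIV f" "compact K" "\<And>x. x \<notin> K \<Longrightarrow> f x = 0"
  obtains B where "B > 0" "\<And>x. norm (f x) \<le> B"
proof -
  have "bounded (f ` K)"
    using assms by (intro compact_imp_bounded compact_continuous_image) (auto intro: continuous_on_subset)
  then obtain B where "B > 0" "\<And>x. x \<in> K \<Longrightarrow> norm (f x) \<le> B"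
    by (auto simp: bounded_pos)
  with assms(3) that[of B] show thesis
    by (metis less_imp_le norm_zero)
qed

lemma C1c_bounded:
  assumes "C1c_ball R \<phi> D"
  obtains B where "B > 0" "\<And>x. norm (D x) \<le> B" "\<And>x. \<bar>\<phi> x\<bar> \<le> B"
proof -
  obtain K where K: "compact K" "K \<subseteq> ball 0 R" "\<And>x. x \<notin> K \<Longrightarrow> \<phi> x = 0" "\<And>x. x \<notin> K \<Longrightarrow> D x = 0"
    using C1c_ballE[OF assms] by metis
  obtain B1 where B1: "B1 > 0" "\<And>x. norm (D x) \<le> B1"
    using bounded_compact_support[OF C1c_ballD(2)[OF assms] K(1,4)] by metis
  obtain B2 where B2: "B2 > 0" "\<And>x. norm (\<phi> x) \<le> B2"
    using bounded_compact_support[OF C1c_ballD(3)[OF assms] K(1,3)] by metis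
  show thesis
  proof (rule that[of "max B1 B2"])
    show "max B1 B2 > 0" using B1 by simp
    show "norm (D x) \<le> max B1 B2" for x using B1(2)[of x] by simp
    show "\<bar>\<phi> x\<bar> \<le> max B1 B2" for x using B2(2)[of x] by simp
  qed
qed

lemma C1c_directional:
  assumes "C1c_ball R \<phi> D"
  shows "((\<lambda>t. \<phi> (x + t *\<^sub>R h)) has_real_derivative D (x + t *\<^sub>R h) \<bullet> h) (at t within S)"
proof -
  have "((\<lambda>t. x + t *\<^sub>R h) has_derivative (\<lambda>s. s *\<^sub>R h)) (at t)"
    by (auto intro!: derivative_eq_intros)
  from has_derivative_compose[OF this C1c_ballD(1)[OF assms]]
  have "((\<lambda>t. \<phi> (x + t *\<^sub>R h)) has_derivative (\<lambda>s. D (x + t *\<^sub>R h) \<bullet> (s *\<^sub>R h))) (at t)" .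
  then have "((\<lambda>t. \<phi> (x + t *\<^sub>R h)) has_real_derivative D (x + t *\<^sub>R h) \<bullet> h) (at t)"
    unfolding has_field_derivative_def by (rule has_derivative_eq_rhs) (auto simp: fun_eq_iff)
  then show ?thesis by (rule has_field_derivative_at_within)
qed

text \<open>Difference quotients of a function with compact support have integral 0 by translation
  invariance, and they converge to the directional derivative under an integrable majorant.\<close>

lemma C1c_integral_zero:
  assumes "C1c_ball R \<phi> D"
  shows "integrable lborel (\<lambda>x. D x \<bullet> e)" "(LINT x|lborel. D x \<bullet> e) = 0"
proof -
  note C = C1c_ballD[OF assms]
  obtain K where K: "compact K" "K \<subseteq> ball 0 R" "\<And>x. x \<notin> K \<Longrightarrow> \<phi> x = 0" "\<And>x. x \<notin> K \<Longrightarrow> D x = 0"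
    using C1c_ballE[OF assms] by metis
  obtain B where B: "B > 0" "\<And>x. norm (D x) \<le> B" using C1c_bounded[OF assms] by metis
  have i\<phi>: "integrable lborel \<phi>" by (rule integrable_compact_support[OF C(3) K(1,3)])
  show "integrable lborel (\<lambda>x. D x \<bullet> e)"
    using K by (intro integrable_compact_support[of _ K] continuous_intros C(2)) auto
  define s where "s = (\<lambda>n x. real (Suc n) * (\<phi> (x + (1 / real (Suc n)) *\<^sub>R e) - \<phi> x))"
  have [measurable]: "\<phi> \<in> borel_measurable borel" "D \<in> borel_measurable borel" using C by auto
  have itr: "integrable lborel (\<lambda>x. \<phi> (c + x))" "(LINT x|lborel. \<phi> (c + x)) = (LINT x|lborel. \<phi> x)" for c
    using integrable_distr[of "(+) c" lborel borel \<phi>] integral_distr[of "(+) c" lborel borel \<phi>]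
      lborel_distr_plus[of c] i\<phi> by simp_all
  have s0: "(LINT x|lborel. s n x) = 0" for n
  proof -
    have "(LINT x|lborel. s n x) = real (Suc n) * (LINT x|lborel. \<phi> ((1 / real (Suc n)) *\<^sub>R e + x) - \<phi> x)"
      unfolding s_def by (simp add: add.commute)
    also have "(LINT x|lborel. \<phi> ((1 / real (Suc n)) *\<^sub>R e + x) - \<phi> x) = 0"
      by (subst Bochner_Integration.integral_diff) (use itr i\<phi> in auto)
    finally show ?thesis by simp
  qed
  have "(\<lambda>n. LINT x|lborel. s n x) \<longlonglongrightarrow> (LINT x|lborel. D x \<bullet> e)"
  proof (rule integral_dominated_convergence)
    \<comment> \<open>All shifts have length at most \<open>norm e\<close>, so the quotients vanish
      outside this enlarged ball; the mean value inequality bounds them by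
      \<open>B * norm e\<close>.\<close>
    show "integrable lborel (\<lambda>x. indicator (cball 0 (R + norm e)) x *\<^sub>R (B * norm e))"
      by (intro borel_integrable_compact continuous_intros) auto
    show "AE x in lborel. (\<lambda>n. s n x) \<longlonglongrightarrow> D x \<bullet> e"
    proof (intro AE_I2)
      fix x
      have "((\<lambda>t. \<phi> (x + t *\<^sub>R e)) has_real_derivative D (x + 0 *\<^sub>R e) \<bullet> e) (at 0)"
        using C1c_directional[OF assms, of x e 0 UNIV] by simp
      then have "((\<lambda>t. (\<phi> (x + t *\<^sub>R e) - \<phi> x) / t) \<longlongrightarrow> D x \<bullet> e) (at 0)"
        by (simp add: DERIV_def)
      moreover have "(\<lambda>n. 1 / real (Suc n)) \<longlonglongrightarrow> 0"
        using LIMSEQ_inverse_real_of_nat by (simp add: inverse_eq_divide)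
      then have "filterlim (\<lambda>n. 1 / real (Suc n)) (at 0) sequentially"
        by (rule filterlim_atI) auto
      ultimately have "(\<lambda>n. (\<phi> (x + (1 / real (Suc n)) *\<^sub>R e) - \<phi> x) / (1 / real (Suc n))) \<longlonglongrightarrow> D x \<bullet> e"
        by (rule filterlim_compose)
      then show "(\<lambda>n. s n x) \<longlonglongrightarrow> D x \<bullet> e" by (simp add: s_def mult.commute)
    qed
    show "AE x in lborel. norm (s n x) \<le> indicator (cball 0 (R + norm e)) x *\<^sub>R (B * norm e)" for n
    proof (intro AE_I2)
      fix x
      let ?c = "(1 / real (Suc n)) *\<^sub>R e"
      have nc: "norm ?c \<le> norm e" by (simp add: divide_simps mult_le_cancel_left1)
      show "norm (s n x) \<le> indicator (cball 0 (R + norm e)) x *\<^sub>R (B * norm e)"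
      proof (cases "x \<in> cball 0 (R + norm e)")
        case True
        have "norm (\<phi> (x + ?c) - \<phi> x) \<le> B * norm (x + ?c - x)"
        proof (rule differentiable_bound[of UNIV])
          show "(\<phi> has_derivative (\<lambda>h. D z \<bullet> h)) (at z within UNIV)" for z using C(1) by simp
          show "onorm (\<lambda>h. D z \<bullet> h) \<le> B" for z
            using B(1) Cauchy_Schwarz_ineq2[of "D z"] mult_right_mono[OF B(2)[of z] norm_ge_zero]
            by (intro onorm_le) (auto intro: order_trans)
        qed auto
        then have "\<bar>\<phi> (x + ?c) - \<phi> x\<bar> \<le> B * (norm e / real (Suc n))" by simp
        then have "real (Suc n) * \<bar>\<phi> (x + ?c) - \<phi> x\<bar> \<le> real (Suc n) * (B * (norm e / real (Suc n)))"
          by (rule mult_left_mono) simp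
        also have "\<dots> = B * norm e" by (simp add: field_simps)
        finally show ?thesis using True by (simp add: s_def abs_mult)
      next
        case False
        then have 1: "norm x > R + norm e" by simp
        then have "\<not> norm (x + ?c) < R" using nc norm_diff_ineq[of x ?c] by linarith
        then have "\<phi> (x + ?c) = 0" "\<phi> x = 0"
          using C(6)[of "x + ?c"] C(6)[of x] 1 norm_ge_zero[of e] by (auto simp del: norm_ge_zero)
        then show ?thesis using B(1) by (simp add: s_def)
      qed
    qed
  qed (auto simp: s_def)
  with s0 show "(LINT x|lborel. D x \<bullet> e) = 0"
    by (simp add: LIMSEQ_const_iff)
qed

lemma C1c_mult:
  assumes "C1c_ball R \<psi> E" and f: "\<And>x. (f has_derivative (\<lambda>h. Df x \<bullet> h)) (at x)" "continuous_on UNIV Df"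
  shows "C1c_ball R (\<lambda>x. f x * \<psi> x) (\<lambda>x. f x *\<^sub>R E x + \<psi> x *\<^sub>R Df x)"
proof -
  note C = C1c_ballD[OF assms(1)]
  obtain K where K: "compact K" "K \<subseteq> ball 0 R" "\<And>x. x \<notin> K \<Longrightarrow> \<psi> x = 0"
    using C1c_ballE[OF assms(1)] by metis
  have cf: "continuous_on UNIV f"
    using f(1) by (meson has_derivative_continuous continuous_at_imp_continuous_on)
  show ?thesis unfolding C1c_ball_def
  proof (intro conjI allI)
    show "((\<lambda>x. f x * \<psi> x) has_derivative (\<lambda>h. (f x *\<^sub>R E x + \<psi> x *\<^sub>R Df x) \<bullet> h)) (at x)" for x
      by (rule has_derivative_eq_rhs[OF has_derivative_mult[OF f(1) C(1)]])
         (auto simp: inner_add_left algebra_simps)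
    show "continuous_on UNIV (\<lambda>x. f x *\<^sub>R E x + \<psi> x *\<^sub>R Df x)"
      by (intro continuous_intros cf C f)
    show "\<exists>K. compact K \<and> K \<subseteq> ball 0 R \<and> (\<forall>x. x \<notin> K \<longrightarrow> f x * \<psi> x = 0)"
      using K by auto
  qed
qed

text \<open>Compact support of \<open>\<psi>\<close> alone suffices: the product with
  \<open>f\<close> is then again a test function, and its derivative integrates to 0.\<close>

lemma C1c_integration_by_parts:
  assumes "C1c_ball R \<psi> E" and f: "\<And>x. (f has_derivative (\<lambda>h. Df x \<bullet> h)) (at x)" "continuous_on UNIV Df"
  shows "integrable lborel (\<lambda>x. f x * (E x \<bullet> e))" "integrable lborel (\<lambda>x. \<psi> x * (Df x \<bullet> e))"
    "(LINT x|lborel. f x * (E x \<bullet> e)) = - (LINT x|lborel. \<psi> x * (Df x \<bullet> e))"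
proof -
  note C = C1c_ballD[OF assms(1)]
  obtain K where K: "compact K" "\<And>x. x \<notin> K \<Longrightarrow> \<psi> x = 0" "\<And>x. x \<notin> K \<Longrightarrow> E x = 0"
    using C1c_ballE[OF assms(1)] by metis
  have cf: "continuous_on UNIV f"
    using f(1) by (meson has_derivative_continuous continuous_at_imp_continuous_on)
  show i: "integrable lborel (\<lambda>x. f x * (E x \<bullet> e))" "integrable lborel (\<lambda>x. \<psi> x * (Df x \<bullet> e))"
    using K by (auto intro!: integrable_compact_support[of _ K] continuous_intros C(2,3) cf f)
  have "(LINT x|lborel. f x * (E x \<bullet> e) + \<psi> x * (Df x \<bullet> e)) = 0"
    using C1c_integral_zero(2)[OF C1c_mult[OF assms], of e] by (simp add: inner_add_left)
  then show "(LINT x|lborel. f x * (E x \<bullet> e)) = - (LINT x|lborel. \<psi> x * (Df x \<bullet> e))"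
    using i by simp
qed

text \<open>Along the segment from \<open>x\<close> to \<open>x + h\<close> the increment is the
  mean of the directional derivative, so its square is at most the mean of the squares; integration
  over \<open>x\<close> and translation invariance finish the bound.\<close>

lemma C1c_translation_estimate:
  fixes h :: "real^'n::idx"
  assumes "C1c_ball R \<phi> D"
  shows "(\<integral>\<^sup>+x. ennreal ((\<phi> (x + h) - \<phi> x)\<^sup>2) \<partial>lborel) \<le> ennreal ((norm h)\<^sup>2) * (\<integral>\<^sup>+x. ennreal ((norm (D x))\<^sup>2) \<partial>lborel)"
proof -
  note C = C1c_ballD[OF assms]
  have [measurable]: "\<phi> \<in> borel_measurable borel" "D \<in> borel_measurable borel" using C by auto
  have 1: "ennreal ((\<phi> (x + h) - \<phi> x)\<^sup>2) \<le>
      (\<integral>\<^sup>+t. indicator {0..1::real} t * ennreal ((norm h)\<^sup>2 * (norm (D (x + t *\<^sub>R h)))\<^sup>2) \<partial>lborel)" for x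
  proof -
    define f where "f = (\<lambda>t. D (x + t *\<^sub>R h) \<bullet> h)"
    define c where "c = \<phi> (x + h) - \<phi> x"
    have cf: "continuous_on {0..1} f" unfolding f_def
      by (intro continuous_intros continuous_on_compose2[OF C(2)]) auto
    have F: "(LINT t|lborel. indicator {0..1} t *\<^sub>R f t) = c"
    proof -
      have "(LINT t|lborel. indicator {0..1} t *\<^sub>R f t) = \<phi> (x + 1 *\<^sub>R h) - \<phi> (x + 0 *\<^sub>R h)"
      proof (rule integral_FTC_atLeastAtMost)
        show "((\<lambda>t. \<phi> (x + t *\<^sub>R h)) has_vector_derivative f t) (at t within {0..1})" for t
          unfolding f_def using C1c_directional[OF assms, of x h t]
          by (simp add: has_real_derivative_iff_has_vector_derivative)
      qed (use cf in auto)
      then show ?thesis by (simp add: c_def)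
    qed
    have i0: "integrable lborel (\<lambda>t. indicator {0..1} t *\<^sub>R f t)"
      by (intro borel_integrable_compact cf) auto
    have i1: "integrable lborel (\<lambda>t. indicator {0..1} t *\<^sub>R (f t)\<^sup>2)"
      by (intro borel_integrable_compact continuous_intros cf) auto
    have i2: "integrable lborel (\<lambda>t. indicator {0..1::real} t *\<^sub>R (c\<^sup>2))"
      by (intro borel_integrable_compact continuous_intros) auto
    \<comment> \<open>Nonnegativity of the variance takes the place of Jensen's inequality.\<close>
    have "0 \<le> (LINT t|lborel. indicator {0..1} t *\<^sub>R (f t - c)\<^sup>2)"
      by (rule integral_nonneg_AE) auto
    also have "(\<lambda>t. indicator {0..1} t *\<^sub>R (f t - c)\<^sup>2)
       = (\<lambda>t. indicator {0..1} t *\<^sub>R (f t)\<^sup>2 - 2 * c * (indicator {0..1} t *\<^sub>R f t) + indicator {0..1::real} t *\<^sub>R (c\<^sup>2))"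
      by (auto simp: fun_eq_iff power2_eq_square algebra_simps)
    also have "(LINT t|lborel. \<dots> t) = (LINT t|lborel. indicator {0..1} t *\<^sub>R (f t)\<^sup>2) - 2 * c * c + c\<^sup>2"
      using i0 i1 i2 F by simp
    finally have "c\<^sup>2 \<le> (LINT t|lborel. indicator {0..1} t *\<^sub>R (f t)\<^sup>2)"
      by (simp add: power2_eq_square)
    then have "ennreal (c\<^sup>2) \<le> ennreal (LINT t|lborel. indicator {0..1} t *\<^sub>R (f t)\<^sup>2)"
      by (rule ennreal_leI)
    also have "\<dots> = (\<integral>\<^sup>+t. ennreal (indicator {0..1} t *\<^sub>R (f t)\<^sup>2) \<partial>lborel)"
      using i1 by (intro nn_integral_eq_integral[symmetric]) auto
    also have "\<dots> \<le> (\<integral>\<^sup>+t. indicator {0..1::real} t * ennreal ((norm h)\<^sup>2 * (norm (D (x + t *\<^sub>R h)))\<^sup>2) \<partial>lborel)"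
    proof (intro nn_integral_mono)
      fix t
      have "(f t)\<^sup>2 \<le> (norm (D (x + t *\<^sub>R h)) * norm h)\<^sup>2"
        unfolding f_def by (rule power2_le_iff_abs_le[THEN iffD2]) (auto simp: Cauchy_Schwarz_ineq2)
      then show "ennreal (indicator {0..1} t *\<^sub>R (f t)\<^sup>2)
         \<le> indicator {0..1::real} t * ennreal ((norm h)\<^sup>2 * (norm (D (x + t *\<^sub>R h)))\<^sup>2)"
        by (auto simp: indicator_def power_mult_distrib mult.commute intro!: ennreal_leI)
    qed
    finally show ?thesis by (simp add: c_def)
  qed
  have "(\<integral>\<^sup>+x. ennreal ((\<phi> (x + h) - \<phi> x)\<^sup>2) \<partial>lborel)
     \<le> (\<integral>\<^sup>+x. (\<integral>\<^sup>+t. indicator {0..1::real} t * ennreal ((norm h)\<^sup>2 * (norm (D (x + t *\<^sub>R h)))\<^sup>2) \<partial>lborel) \<partial>lborel)"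
    by (intro nn_integral_mono 1)
  also have "\<dots> = (\<integral>\<^sup>+t. (\<integral>\<^sup>+x. indicator {0..1::real} t * ennreal ((norm h)\<^sup>2 * (norm (D (x + t *\<^sub>R h)))\<^sup>2) \<partial>lborel) \<partial>lborel)"
    by (rule lborel_pair.Fubini'[symmetric]) measurable
  also have "\<dots> = (\<integral>\<^sup>+t. indicator {0..1::real} t * (ennreal ((norm h)\<^sup>2) * (\<integral>\<^sup>+x. ennreal ((norm (D x))\<^sup>2) \<partial>lborel)) \<partial>lborel)"
  proof (intro nn_integral_cong)
    fix t :: real
    have "(\<integral>\<^sup>+x. indicator {0..1::real} t * ennreal ((norm h)\<^sup>2 * (norm (D (x + t *\<^sub>R h)))\<^sup>2) \<partial>lborel)
      = indicator {0..1::real} t * (\<integral>\<^sup>+x. ennreal ((norm h)\<^sup>2) * ennreal ((norm (D (x + t *\<^sub>R h)))\<^sup>2) \<partial>lborel)"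
      by (subst nn_integral_cmult) (auto simp: ennreal_mult)
    also have "(\<integral>\<^sup>+x. ennreal ((norm h)\<^sup>2) * ennreal ((norm (D (x + t *\<^sub>R h)))\<^sup>2) \<partial>lborel)
      = ennreal ((norm h)\<^sup>2) * (\<integral>\<^sup>+x. ennreal ((norm (D (x + t *\<^sub>R h)))\<^sup>2) \<partial>lborel)"
      by (rule nn_integral_cmult) measurable
    also have "(\<integral>\<^sup>+x. ennreal ((norm (D (x + t *\<^sub>R h)))\<^sup>2) \<partial>lborel) = (\<integral>\<^sup>+x. ennreal ((norm (D x))\<^sup>2) \<partial>lborel)"
      by (rule nn_integral_translate) measurable
    finally show "(\<integral>\<^sup>+x. indicator {0..1::real} t * ennreal ((norm h)\<^sup>2 * (norm (D (x + t *\<^sub>R h)))\<^sup>2) \<partial>lborel)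
      = indicator {0..1::real} t * (ennreal ((norm h)\<^sup>2) * (\<integral>\<^sup>+x. ennreal ((norm (D x))\<^sup>2) \<partial>lborel))" .
  qed
  also have "\<dots> = ennreal ((norm h)\<^sup>2) * (\<integral>\<^sup>+x. ennreal ((norm (D x))\<^sup>2) \<partial>lborel)"
    by (subst nn_integral_multc) auto
  finally show ?thesis .
qed

text \<open>The squared norm of L^2, with values in the extended reals so that estimates and limits
  carry no integrability conditions.\<close>

definition l2sq :: "('a::euclidean_space \<Rightarrow> 'b::euclidean_space) \<Rightarrow> ennreal" where
  "l2sq f = (\<integral>\<^sup>+x. ennreal ((norm (f x))\<^sup>2) \<partial>lborel)"

section \<open>Convergence in the mean square and weak gradients\<close>

lemma tendsto_power2_zeroD:
  fixes f :: "'a \<Rightarrow> real"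
  assumes "((\<lambda>n. (f n)\<^sup>2) \<longlongrightarrow> 0) F"
  shows "(f \<longlongrightarrow> 0) F"
  using tendsto_real_sqrt[OF assms] by (simp add: tendsto_rabs_zero_iff)

lemma norm_add_sq_le: "(norm (a + b))\<^sup>2 \<le> 2 * (norm a)\<^sup>2 + 2 * (norm (b::'b::real_normed_vector))\<^sup>2"
proof -
  have "(norm (a + b))\<^sup>2 \<le> (norm a + norm b)\<^sup>2"
    by (intro power_mono norm_triangle_ineq) simp
  also have "\<dots> \<le> 2 * (norm a)\<^sup>2 + 2 * (norm b)\<^sup>2"
    using sum_squares_bound[of "norm a" "norm b"] by (simp add: power2_sum)
  finally show ?thesis .
qed

lemma l2sq_add:
  assumes [measurable]: "f \<in> borel_measurable borel" "g \<in> borel_measurable borel"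
  shows "l2sq (\<lambda>x. f x + g x) \<le> 2 * l2sq f + 2 * l2sq g"
proof -
  have "l2sq (\<lambda>x. f x + g x) \<le> (\<integral>\<^sup>+x. 2 * ennreal ((norm (f x))\<^sup>2) + 2 * ennreal ((norm (g x))\<^sup>2) \<partial>lborel)"
    unfolding l2sq_def
  proof (intro nn_integral_mono)
    fix x
    have "ennreal ((norm (f x + g x))\<^sup>2) \<le> ennreal (2 * (norm (f x))\<^sup>2 + 2 * (norm (g x))\<^sup>2)"
      by (intro ennreal_leI norm_add_sq_le)
    then show "ennreal ((norm (f x + g x))\<^sup>2) \<le> 2 * ennreal ((norm (f x))\<^sup>2) + 2 * ennreal ((norm (g x))\<^sup>2)"
      by (simp add: ennreal_mult)
  qed
  also have "\<dots> = 2 * l2sq f + 2 * l2sq g"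
    unfolding l2sq_def by (simp add: nn_integral_add nn_integral_cmult)
  finally show ?thesis .
qed

lemma l2sq_le_AE:
  assumes [measurable]: "g \<in> borel_measurable borel" and "0 \<le> L" "AE x in lborel. norm (f x) \<le> L * norm (g x)"
  shows "l2sq f \<le> ennreal (L\<^sup>2) * l2sq g"
proof -
  have "l2sq f \<le> (\<integral>\<^sup>+x. ennreal (L\<^sup>2) * ennreal ((norm (g x))\<^sup>2) \<partial>lborel)"
    unfolding l2sq_def
  proof (rule nn_integral_mono_AE)
    show "AE x in lborel. ennreal ((norm (f x))\<^sup>2) \<le> ennreal (L\<^sup>2) * ennreal ((norm (g x))\<^sup>2)"
      using assms(3)
    proof eventually_elim
      fix x assume "norm (f x) \<le> L * norm (g x)"
      then have "(norm (f x))\<^sup>2 \<le> (L * norm (g x))\<^sup>2" by (rule power_mono) simp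
      then show "ennreal ((norm (f x))\<^sup>2) \<le> ennreal (L\<^sup>2) * ennreal ((norm (g x))\<^sup>2)"
        using assms(2) by (simp add: ennreal_mult[symmetric] power_mult_distrib ennreal_leI)
    qed
  qed
  also have "\<dots> = ennreal (L\<^sup>2) * l2sq g"
    unfolding l2sq_def by (rule nn_integral_cmult) measurable
  finally show ?thesis .
qed

lemma l2sq_le:
  assumes "g \<in> borel_measurable borel" "0 \<le> L" "\<And>x. norm (f x) \<le> L * norm (g x)"
  shows "l2sq f \<le> ennreal (L\<^sup>2) * l2sq g"
  using assms by (intro l2sq_le_AE) auto

lemma l2sq_add_tendsto:
  assumes m: "\<And>k. F k \<in> borel_measurable borel" "\<And>k. G k \<in> borel_measurable borel"
    and "(\<lambda>k. l2sq (F k)) \<longlonglongrightarrow> 0" "(\<lambda>k. l2sq (G k)) \<longlonglongrightarrow> 0"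
  shows "(\<lambda>k. l2sq (\<lambda>x. F k x + G k x)) \<longlonglongrightarrow> 0"
proof (rule tendsto_sandwich[OF _ _ tendsto_const])
  show "\<forall>\<^sub>F k in sequentially. l2sq (\<lambda>x. F k x + G k x) \<le> 2 * l2sq (F k) + 2 * l2sq (G k)"
    by (intro always_eventually allI l2sq_add m)
  have "(\<lambda>k. 2 * l2sq (F k) + 2 * l2sq (G k)) \<longlonglongrightarrow> 2 * 0 + 2 * 0"
    by (intro tendsto_add ennreal_tendsto_cmult assms) auto
  then show "(\<lambda>k. 2 * l2sq (F k) + 2 * l2sq (G k)) \<longlonglongrightarrow> 0" by simp
qed simp

lemma l2sq_tendsto_le:
  assumes "\<And>k. G k \<in> borel_measurable borel" "0 \<le> L" "\<And>k. AE x in lborel. norm (F k x) \<le> L * norm (G k x)"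
    and "(\<lambda>k. l2sq (G k)) \<longlonglongrightarrow> 0"
  shows "(\<lambda>k. l2sq (F k)) \<longlonglongrightarrow> 0"
proof (rule tendsto_sandwich[OF _ _ tendsto_const])
  show "\<forall>\<^sub>F k in sequentially. l2sq (F k) \<le> ennreal (L\<^sup>2) * l2sq (G k)"
    by (intro always_eventually allI l2sq_le_AE assms)
  have "(\<lambda>k. ennreal (L\<^sup>2) * l2sq (G k)) \<longlonglongrightarrow> ennreal (L\<^sup>2) * 0"
    by (intro ennreal_tendsto_cmult assms) auto
  then show "(\<lambda>k. ennreal (L\<^sup>2) * l2sq (G k)) \<longlonglongrightarrow> 0" by simp
qed simp

text \<open>Serves for factors that converge only pointwise, such as the derivative of a truncation
  along an approximating sequence.\<close>

lemma l2sq_dominated: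
  fixes F :: "nat \<Rightarrow> 'a::euclidean_space \<Rightarrow> 'b::euclidean_space"
  assumes [measurable]: "\<And>k. F k \<in> borel_measurable borel" "w \<in> borel_measurable borel"
    and "\<And>k. AE x in lborel. norm (F k x) \<le> norm (w x)" "l2sq w < \<infinity>" "AE x in lborel. (\<lambda>k. F k x) \<longlonglongrightarrow> 0"
  shows "(\<lambda>k. l2sq (F k)) \<longlonglongrightarrow> 0"
proof -
  have "(\<lambda>k. \<integral>\<^sup>+x. ennreal ((norm (F k x))\<^sup>2) \<partial>lborel) \<longlonglongrightarrow> (\<integral>\<^sup>+(x::'a). 0 \<partial>lborel)"
  proof (rule nn_integral_dominated_convergence[where w = "\<lambda>x. ennreal ((norm (w x))\<^sup>2)" and u' = "\<lambda>_. 0"])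
    show "AE x in lborel. ennreal ((norm (F j x))\<^sup>2) \<le> ennreal ((norm (w x))\<^sup>2)" for j
      using assms(3)[of j] by eventually_elim (intro ennreal_leI power_mono, auto)
    show "(\<integral>\<^sup>+x. ennreal ((norm (w x))\<^sup>2) \<partial>lborel) < \<infinity>"
      using assms(4) by (simp add: l2sq_def)
    show "AE x in lborel. (\<lambda>k. ennreal ((norm (F k x))\<^sup>2)) \<longlonglongrightarrow> 0"
      using assms(5)
    proof eventually_elim
      fix x assume "(\<lambda>k. F k x) \<longlonglongrightarrow> 0"
      then have "(\<lambda>k. (norm (F k x))\<^sup>2) \<longlonglongrightarrow> (norm (0::'b))\<^sup>2"
        by (intro tendsto_intros)
      then show "(\<lambda>k. ennreal ((norm (F k x))\<^sup>2)) \<longlonglongrightarrow> 0"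
        using tendsto_ennrealI by fastforce
    qed
  qed measurable
  then show ?thesis by (simp add: l2sq_def)
qed

lemma l2sq_hrefl:
  fixes e :: "real^'n::{finite,wellorder}"
  assumes "norm e = 1" and [measurable]: "f \<in> borel_measurable borel"
  shows "l2sq (\<lambda>x. f (hrefl e l x)) = l2sq f"
  unfolding l2sq_def using assms(1) by (intro nn_integral_hrefl[of e "\<lambda>x. ennreal ((norm (f x))\<^sup>2)"]) measurable

lemma l2sq_integrable:
  assumes [measurable]: "f \<in> borel_measurable borel" and "l2sq f < \<infinity>"
  shows "integrable lborel (\<lambda>x. (norm (f x))\<^sup>2)" "l2sq f = ennreal (LINT x|lborel. (norm (f x))\<^sup>2)"
proof -
  show i: "integrable lborel (\<lambda>x. (norm (f x))\<^sup>2)"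
    using assms(2) unfolding l2sq_def by (intro integrableI_bounded) (auto simp: l2sq_def)
  show "l2sq f = ennreal (LINT x|lborel. (norm (f x))\<^sup>2)"
    unfolding l2sq_def by (rule nn_integral_eq_integral[OF i]) auto
qed

lemma integrable_l2sq:
  assumes "integrable lborel (\<lambda>x. (norm (f x))\<^sup>2)"
  shows "l2sq f < \<infinity>"
  using nn_integral_eq_integral[OF assms] by (simp add: l2sq_def)

lemma l2_inner_integrable:
  fixes f g :: "'a::euclidean_space \<Rightarrow> 'b::euclidean_space"
  assumes [measurable]: "f \<in> borel_measurable borel" "g \<in> borel_measurable borel" and "l2sq f < \<infinity>" "l2sq g < \<infinity>"
  shows "integrable lborel (\<lambda>x. f x \<bullet> g x)"
proof (rule Bochner_Integration.integrable_bound)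
  show "integrable lborel (\<lambda>x. (norm (f x))\<^sup>2 + (norm (g x))\<^sup>2)"
    by (intro Bochner_Integration.integrable_add l2sq_integrable(1) assms)
  show "AE x in lborel. norm (f x \<bullet> g x) \<le> norm ((norm (f x))\<^sup>2 + (norm (g x))\<^sup>2)"
    using order_trans[OF Cauchy_Schwarz_ineq2 mult_self_le] by (intro AE_I2) simp
qed measurable

lemma l2_cauchy_schwarz:
  fixes f g :: "'a::euclidean_space \<Rightarrow> 'b::euclidean_space"
  assumes m: "f \<in> borel_measurable borel" "g \<in> borel_measurable borel" and "l2sq f < \<infinity>" "l2sq g < \<infinity>"
  shows "(LINT x|lborel. f x \<bullet> g x)\<^sup>2 \<le> (LINT x|lborel. (norm (f x))\<^sup>2) * (LINT x|lborel. (norm (g x))\<^sup>2)"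
proof -
  define A where "A = (LINT x|lborel. (norm (f x))\<^sup>2)"
  define B where "B = (LINT x|lborel. (norm (g x))\<^sup>2)"
  define C where "C = (LINT x|lborel. f x \<bullet> g x)"
  note i = l2sq_integrable(1)[OF m(1) assms(3)] l2sq_integrable(1)[OF m(2) assms(4)] l2_inner_integrable[OF assms]
  have nn: "A \<ge> 0" "B \<ge> 0" unfolding A_def B_def by (auto intro!: integral_nonneg_AE)
  have q: "0 \<le> A + 2 * t * C + t\<^sup>2 * B" for t
  proof -
    have "0 \<le> (LINT x|lborel. (norm (f x + t *\<^sub>R g x))\<^sup>2)"
      by (intro integral_nonneg_AE) auto
    also have "(\<lambda>x. (norm (f x + t *\<^sub>R g x))\<^sup>2) = (\<lambda>x. (norm (f x))\<^sup>2 + (2 * t * (f x \<bullet> g x) + t\<^sup>2 * (norm (g x))\<^sup>2))"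
      unfolding power2_norm_eq_inner
      by (rule ext) (simp add: inner_add_left inner_add_right inner_commute[of "g _" "f _"] algebra_simps power2_eq_square[of t])
    also have "(LINT x|lborel. \<dots> x) = A + (2 * t * C + t\<^sup>2 * B)"
      using i by (simp add: A_def B_def C_def)
    finally show ?thesis by simp
  qed
  have "C\<^sup>2 \<le> A * B"
  proof (cases "B = 0")
    case True
    have "C = 0"
    proof (rule ccontr)
      assume "C \<noteq> 0"
      \<comment> \<open>For \<open>B = 0\<close> the quadratic is affine in \<open>t\<close>, and at
        this point it takes the value -1.\<close>
      then show False using q[of "- (A + 1) / (2 * C)"] True by (simp add: field_simps)
    qed
    then show ?thesis using nn by simp
  next
    case False
    then have B: "B > 0" using nn by simp
    \<comment> \<open>The point \<open>- C / B\<close> minimises the quadratic.\<close>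
    have "0 \<le> B * (A + 2 * (- C / B) * C + (- C / B)\<^sup>2 * B)"
      using q[of "- C / B"] B by (intro mult_nonneg_nonneg) simp_all
    also have "\<dots> = A * B - C\<^sup>2" using B by (simp add: field_simps power2_eq_square)
    finally show ?thesis by simp
  qed
  then show ?thesis by (simp add: A_def B_def C_def)
qed

text \<open>Cauchy-Schwarz for the difference. Its norm is known to be finite only for large
  \<open>k\<close>, so the estimate holds eventually.\<close>

lemma l2_inner_tendsto:
  fixes F :: "nat \<Rightarrow> 'a::euclidean_space \<Rightarrow> 'b::euclidean_space"
  assumes m [measurable]: "\<And>k. F k \<in> borel_measurable borel" "f \<in> borel_measurable borel" "g \<in> borel_measurable borel"
    and fin: "l2sq f < \<infinity>" "l2sq g < \<infinity>" and lim: "(\<lambda>k. l2sq (\<lambda>x. F k x - f x)) \<longlonglongrightarrow> 0"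
  shows "(\<lambda>k. LINT x|lborel. F k x \<bullet> g x) \<longlonglongrightarrow> (LINT x|lborel. f x \<bullet> g x)"
proof -
  have ev: "\<forall>\<^sub>F k in sequentially. l2sq (\<lambda>x. F k x - f x) < \<infinity>"
    using order_tendstoD(2)[OF lim, of \<infinity>] by simp
  have "(\<lambda>k. enn2real (l2sq (\<lambda>x. F k x - f x))) \<longlonglongrightarrow> 0"
    using lim by (intro tendsto_enn2real) simp_all
  then have l1: "(\<lambda>k. enn2real (l2sq (\<lambda>x. F k x - f x)) * (LINT x|lborel. (norm (g x))\<^sup>2)) \<longlonglongrightarrow> 0"
    by (auto intro: tendsto_mult_left_zero)
  have "(\<lambda>k. ((LINT x|lborel. F k x \<bullet> g x) - (LINT x|lborel. f x \<bullet> g x))\<^sup>2) \<longlonglongrightarrow> 0"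
  proof (rule tendsto_sandwich[OF _ _ tendsto_const l1])
    show "\<forall>\<^sub>F k in sequentially. ((LINT x|lborel. F k x \<bullet> g x) - (LINT x|lborel. f x \<bullet> g x))\<^sup>2
       \<le> enn2real (l2sq (\<lambda>x. F k x - f x)) * (LINT x|lborel. (norm (g x))\<^sup>2)"
      using ev
    proof eventually_elim
      fix k assume k: "l2sq (\<lambda>x. F k x - f x) < \<infinity>"
      have m': "(\<lambda>x. F k x - f x) \<in> borel_measurable borel" by measurable
      have i1: "integrable lborel (\<lambda>x. (F k x - f x) \<bullet> g x)" and i2: "integrable lborel (\<lambda>x. f x \<bullet> g x)"
        using l2_inner_integrable[OF m' m(3) k fin(2)] l2_inner_integrable[OF m(2,3) fin] by auto
      have "(LINT x|lborel. F k x \<bullet> g x) = (LINT x|lborel. (F k x - f x) \<bullet> g x + f x \<bullet> g x)"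
        by (simp add: inner_diff_left)
      also have "\<dots> = (LINT x|lborel. (F k x - f x) \<bullet> g x) + (LINT x|lborel. f x \<bullet> g x)"
        using i1 i2 by simp
      finally have "((LINT x|lborel. F k x \<bullet> g x) - (LINT x|lborel. f x \<bullet> g x))\<^sup>2 = (LINT x|lborel. (F k x - f x) \<bullet> g x)\<^sup>2"
        by simp
      also have "\<dots> \<le> (LINT x|lborel. (norm (F k x - f x))\<^sup>2) * (LINT x|lborel. (norm (g x))\<^sup>2)"
        by (rule l2_cauchy_schwarz[OF m' m(3) k fin(2)])
      also have "(LINT x|lborel. (norm (F k x - f x))\<^sup>2) = enn2real (l2sq (\<lambda>x. F k x - f x))"
        using l2sq_integrable(2)[OF m' k] by (simp add: integral_nonneg_AE)
      finally show "((LINT x|lborel. F k x \<bullet> g x) - (LINT x|lborel. f x \<bullet> g x))\<^sup>2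
       \<le> enn2real (l2sq (\<lambda>x. F k x - f x)) * (LINT x|lborel. (norm (g x))\<^sup>2)" .
    qed
  qed simp
  then have "(\<lambda>k. (LINT x|lborel. F k x \<bullet> g x) - (LINT x|lborel. f x \<bullet> g x)) \<longlonglongrightarrow> 0"
    by (rule tendsto_power2_zeroD)
  then show ?thesis by (simp add: LIM_zero_iff)
qed

lemma C1c_l2:
  assumes "C1c_ball R \<phi> D"
  shows "l2sq \<phi> < \<infinity>" "l2sq D < \<infinity>"
proof -
  obtain K where K: "compact K" "K \<subseteq> ball 0 R" "\<And>x. x \<notin> K \<Longrightarrow> \<phi> x = 0" "\<And>x. x \<notin> K \<Longrightarrow> D x = 0"
    using C1c_ballE[OF assms] by metis
  show "l2sq \<phi> < \<infinity>"
    by (intro integrable_l2sq integrable_compact_support[OF _ K(1)] continuous_intros C1c_ballD(3)[OF assms])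
       (simp add: K)
  show "l2sq D < \<infinity>"
    by (intro integrable_l2sq integrable_compact_support[OF _ K(1)] continuous_intros C1c_ballD(2)[OF assms])
       (simp add: K)
qed

lemma l2sq_finite_add:
  assumes "f \<in> borel_measurable borel" "g \<in> borel_measurable borel" "l2sq f < \<infinity>" "l2sq g < \<infinity>"
  shows "l2sq (\<lambda>x. f x + g x) < \<infinity>"
proof -
  have "2 * l2sq f + 2 * l2sq g < \<infinity>" using assms by (simp add: ennreal_mult_less_top)
  with l2sq_add[OF assms(1,2)] show ?thesis by (rule le_less_trans)
qed

lemma l2sq_finite_le:
  assumes "g \<in> borel_measurable borel" "0 \<le> L" "\<And>x. norm (f x) \<le> L * norm (g x)" "l2sq g < \<infinity>"
  shows "l2sq f < \<infinity>"
proof -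
  have "ennreal (L\<^sup>2) * l2sq g < \<infinity>" using assms by (simp add: ennreal_mult_less_top)
  with l2sq_le[OF assms(1-3)] show ?thesis by (rule le_less_trans)
qed

lemma l2sq_minus: "l2sq (\<lambda>x. - f x) = l2sq f"
  by (simp add: l2sq_def)

lemma l2sq_commute: "l2sq (\<lambda>x. f x - g x) = l2sq (\<lambda>x. g x - f x)"
  by (simp add: l2sq_def norm_minus_commute)

section \<open>Elementary properties of functions with a weak gradient in
  \<open>H10_grad\<close>\<close>

lemma H10_grad_measurable:
  assumes "H10_grad R u g"
  shows "u \<in> borel_measurable borel" "g \<in> borel_measurable borel"
  using assms[unfolded H10_grad_def, THEN conjunct1]
    assms[unfolded H10_grad_def, THEN conjunct2, THEN conjunct1] by simp_all

text \<open>Convergence in the mean alone does not pass through nonlinear compositions, so one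
  subsequence is extracted along which function and gradient also converge almost
  everywhere.\<close>

lemma H10_gradE:
  fixes u :: "real^'n::idx \<Rightarrow> real"
  assumes "H10_grad R u g"
  obtains \<phi> D where "\<And>k::nat. C1c_ball R (\<phi> k) (D k)"
    "(\<lambda>k. l2sq (\<lambda>x. \<phi> k x - u x)) \<longlonglongrightarrow> 0" "(\<lambda>k. l2sq (\<lambda>x. D k x - g x)) \<longlonglongrightarrow> 0"
    "AE x in lborel. (\<lambda>k. \<phi> k x) \<longlonglongrightarrow> u x" "AE x in lborel. (\<lambda>k. D k x) \<longlonglongrightarrow> g x"
proof -
  have [measurable]: "u \<in> borel_measurable borel" "g \<in> borel_measurable borel"
    using H10_grad_measurable[OF assms] by auto
  from assms obtain \<phi> D where C: "\<And>k. C1c_ball R (\<phi> k) (D k)"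
    and i: "\<And>k. integrable lborel (\<lambda>x. (\<phi> k x - u x)^2 + (norm (D k x - g x))^2)"
    and lim: "(\<lambda>k. LINT x|lborel. (\<phi> k x - u x)^2 + (norm (D k x - g x))^2) \<longlonglongrightarrow> 0"
    unfolding H10_grad_def by blast
  have [measurable]: "\<phi> k \<in> borel_measurable borel" "D k \<in> borel_measurable borel" for k
    using C1c_ballD[OF C] by auto
  have lim': "(\<lambda>k. LINT x|lborel. norm ((\<phi> k x - u x)^2 + (norm (D k x - g x))^2)) \<longlonglongrightarrow> 0"
    using lim by simp
  obtain r where r: "strict_mono (r::nat\<Rightarrow>nat)"
    and AE: "AE x in lborel. (\<lambda>n. (\<phi> (r n) x - u x)^2 + (norm (D (r n) x - g x))^2) \<longlonglongrightarrow> 0"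
    using tendsto_L1_AE_subseq[OF i lim'] by blast
  have le: "(\<lambda>k. ennreal (LINT x|lborel. (\<phi> (r k) x - u x)^2 + (norm (D (r k) x - g x))^2)) \<longlonglongrightarrow> 0"
    using tendsto_ennrealI[OF LIMSEQ_subseq_LIMSEQ[OF lim r]] by (simp add: comp_def)
  have b: "ennreal (LINT x|lborel. (\<phi> k x - u x)^2 + (norm (D k x - g x))^2)
      = (\<integral>\<^sup>+x. ennreal ((\<phi> k x - u x)^2 + (norm (D k x - g x))^2) \<partial>lborel)" for k
    by (rule nn_integral_eq_integral[OF i, symmetric]) auto
  show thesis
  proof (rule that[of "\<lambda>k. \<phi> (r k)" "\<lambda>k. D (r k)"])
    show "C1c_ball R (\<phi> (r k)) (D (r k))" for k by (rule C)
    show "(\<lambda>k. l2sq (\<lambda>x. \<phi> (r k) x - u x)) \<longlonglongrightarrow> 0"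
      by (rule tendsto_sandwich[OF _ _ tendsto_const le])
         (auto simp del: ennreal_plus simp: b l2sq_def intro!: nn_integral_mono ennreal_leI always_eventually)
    show "(\<lambda>k. l2sq (\<lambda>x. D (r k) x - g x)) \<longlonglongrightarrow> 0"
      by (rule tendsto_sandwich[OF _ _ tendsto_const le])
         (auto simp del: ennreal_plus simp: b l2sq_def intro!: nn_integral_mono ennreal_leI always_eventually)
    show "AE x in lborel. (\<lambda>k. \<phi> (r k) x) \<longlonglongrightarrow> u x"
      using AE
    proof eventually_elim
      fix x assume "(\<lambda>n. (\<phi> (r n) x - u x)^2 + (norm (D (r n) x - g x))^2) \<longlonglongrightarrow> 0"
      then have "(\<lambda>n. (\<phi> (r n) x - u x)^2) \<longlonglongrightarrow> 0"
        by (rule tendsto_sandwich[OF _ _ tendsto_const, rotated 2]) auto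
      then show "(\<lambda>k. \<phi> (r k) x) \<longlonglongrightarrow> u x"
        by (metis LIM_zero_cancel tendsto_power2_zeroD)
    qed
    show "AE x in lborel. (\<lambda>k. D (r k) x) \<longlonglongrightarrow> g x"
      using AE
    proof eventually_elim
      fix x assume "(\<lambda>n. (\<phi> (r n) x - u x)^2 + (norm (D (r n) x - g x))^2) \<longlonglongrightarrow> 0"
      then have "(\<lambda>n. (norm (D (r n) x - g x))^2) \<longlonglongrightarrow> 0"
        by (rule tendsto_sandwich[OF _ _ tendsto_const, rotated 2]) auto
      then have "(\<lambda>n. norm (D (r n) x - g x)) \<longlonglongrightarrow> 0"
        by (rule tendsto_power2_zeroD)
      then show "(\<lambda>k. D (r k) x) \<longlonglongrightarrow> g x"
        by (simp add: tendsto_norm_zero_iff LIM_zero_iff)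
    qed
  qed
qed

lemma H10_gradI:
  fixes u :: "real^'n::idx \<Rightarrow> real"
  assumes [measurable]: "u \<in> borel_measurable borel" "g \<in> borel_measurable borel"
    and C: "\<And>k::nat. C1c_ball R (\<phi> k) (D k)"
    and lim: "(\<lambda>k. l2sq (\<lambda>x. \<phi> k x - u x)) \<longlonglongrightarrow> 0" "(\<lambda>k. l2sq (\<lambda>x. D k x - g x)) \<longlonglongrightarrow> 0"
  shows "H10_grad R u g"
proof -
  have [measurable]: "\<phi> k \<in> borel_measurable borel" "D k \<in> borel_measurable borel" for k
    using C1c_ballD[OF C] by auto
  have "\<forall>\<^sub>F k in sequentially. l2sq (\<lambda>x. \<phi> k x - u x) < \<infinity> \<and> l2sq (\<lambda>x. D k x - g x) < \<infinity>"
    using order_tendstoD(2)[OF lim(1), of \<infinity>] order_tendstoD(2)[OF lim(2), of \<infinity>] by (simp add: eventually_conj)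
  then obtain k0 where k0: "\<And>k. k \<ge> k0 \<Longrightarrow> l2sq (\<lambda>x. \<phi> k x - u x) < \<infinity> \<and> l2sq (\<lambda>x. D k x - g x) < \<infinity>"
    by (auto simp: eventually_sequentially)
  \<comment> \<open>The squared distances are finite only from \<open>k0\<close> on, while the
    definition asks for integrability at every index; the sequence is shifted accordingly.\<close>
  define \<psi> E where "\<psi> k = \<phi> (k + k0)" and "E k = D (k + k0)" for k
  have [measurable]: "\<psi> k \<in> borel_measurable borel" "E k \<in> borel_measurable borel" for k
    by (auto simp: \<psi>_def E_def)
  have f: "l2sq (\<lambda>x. \<psi> k x - u x) < \<infinity>" "l2sq (\<lambda>x. E k x - g x) < \<infinity>" for k
    using k0[of "k + k0"] by (auto simp: \<psi>_def E_def)
  have m: "(\<lambda>x. \<psi> k x - u x) \<in> borel_measurable borel" "(\<lambda>x. E k x - g x) \<in> borel_measurable borel" for k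
    by measurable
  note i1 = l2sq_integrable[OF m(1) f(1)] and i2 = l2sq_integrable[OF m(2) f(2)]
  have "(\<lambda>k. enn2real (l2sq (\<lambda>x. \<psi> k x - u x))) \<longlonglongrightarrow> 0"
    unfolding \<psi>_def using LIMSEQ_ignore_initial_segment[OF lim(1), of k0] by (intro tendsto_enn2real) simp_all
  then have l1: "(\<lambda>k. LINT x|lborel. (\<psi> k x - u x)\<^sup>2) \<longlonglongrightarrow> 0"
    by (simp add: i1(2))
  have "(\<lambda>k. enn2real (l2sq (\<lambda>x. E k x - g x))) \<longlonglongrightarrow> 0"
    unfolding E_def using LIMSEQ_ignore_initial_segment[OF lim(2), of k0] by (intro tendsto_enn2real) simp_all
  then have l2: "(\<lambda>k. LINT x|lborel. (norm (E k x - g x))\<^sup>2) \<longlonglongrightarrow> 0"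
    by (simp add: i2(2))
  have i1': "integrable lborel (\<lambda>x. (\<psi> k x - u x)\<^sup>2)" for k using i1(1)[of k] by simp
  show ?thesis unfolding H10_grad_def
  proof (intro conjI exI[of _ \<psi>] exI[of _ E] allI)
    show "C1c_ball R (\<psi> k) (E k)" for k using C by (simp add: \<psi>_def E_def)
    show "integrable lborel (\<lambda>x. (\<psi> k x - u x)\<^sup>2 + (norm (E k x - g x))\<^sup>2)" for k
      using i1' i2(1) by (rule Bochner_Integration.integrable_add)
    have "(LINT x|lborel. (\<psi> k x - u x)\<^sup>2 + (norm (E k x - g x))\<^sup>2)
        = (LINT x|lborel. (\<psi> k x - u x)\<^sup>2) + (LINT x|lborel. (norm (E k x - g x))\<^sup>2)" for k
      using i1' i2(1) by (rule Bochner_Integration.integral_add)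
    then show "(\<lambda>k. LINT x|lborel. (\<psi> k x - u x)\<^sup>2 + (norm (E k x - g x))\<^sup>2) \<longlonglongrightarrow> 0"
      using tendsto_add[OF l1 l2] by simp
  qed auto
qed

text \<open>Square integrability is not part of the definition of \<open>H10_grad\<close>; it is
  inherited from an approximant at finite distance.\<close>

lemma H10_grad_l2:
  assumes "H10_grad R u g"
  shows "l2sq u < \<infinity>" "l2sq g < \<infinity>"
proof -
  obtain \<phi> D where C: "\<And>k::nat. C1c_ball R (\<phi> k) (D k)"
    and l: "(\<lambda>k. l2sq (\<lambda>x. \<phi> k x - u x)) \<longlonglongrightarrow> 0" "(\<lambda>k. l2sq (\<lambda>x. D k x - g x)) \<longlonglongrightarrow> 0"
    and ae1: "AE x in lborel. (\<lambda>k. \<phi> k x) \<longlonglongrightarrow> u x" "AE x in lborel. (\<lambda>k. D k x) \<longlonglongrightarrow> g x"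
    by (rule H10_gradE[OF assms]) blast
  have [measurable]: "u \<in> borel_measurable borel" "g \<in> borel_measurable borel"
      "\<phi> k \<in> borel_measurable borel" "D k \<in> borel_measurable borel" for k
    using C1c_ballD[OF C] H10_grad_measurable[OF assms] by auto
  obtain k where k: "l2sq (\<lambda>x. \<phi> k x - u x) < \<infinity>"
    using order_tendstoD(2)[OF l(1), of \<infinity>] by (auto dest: eventually_happens)
  obtain j where j: "l2sq (\<lambda>x. D j x - g x) < \<infinity>"
    using order_tendstoD(2)[OF l(2), of \<infinity>] by (auto dest: eventually_happens)
  have "l2sq (\<lambda>x. (u x - \<phi> k x) + \<phi> k x) < \<infinity>"
    using k C1c_l2(1)[OF C] by (intro l2sq_finite_add) (auto simp: l2sq_commute[of u])
  then show "l2sq u < \<infinity>" by simp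
  have "l2sq (\<lambda>x. (g x - D j x) + D j x) < \<infinity>"
    using j C1c_l2(2)[OF C] by (intro l2sq_finite_add) (auto simp: l2sq_commute[of g])
  then show "l2sq g < \<infinity>" by simp
qed

lemma H10_grad_outside:
  assumes "H10_grad R u g"
  shows "AE x in lborel. x \<notin> ball 0 R \<longrightarrow> u x = 0 \<and> g x = 0"
proof -
  obtain \<phi> D where C: "\<And>k::nat. C1c_ball R (\<phi> k) (D k)"
    and lm: "(\<lambda>k. l2sq (\<lambda>x. \<phi> k x - u x)) \<longlonglongrightarrow> 0" "(\<lambda>k. l2sq (\<lambda>x. D k x - g x)) \<longlonglongrightarrow> 0"
    and l: "AE x in lborel. (\<lambda>k. \<phi> k x) \<longlonglongrightarrow> u x" "AE x in lborel. (\<lambda>k. D k x) \<longlonglongrightarrow> g x"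
    by (rule H10_gradE[OF assms]) blast
  from l show ?thesis
  proof eventually_elim
    fix x assume "(\<lambda>k. \<phi> k x) \<longlonglongrightarrow> u x" "(\<lambda>k. D k x) \<longlonglongrightarrow> g x"
    then show "x \<notin> ball 0 R \<longrightarrow> u x = 0 \<and> g x = 0"
      using C1c_ballD(6,7)[OF C] by (auto simp: LIMSEQ_const_iff)
  qed
qed

lemma C1c_lincomb:
  assumes "C1c_ball R \<phi> D" "C1c_ball R \<psi> E"
  shows "C1c_ball R (\<lambda>x. \<phi> x + t * \<psi> x) (\<lambda>x. D x + t *\<^sub>R E x)"
proof -
  obtain K where K: "compact K" "K \<subseteq> ball 0 R" "\<And>x. x \<notin> K \<Longrightarrow> \<phi> x = 0"
    using C1c_ballE[OF assms(1)] by metis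
  obtain L where L: "compact L" "L \<subseteq> ball 0 R" "\<And>x. x \<notin> L \<Longrightarrow> \<psi> x = 0"
    using C1c_ballE[OF assms(2)] by metis
  show ?thesis unfolding C1c_ball_def
  proof (intro conjI allI)
    show "((\<lambda>x. \<phi> x + t * \<psi> x) has_derivative (\<lambda>h. (D x + t *\<^sub>R E x) \<bullet> h)) (at x)" for x
      by (rule has_derivative_eq_rhs[OF has_derivative_add[OF C1c_ballD(1)[OF assms(1)]
            has_derivative_mult_right[OF C1c_ballD(1)[OF assms(2)]]]])
         (auto simp: inner_add_left)
    show "continuous_on UNIV (\<lambda>x. D x + t *\<^sub>R E x)"
      by (intro continuous_intros C1c_ballD(2)[OF assms(1)] C1c_ballD(2)[OF assms(2)])
    show "\<exists>K. compact K \<and> K \<subseteq> ball 0 R \<and> (\<forall>x. x \<notin> K \<longrightarrow> \<phi> x + t * \<psi> x = 0)"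
      using K L by (intro exI[of _ "K \<union> L"]) auto
  qed
qed

lemma H10_grad_lincomb:
  assumes "H10_grad R u g" "H10_grad R v gv"
  shows "H10_grad R (\<lambda>x. u x + t * v x) (\<lambda>x. g x + t *\<^sub>R gv x)"
proof -
  obtain \<phi> D where C1: "\<And>k::nat. C1c_ball R (\<phi> k) (D k)"
    and l1: "(\<lambda>k. l2sq (\<lambda>x. \<phi> k x - u x)) \<longlonglongrightarrow> 0" "(\<lambda>k. l2sq (\<lambda>x. D k x - g x)) \<longlonglongrightarrow> 0"
    and ae1: "AE x in lborel. (\<lambda>k. \<phi> k x) \<longlonglongrightarrow> u x" "AE x in lborel. (\<lambda>k. D k x) \<longlonglongrightarrow> g x"
    by (rule H10_gradE[OF assms(1)]) blast
  obtain \<psi> E where C2: "\<And>k::nat. C1c_ball R (\<psi> k) (E k)"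
    and l2: "(\<lambda>k. l2sq (\<lambda>x. \<psi> k x - v x)) \<longlonglongrightarrow> 0" "(\<lambda>k. l2sq (\<lambda>x. E k x - gv x)) \<longlonglongrightarrow> 0"
    and ae2: "AE x in lborel. (\<lambda>k. \<psi> k x) \<longlonglongrightarrow> v x" "AE x in lborel. (\<lambda>k. E k x) \<longlonglongrightarrow> gv x"
    by (rule H10_gradE[OF assms(2)]) blast
  have [measurable]: "u \<in> borel_measurable borel" "g \<in> borel_measurable borel" "v \<in> borel_measurable borel" "gv \<in> borel_measurable borel"
      "\<phi> k \<in> borel_measurable borel" "D k \<in> borel_measurable borel"
      "\<psi> k \<in> borel_measurable borel" "E k \<in> borel_measurable borel" for k
    using C1c_ballD[OF C1] C1c_ballD[OF C2] H10_grad_measurable[OF assms(1)] H10_grad_measurable[OF assms(2)] by auto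
  show ?thesis
  proof (rule H10_gradI[OF _ _ C1c_lincomb[OF C1 C2, where t = t]])
    have a: "(\<lambda>k. l2sq (\<lambda>x. t * (\<psi> k x - v x))) \<longlonglongrightarrow> 0"
      by (rule l2sq_tendsto_le[OF _ _ _ l2(1), of "\<bar>t\<bar>"]) (auto simp: abs_mult)
    have b: "(\<lambda>k. l2sq (\<lambda>x. t *\<^sub>R (E k x - gv x))) \<longlonglongrightarrow> 0"
      by (rule l2sq_tendsto_le[OF _ _ _ l2(2), of "\<bar>t\<bar>"]) auto
    show "(\<lambda>k. l2sq (\<lambda>x. \<phi> k x + t * \<psi> k x - (u x + t * v x))) \<longlonglongrightarrow> 0"
      using l2sq_add_tendsto[OF _ _ l1(1) a] by (simp add: algebra_simps)
    show "(\<lambda>k. l2sq (\<lambda>x. D k x + t *\<^sub>R E k x - (g x + t *\<^sub>R gv x))) \<longlonglongrightarrow> 0"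
      using l2sq_add_tendsto[OF _ _ l1(2) b] by (simp add: algebra_simps)
  qed auto
qed

text \<open>The sharp constant is 1, but a crude one avoids passing to the limit in the norms.\<close>
lemma H10_grad_translation_estimate:
  fixes h :: "real^'n::idx"
  assumes "H10_grad R u g"
  shows "l2sq (\<lambda>x. u (x + h) - u x) \<le> ennreal (4 * (norm h)\<^sup>2) * l2sq g"
proof -
  obtain \<phi> D where C: "\<And>k::nat. C1c_ball R (\<phi> k) (D k)"
    and l: "(\<lambda>k. l2sq (\<lambda>x. \<phi> k x - u x)) \<longlonglongrightarrow> 0" "(\<lambda>k. l2sq (\<lambda>x. D k x - g x)) \<longlonglongrightarrow> 0"
    and ae: "AE x in lborel. (\<lambda>k. \<phi> k x) \<longlonglongrightarrow> u x" "AE x in lborel. (\<lambda>k. D k x) \<longlonglongrightarrow> g x"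
    by (rule H10_gradE[OF assms]) blast
  have [measurable]: "u \<in> borel_measurable borel" "g \<in> borel_measurable borel"
      "\<phi> k \<in> borel_measurable borel" "D k \<in> borel_measurable borel" for k
    using C1c_ballD[OF C] H10_grad_measurable[OF assms] by auto
  have tr: "l2sq (\<lambda>x. f (x + h)) = l2sq f" if "f \<in> borel_measurable borel" for f :: "real^'n::idx \<Rightarrow> real"
    unfolding l2sq_def using that by (intro nn_integral_translate[of "\<lambda>x. ennreal ((norm (f x))\<^sup>2)"]) measurable
  have b: "l2sq (\<lambda>x. u (x + h) - u x) \<le> 2 * (ennreal ((norm h)\<^sup>2) * (2 * l2sq (\<lambda>x. D k x - g x) + 2 * l2sq g))
      + 2 * (2 * l2sq (\<lambda>x. \<phi> k x - u x) + 2 * l2sq (\<lambda>x. \<phi> k x - u x))" for k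
  proof -
    have "l2sq (\<lambda>x. (\<phi> k (x + h) - \<phi> k x) + ((u (x + h) - \<phi> k (x + h)) + (\<phi> k x - u x)))
      \<le> 2 * l2sq (\<lambda>x. \<phi> k (x + h) - \<phi> k x) + 2 * l2sq (\<lambda>x. (u (x + h) - \<phi> k (x + h)) + (\<phi> k x - u x))"
      by (rule l2sq_add) measurable
    also have "l2sq (\<lambda>x. \<phi> k (x + h) - \<phi> k x) \<le> ennreal ((norm h)\<^sup>2) * l2sq (D k)"
      using C1c_translation_estimate[OF C, of k h] by (simp add: l2sq_def)
    also have "l2sq (D k) \<le> 2 * l2sq (\<lambda>x. D k x - g x) + 2 * l2sq g"
      using l2sq_add[of "\<lambda>x. D k x - g x" g] by simp
    also have "l2sq (\<lambda>x. (u (x + h) - \<phi> k (x + h)) + (\<phi> k x - u x))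
       \<le> 2 * l2sq (\<lambda>x. u (x + h) - \<phi> k (x + h)) + 2 * l2sq (\<lambda>x. \<phi> k x - u x)"
      by (rule l2sq_add) measurable
    also have "l2sq (\<lambda>x. u (x + h) - \<phi> k (x + h)) = l2sq (\<lambda>x. \<phi> k x - u x)"
      using tr[of "\<lambda>x. u x - \<phi> k x"] by (simp add: l2sq_commute[of u])
    finally show ?thesis by (simp add: mult_left_mono add_mono)
  qed
  have "(\<lambda>k. 2 * (ennreal ((norm h)\<^sup>2) * (2 * l2sq (\<lambda>x. D k x - g x) + 2 * l2sq g))
      + 2 * (2 * l2sq (\<lambda>x. \<phi> k x - u x) + 2 * l2sq (\<lambda>x. \<phi> k x - u x)))
     \<longlonglongrightarrow> 2 * (ennreal ((norm h)\<^sup>2) * (2 * 0 + 2 * l2sq g)) + 2 * (2 * 0 + 2 * 0)"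
    by (intro tendsto_add ennreal_tendsto_cmult l tendsto_const) auto
  then have "l2sq (\<lambda>x. u (x + h) - u x) \<le> 2 * (ennreal ((norm h)\<^sup>2) * (2 * 0 + 2 * l2sq g)) + 2 * (2 * 0 + 2 * 0)"
    by (rule tendsto_lowerbound) (use b in auto)
  also have "\<dots> = (2 * 2 * ennreal ((norm h)\<^sup>2)) * l2sq g"
    by (simp add: ac_simps)
  also have "2 * 2 * ennreal ((norm h)\<^sup>2) = ennreal (4 * (norm h)\<^sup>2)"
    by (simp add: ennreal_mult)
  finally show ?thesis .
qed

text \<open>Polynomials are the test functions in the uniqueness proof for weak gradients, and
  integration by parts requires a continuous gradient.\<close>

lemma real_polynomial_function_C1:
  fixes f :: "'a::euclidean_space \<Rightarrow> real"
  assumes "real_polynomial_function f"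
  shows "\<exists>Df. (\<forall>x. (f has_derivative (\<lambda>h. Df x \<bullet> h)) (at x)) \<and> continuous_on UNIV Df"
  using assms
proof induction
  case (linear f)
  then have "(\<lambda>h. adjoint f 1 \<bullet> h) = f"
    using adjoint_works[OF bounded_linear.linear[OF linear], of _ 1] by (auto simp: fun_eq_iff inner_commute)
  then show ?case
    using bounded_linear_imp_has_derivative[OF linear] by (intro exI[of _ "\<lambda>x. adjoint f 1"]) auto
next
  case (const c)
  show ?case by (intro exI[of _ "\<lambda>x. 0"]) auto
next
  case (add f g)
  then obtain Df Dg where "\<And>x. (f has_derivative (\<lambda>h. Df x \<bullet> h)) (at x)" "continuous_on UNIV Df"
    "\<And>x. (g has_derivative (\<lambda>h. Dg x \<bullet> h)) (at x)" "continuous_on UNIV Dg" by auto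
  then show ?case
    by (intro exI[of _ "\<lambda>x. Df x + Dg x"])
       (auto simp: inner_add_left intro!: continuous_intros has_derivative_add)
next
  case (mult f g)
  then obtain Df Dg where *: "\<And>x. (f has_derivative (\<lambda>h. Df x \<bullet> h)) (at x)" "continuous_on UNIV Df"
    "\<And>x. (g has_derivative (\<lambda>h. Dg x \<bullet> h)) (at x)" "continuous_on UNIV Dg" by auto
  have "continuous_on UNIV f" "continuous_on UNIV g"
    using * by (meson has_derivative_continuous continuous_at_imp_continuous_on)+
  with * show ?case
    by (intro exI[of _ "\<lambda>x. f x *\<^sub>R Dg x + g x *\<^sub>R Df x"])
       (auto simp: inner_add_left mult.commute intro!: continuous_intros derivative_eq_intros)
qed

lemma l2sq_indicator_bounded:
  fixes f :: "'a::euclidean_space \<Rightarrow> 'b::euclidean_space"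
  assumes "\<And>x. x \<in> ball 0 R \<Longrightarrow> norm (f x) \<le> B"
  shows "l2sq (\<lambda>x. indicator (ball 0 R) x *\<^sub>R f x) < \<infinity>"
proof -
  have "l2sq (\<lambda>x. indicator (ball 0 R) x *\<^sub>R f x) \<le> (\<integral>\<^sup>+x. ennreal (B\<^sup>2) * indicator (ball (0::'a) R) x \<partial>lborel)"
    unfolding l2sq_def
  proof (intro nn_integral_mono)
    fix x :: 'a
    show "ennreal ((norm (indicator (ball 0 R) x *\<^sub>R f x))\<^sup>2) \<le> ennreal (B\<^sup>2) * indicator (ball 0 R) x"
      using assms[of x] by (cases "x \<in> ball 0 R") (auto intro!: ennreal_leI power_mono)
  qed
  also have "\<dots> < \<infinity>"
    using emeasure_lborel_ball_finite[of "0::'a" R] by (simp add: nn_integral_cmult_indicator ennreal_mult_less_top)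
  finally show ?thesis .
qed

lemma continuous_bounded_ball:
  fixes f :: "'a::euclidean_space \<Rightarrow> 'b::real_normed_vector"
  assumes "continuous_on (cball 0 R) f"
  obtains B where "B > 0" "\<And>x. x \<in> cball 0 R \<Longrightarrow> norm (f x) \<le> B"
proof -
  have "bounded (f ` cball 0 R)"
    using assms by (intro compact_imp_bounded compact_continuous_image) auto
  then show thesis using that by (auto simp: bounded_pos)
qed

text \<open>The gradient operator is closable: a gradient limit of a null sequence is orthogonal to all
  polynomials on the ball, hence by Weierstrass approximation to the approximating gradients.\<close>
lemma H10_grad_unique:
  fixes u :: "real^'n::idx \<Rightarrow> real"
  assumes "H10_grad R u g1" "H10_grad R u g2"
  shows "AE x in lborel. g1 x = g2 x"
proof -
  obtain \<phi> D where C1: "\<And>k::nat. C1c_ball R (\<phi> k) (D k)"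
    and l1: "(\<lambda>k. l2sq (\<lambda>x. \<phi> k x - u x)) \<longlonglongrightarrow> 0" "(\<lambda>k. l2sq (\<lambda>x. D k x - g1 x)) \<longlonglongrightarrow> 0"
    and ae: "AE x in lborel. (\<lambda>k. \<phi> k x) \<longlonglongrightarrow> u x" "AE x in lborel. (\<lambda>k. D k x) \<longlonglongrightarrow> g1 x"
    by (rule H10_gradE[OF assms(1)]) blast
  obtain \<psi> E where C2: "\<And>k::nat. C1c_ball R (\<psi> k) (E k)"
    and l2: "(\<lambda>k. l2sq (\<lambda>x. \<psi> k x - u x)) \<longlonglongrightarrow> 0" "(\<lambda>k. l2sq (\<lambda>x. E k x - g2 x)) \<longlonglongrightarrow> 0"
    and ae2: "AE x in lborel. (\<lambda>k. \<psi> k x) \<longlonglongrightarrow> u x" "AE x in lborel. (\<lambda>k. E k x) \<longlonglongrightarrow> g2 x"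
    by (rule H10_gradE[OF assms(2)]) blast
  have [measurable]: "u \<in> borel_measurable borel" "g1 \<in> borel_measurable borel" "g2 \<in> borel_measurable borel"
      "\<phi> k \<in> borel_measurable borel" "D k \<in> borel_measurable borel"
      "\<psi> k \<in> borel_measurable borel" "E k \<in> borel_measurable borel" for k
    using C1c_ballD[OF C1] C1c_ballD[OF C2] H10_grad_measurable[OF assms(1)] H10_grad_measurable[OF assms(2)] by auto
  \<comment> \<open>The differences tend to 0 in the mean while their gradients tend to
    \<open>d\<close>; it remains to show that \<open>d\<close> vanishes almost everywhere.\<close>
  define \<xi> F d where "\<xi> k x = \<phi> k x + (-1) * \<psi> k x" and "F k x = D k x + (-1) *\<^sub>R E k x"
    and "d x = g1 x - g2 x" for k x
  have C: "C1c_ball R (\<xi> k) (F k)" for k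
    using C1c_lincomb[OF C1[of k] C2[of k], of "-1"] unfolding \<xi>_def[abs_def] F_def[abs_def] .
  have mm: "d \<in> borel_measurable borel" "\<xi> k \<in> borel_measurable borel" "F k \<in> borel_measurable borel" for k
    unfolding d_def[abs_def] \<xi>_def[abs_def] F_def[abs_def] by measurable
  note [measurable] = mm
  have neg: "(\<lambda>k. l2sq (\<lambda>x. u x - \<psi> k x)) \<longlonglongrightarrow> 0" "(\<lambda>k. l2sq (\<lambda>x. g2 x - E k x)) \<longlonglongrightarrow> 0"
    using l2 by (simp_all add: l2sq_commute[of u] l2sq_commute[of g2])
  have l\<xi>: "(\<lambda>k. l2sq (\<lambda>x. \<xi> k x - 0)) \<longlonglongrightarrow> 0"
    using l2sq_add_tendsto[OF _ _ l1(1) neg(1)] by (simp add: \<xi>_def)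
  have lF: "(\<lambda>k. l2sq (\<lambda>x. F k x - d x)) \<longlonglongrightarrow> 0"
    using l2sq_add_tendsto[OF _ _ l1(2) neg(2)] by (simp add: F_def d_def algebra_simps)
  have "l2sq (\<lambda>x. g1 x + - g2 x) < \<infinity>"
    using H10_grad_l2(2)[OF assms(1)] H10_grad_l2(2)[OF assms(2)]
    by (intro l2sq_finite_add) (auto simp: l2sq_minus)
  then have fd: "l2sq d < \<infinity>" by (simp add: d_def[abs_def])
  let ?I = "\<lambda>x. indicator (ball (0::real^'n::idx) R) x :: real"
  have ip: "integrable lborel (\<lambda>x. (?I x * f x) * (d x \<bullet> e))" if cf: "continuous_on UNIV f" for f e
  proof -
    obtain B where B: "\<And>x. x \<in> cball 0 R \<Longrightarrow> norm (f x) \<le> B"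
      using continuous_bounded_ball[OF continuous_on_subset[OF cf subset_UNIV]] by metis
    have [measurable]: "f \<in> borel_measurable borel" using cf by (rule borel_measurable_continuous_onI)
    have "l2sq (\<lambda>x. ?I x *\<^sub>R (f x *\<^sub>R e)) < \<infinity>"
      using B by (intro l2sq_indicator_bounded[of _ _ "B * norm e"]) (auto intro!: mult_right_mono)
    then have "integrable lborel (\<lambda>x. d x \<bullet> (?I x *\<^sub>R (f x *\<^sub>R e)))"
      by (intro l2_inner_integrable fd) measurable
    then show ?thesis by (simp add: ac_simps)
  qed
  have orth_poly: "(LINT x|lborel. (?I x * P x) * (d x \<bullet> e)) = 0" if P: "real_polynomial_function P" for P e
  proof -
    obtain DP where DP: "\<And>x. (P has_derivative (\<lambda>h. DP x \<bullet> h)) (at x)" "continuous_on UNIV DP"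
      using real_polynomial_function_C1[OF P] by blast
    have cP: "continuous_on UNIV P"
      using DP by (meson has_derivative_continuous continuous_at_imp_continuous_on)
    have [measurable]: "P \<in> borel_measurable borel" "DP \<in> borel_measurable borel"
      using cP DP by (auto intro: borel_measurable_continuous_onI)
    obtain B where B: "\<And>x. x \<in> cball 0 R \<Longrightarrow> norm (P x) \<le> B"
      using continuous_bounded_ball[OF continuous_on_subset[OF cP subset_UNIV]] by metis
    obtain B' where B': "\<And>x. x \<in> cball 0 R \<Longrightarrow> norm (DP x) \<le> B'"
      using continuous_bounded_ball[OF continuous_on_subset[OF DP(2) subset_UNIV]] by metis
    have f1: "l2sq (\<lambda>x. ?I x *\<^sub>R (P x *\<^sub>R e)) < \<infinity>"
      using B by (intro l2sq_indicator_bounded[of _ _ "B * norm e"]) (auto intro!: mult_right_mono)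
    have f2: "l2sq (\<lambda>x. ?I x *\<^sub>R (DP x \<bullet> e)) < \<infinity>"
      using B' by (intro l2sq_indicator_bounded[of _ _ "B' * norm e"])
        (auto intro!: order_trans[OF Cauchy_Schwarz_ineq2] mult_right_mono)
    have "(\<lambda>k. LINT x|lborel. F k x \<bullet> (?I x *\<^sub>R (P x *\<^sub>R e))) \<longlonglongrightarrow> (LINT x|lborel. d x \<bullet> (?I x *\<^sub>R (P x *\<^sub>R e)))"
      by (intro l2_inner_tendsto fd f1 lF) measurable
    moreover have "(\<lambda>k. LINT x|lborel. \<xi> k x \<bullet> (?I x *\<^sub>R (DP x \<bullet> e))) \<longlonglongrightarrow> (LINT x|lborel. 0 \<bullet> (?I x *\<^sub>R (DP x \<bullet> e)))"
      by (intro l2_inner_tendsto f2 l\<xi>) (auto simp: l2sq_def)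
    moreover have "(LINT x|lborel. F k x \<bullet> (?I x *\<^sub>R (P x *\<^sub>R e))) = - (LINT x|lborel. \<xi> k x \<bullet> (?I x *\<^sub>R (DP x \<bullet> e)))" for k
    proof -
      have "(\<lambda>x. F k x \<bullet> (?I x *\<^sub>R (P x *\<^sub>R e))) = (\<lambda>x. P x * (F k x \<bullet> e))"
        using C1c_ballD(7)[OF C] by (auto simp: fun_eq_iff indicator_def)
      moreover have "(\<lambda>x. \<xi> k x \<bullet> (?I x *\<^sub>R (DP x \<bullet> e))) = (\<lambda>x. \<xi> k x * (DP x \<bullet> e))"
        using C1c_ballD(6)[OF C] by (auto simp: fun_eq_iff indicator_def)
      ultimately show ?thesis
        using C1c_integration_by_parts(3)[OF C DP, of k e] by simp
    qed
    ultimately have "(\<lambda>k. LINT x|lborel. \<xi> k x \<bullet> (?I x *\<^sub>R (DP x \<bullet> e))) \<longlonglongrightarrow> 0"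
      "(\<lambda>k. - (LINT x|lborel. \<xi> k x \<bullet> (?I x *\<^sub>R (DP x \<bullet> e)))) \<longlonglongrightarrow> (LINT x|lborel. d x \<bullet> (?I x *\<^sub>R (P x *\<^sub>R e)))"
      by simp_all
    then have "(LINT x|lborel. d x \<bullet> (?I x *\<^sub>R (P x *\<^sub>R e))) = - 0"
      by (intro LIMSEQ_unique[OF _ tendsto_minus])
    then have "(LINT x|lborel. d x \<bullet> (?I x *\<^sub>R (P x *\<^sub>R e))) = 0" by simp
    then show ?thesis by (simp add: ac_simps)
  qed
  have orth: "(LINT x|lborel. (?I x * f x) * (d x \<bullet> e)) = 0" if cf: "continuous_on UNIV f" for f e
  proof -
    define M where "M = (LINT x|lborel. \<bar>?I x * 1 * (d x \<bullet> e)\<bar>)"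
    have M: "M \<ge> 0" unfolding M_def by (intro integral_nonneg_AE) auto
    have i1: "integrable lborel (\<lambda>x. \<bar>?I x * 1 * (d x \<bullet> e)\<bar>)"
      using ip[of "\<lambda>x. 1" e] by (intro integrable_abs) auto
    have bd: "\<bar>LINT x|lborel. (?I x * f x) * (d x \<bullet> e)\<bar> \<le> \<epsilon> * M" if \<epsilon>: "\<epsilon> > 0" for \<epsilon>
    proof -
      from Stone_Weierstrass_polynomial_function[OF compact_cball continuous_on_subset[OF cf subset_UNIV] \<epsilon>, of 0 R]
      obtain P where P': "polynomial_function P \<and> (\<forall>x\<in>cball 0 R. norm (f x - P x) < \<epsilon>)" ..
      then have P: "polynomial_function P" "\<And>x. x \<in> cball 0 R \<Longrightarrow> norm (f x - P x) < \<epsilon>" by simp_all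
      have rP: "real_polynomial_function P" using P(1) by (simp add: real_polynomial_function_eq)
      have cP: "continuous_on UNIV P"
        using continuous_real_polymonial_function[OF rP] by (simp add: continuous_at_imp_continuous_on)
      have "(LINT x|lborel. (?I x * f x) * (d x \<bullet> e)) = (LINT x|lborel. (?I x * f x) * (d x \<bullet> e)) - (LINT x|lborel. (?I x * P x) * (d x \<bullet> e))"
        using orth_poly[OF rP] by simp
      also have "\<dots> = (LINT x|lborel. (?I x * f x) * (d x \<bullet> e) - (?I x * P x) * (d x \<bullet> e))"
        using ip[OF cf] ip[OF cP] by simp
      also have "\<bar>\<dots>\<bar> \<le> (LINT x|lborel. \<epsilon> * \<bar>?I x * 1 * (d x \<bullet> e)\<bar>)"
      proof (rule order_trans[OF integral_abs_bound integral_mono])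
        show "integrable lborel (\<lambda>x. \<bar>(?I x * f x) * (d x \<bullet> e) - (?I x * P x) * (d x \<bullet> e)\<bar>)"
          using ip[OF cf] ip[OF cP] by (intro integrable_abs Bochner_Integration.integrable_diff)
        show "integrable lborel (\<lambda>x. \<epsilon> * \<bar>?I x * 1 * (d x \<bullet> e)\<bar>)" using i1 by simp
        fix x
        show "\<bar>(?I x * f x) * (d x \<bullet> e) - (?I x * P x) * (d x \<bullet> e)\<bar> \<le> \<epsilon> * \<bar>?I x * 1 * (d x \<bullet> e)\<bar>"
        proof (cases "x \<in> ball 0 R")
          case True
          have "\<bar>f x - P x\<bar> * \<bar>d x \<bullet> e\<bar> \<le> \<epsilon> * \<bar>d x \<bullet> e\<bar>"
            using P(2)[of x] True by (intro mult_right_mono) auto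
          then show ?thesis using True by (simp add: left_diff_distrib[symmetric] abs_mult)
        qed simp
      qed
      also have "\<dots> = \<epsilon> * M" using i1 by (simp add: M_def)
      finally show ?thesis .
    qed
    have "\<bar>LINT x|lborel. (?I x * f x) * (d x \<bullet> e)\<bar> \<le> 0 + \<epsilon>" if "\<epsilon> > 0" for \<epsilon>
    proof -
      \<comment> \<open>The denominator \<open>M + 1\<close> covers the case
        \<open>M = 0\<close>.\<close>
      have "\<bar>LINT x|lborel. (?I x * f x) * (d x \<bullet> e)\<bar> \<le> (\<epsilon> / (M + 1)) * M"
        using bd[of "\<epsilon> / (M + 1)"] that M by simp
      also have "\<dots> \<le> \<epsilon>" using that M by (simp add: field_simps)
      finally show ?thesis by simp
    qed
    then have "\<bar>LINT x|lborel. (?I x * f x) * (d x \<bullet> e)\<bar> \<le> 0" by (rule field_le_epsilon)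
    then show ?thesis by simp
  qed
  have "AE x in lborel. d x \<bullet> e = 0" if e: "e \<in> Basis" for e
  proof -
    have f1: "l2sq (\<lambda>x. (d x \<bullet> e) *\<^sub>R e) < \<infinity>"
    proof (rule l2sq_finite_le[of d 1, OF _ _ _ fd])
      show "norm ((d x \<bullet> e) *\<^sub>R e) \<le> 1 * norm (d x)" for x
        using Basis_le_norm[OF e, of "d x"] norm_Basis[OF e] by simp
    qed simp_all
    \<comment> \<open>Each \<open>F k\<close> is continuous and vanishes outside the ball, hence is
      orthogonal to the components of \<open>d\<close>; since the limit of \<open>F k\<close> is
      \<open>d\<close> itself, the squared norm of this component is 0.\<close>
    have "(\<lambda>k. LINT x|lborel. F k x \<bullet> ((d x \<bullet> e) *\<^sub>R e)) \<longlonglongrightarrow> (LINT x|lborel. d x \<bullet> ((d x \<bullet> e) *\<^sub>R e))"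
      by (intro l2_inner_tendsto fd f1 lF) measurable
    moreover have "(LINT x|lborel. F k x \<bullet> ((d x \<bullet> e) *\<^sub>R e)) = 0" for k
    proof -
      have "(\<lambda>x. F k x \<bullet> ((d x \<bullet> e) *\<^sub>R e)) = (\<lambda>x. (?I x * (F k x \<bullet> e)) * (d x \<bullet> e))"
        using C1c_ballD(7)[OF C] by (auto simp: fun_eq_iff indicator_def)
      then show ?thesis
        using orth[of "\<lambda>x. F k x \<bullet> e" e] C1c_ballD(2)[OF C] by (simp add: continuous_on_inner)
    qed
    ultimately have z: "(LINT x|lborel. (d x \<bullet> e)\<^sup>2) = 0"
      by (simp add: LIMSEQ_const_iff power2_eq_square)
    have "integrable lborel (\<lambda>x. d x \<bullet> ((d x \<bullet> e) *\<^sub>R e))"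
      by (intro l2_inner_integrable fd f1) measurable
    then have "integrable lborel (\<lambda>x. (d x \<bullet> e)\<^sup>2)" by (simp add: power2_eq_square)
    from integral_nonneg_eq_0_iff_AE[OF this] z show ?thesis by simp
  qed
  then have "AE x in lborel. \<forall>e\<in>Basis. d x \<bullet> e = 0"
    by (intro AE_finite_allI) auto
  then show ?thesis
    by eventually_elim (metis d_def euclidean_all_zero_iff eq_iff_diff_eq_0)
qed

text \<open>The error in the gradient splits into \<open>\<beta>' (W k x)\<close> times
  \<open>G k x - g x\<close>, controlled by the bound \<open>L\<close>, and
  \<open>\<beta>' (W k x) - \<beta>' (w x)\<close> times \<open>g x\<close>, which tends to 0 by
  dominated convergence. The set \<open>\<Omega>\<close> allows the composition to be cut off by
  0.\<close>

lemma l2_comp_limit: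
  fixes w :: "'a::euclidean_space \<Rightarrow> real" and g :: "'a \<Rightarrow> 'b::euclidean_space" and W :: "nat \<Rightarrow> 'a \<Rightarrow> real"
  assumes [measurable]: "\<Omega> \<in> sets borel" "\<And>k. W k \<in> borel_measurable borel" "w \<in> borel_measurable borel"
      "\<And>k. G k \<in> borel_measurable borel" "g \<in> borel_measurable borel"
    and lip: "\<And>s t. \<bar>\<beta> s - \<beta> t\<bar> \<le> L * \<bar>s - t\<bar>" and bd: "\<And>s. \<bar>\<beta>' s\<bar> \<le> L"
    and cont: "continuous_on UNIV \<beta>" "continuous_on UNIV \<beta>'"
    and lim: "(\<lambda>k. l2sq (\<lambda>x. indicator \<Omega> x *\<^sub>R (W k x - w x))) \<longlonglongrightarrow> 0"
      "(\<lambda>k. l2sq (\<lambda>x. indicator \<Omega> x *\<^sub>R (G k x - g x))) \<longlonglongrightarrow> 0"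
    and ae: "AE x in lborel. x \<in> \<Omega> \<longrightarrow> (\<lambda>k. W k x) \<longlonglongrightarrow> w x"
    and fin: "l2sq (\<lambda>x. indicator \<Omega> x *\<^sub>R g x) < \<infinity>"
  shows "(\<lambda>k. l2sq (\<lambda>x. (if x \<in> \<Omega> then \<beta> (W k x) else 0) - (if x \<in> \<Omega> then \<beta> (w x) else 0))) \<longlonglongrightarrow> 0"
    "(\<lambda>k. l2sq (\<lambda>x. (if x \<in> \<Omega> then \<beta>' (W k x) *\<^sub>R G k x else 0) - (if x \<in> \<Omega> then \<beta>' (w x) *\<^sub>R g x else 0))) \<longlonglongrightarrow> 0"
proof -
  have [measurable]: "\<beta> \<in> borel_measurable borel" "\<beta>' \<in> borel_measurable borel"
    using cont by (auto intro: borel_measurable_continuous_onI)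
  have L: "L \<ge> 0" using bd[of 0] by linarith
  show "(\<lambda>k. l2sq (\<lambda>x. (if x \<in> \<Omega> then \<beta> (W k x) else 0) - (if x \<in> \<Omega> then \<beta> (w x) else 0))) \<longlonglongrightarrow> 0"
    by (rule l2sq_tendsto_le[OF _ L _ lim(1)]) (auto simp: lip)
  have 1: "(\<lambda>k. l2sq (\<lambda>x. \<beta>' (W k x) *\<^sub>R (indicator \<Omega> x *\<^sub>R (G k x - g x)))) \<longlonglongrightarrow> 0"
    by (rule l2sq_tendsto_le[OF _ L _ lim(2)]) (auto simp: indicator_def intro!: mult_right_mono bd AE_I2)
  have 2: "(\<lambda>k. l2sq (\<lambda>x. (\<beta>' (W k x) - \<beta>' (w x)) *\<^sub>R (indicator \<Omega> x *\<^sub>R g x))) \<longlonglongrightarrow> 0"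
  proof (rule l2sq_dominated[where w = "\<lambda>x. (2 * L) *\<^sub>R (indicator \<Omega> x *\<^sub>R g x)"])
    have "\<bar>\<beta>' s - \<beta>' t\<bar> \<le> 2 * L" for s t using bd[of s] bd[of t] by linarith
    then show "AE x in lborel. norm ((\<beta>' (W k x) - \<beta>' (w x)) *\<^sub>R (indicator \<Omega> x *\<^sub>R g x)) \<le> norm ((2 * L) *\<^sub>R (indicator \<Omega> x *\<^sub>R g x))" for k
      using L by (intro AE_I2) (auto simp: indicator_def intro!: mult_right_mono)
    show "l2sq (\<lambda>x. (2 * L) *\<^sub>R (indicator \<Omega> x *\<^sub>R g x)) < \<infinity>"
      using L by (intro l2sq_finite_le[OF _ _ _ fin, of "2 * L"]) auto
    show "AE x in lborel. (\<lambda>k. (\<beta>' (W k x) - \<beta>' (w x)) *\<^sub>R (indicator \<Omega> x *\<^sub>R g x)) \<longlonglongrightarrow> 0"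
      using ae
    proof eventually_elim
      fix x assume x: "x \<in> \<Omega> \<longrightarrow> (\<lambda>k. W k x) \<longlonglongrightarrow> w x"
      show "(\<lambda>k. (\<beta>' (W k x) - \<beta>' (w x)) *\<^sub>R (indicator \<Omega> x *\<^sub>R g x)) \<longlonglongrightarrow> 0"
      proof (cases "x \<in> \<Omega>")
        case True
        then have "(\<lambda>k. \<beta>' (W k x)) \<longlonglongrightarrow> \<beta>' (w x)"
          using x continuous_on_tendsto_compose[OF cont(2)] by simp
        then have "(\<lambda>k. (\<beta>' (W k x) - \<beta>' (w x)) *\<^sub>R (indicator \<Omega> x *\<^sub>R g x)) \<longlonglongrightarrow> (\<beta>' (w x) - \<beta>' (w x)) *\<^sub>R (indicator \<Omega> x *\<^sub>R g x)"
          by (intro tendsto_intros)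
        then show ?thesis by simp
      qed simp
    qed
  qed measurable
  have "(\<lambda>x. (if x \<in> \<Omega> then \<beta>' (W k x) *\<^sub>R G k x else 0) - (if x \<in> \<Omega> then \<beta>' (w x) *\<^sub>R g x else 0))
    = (\<lambda>x. \<beta>' (W k x) *\<^sub>R (indicator \<Omega> x *\<^sub>R (G k x - g x)) + (\<beta>' (W k x) - \<beta>' (w x)) *\<^sub>R (indicator \<Omega> x *\<^sub>R g x))" for k
    by (auto simp: fun_eq_iff algebra_simps)
  then show "(\<lambda>k. l2sq (\<lambda>x. (if x \<in> \<Omega> then \<beta>' (W k x) *\<^sub>R G k x else 0) - (if x \<in> \<Omega> then \<beta>' (w x) *\<^sub>R g x else 0))) \<longlonglongrightarrow> 0"
    using l2sq_add_tendsto[OF _ _ 1 2] by simp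
qed

section \<open>Test functions\<close>

text \<open>From exponent two on the kink at 0 disappears, because the difference quotient there is
  at most \<open>\<bar>h\<bar> ^ n\<close>.\<close>

lemma pos_part_power_deriv:
  assumes "n \<ge> 1"
  shows "((\<lambda>t. (max 0 t) ^ Suc n) has_real_derivative real (Suc n) * (max 0 t) ^ n) (at t)"
proof -
  consider "t > 0" | "t < 0" | "t = 0" by linarith
  then show ?thesis
  proof cases
    case 1
    have "((\<lambda>t. t ^ Suc n) has_real_derivative real (Suc n) * t ^ n) (at t)"
      using DERIV_pow[of "Suc n" t UNIV] by simp
    then show ?thesis
      using 1 by (auto intro: has_field_derivative_transform_within_open[of _ _ _ "{0<..}"])
  next
    case 2
    have "((\<lambda>t. 0) has_real_derivative 0) (at t)" by simp
    then have "((\<lambda>t. (max 0 t) ^ Suc n) has_real_derivative 0) (at t)"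
      by (rule has_field_derivative_transform_within_open[of _ _ _ "{..<0}"]) (use 2 in auto)
    moreover have "real (Suc n) * (max 0 t) ^ n = 0" using 2 assms by simp
    ultimately show ?thesis by metis
  next
    case 3
    have "((\<lambda>h. ((max 0 (0 + h)) ^ Suc n - (max 0 0) ^ Suc n) / h) \<longlongrightarrow> 0) (at (0::real))"
    proof (rule Lim_null_comparison)
      show "\<forall>\<^sub>F h in at (0::real). norm (((max 0 (0 + h)) ^ Suc n - (max 0 0) ^ Suc n) / h) \<le> \<bar>h\<bar> ^ n"
      proof (intro always_eventually allI)
        fix h :: real
        show "norm (((max 0 (0 + h)) ^ Suc n - (max 0 0) ^ Suc n) / h) \<le> \<bar>h\<bar> ^ n"
          by (cases "h > 0") (auto simp: max_def)
      qed
      have "((\<lambda>h. \<bar>h\<bar> ^ n) \<longlongrightarrow> \<bar>0\<bar> ^ n) (at (0::real))" by (intro tendsto_intros)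
      moreover have "\<bar>0::real\<bar> ^ n = 0" using assms by simp
      ultimately show "((\<lambda>h. \<bar>h\<bar> ^ n) \<longlongrightarrow> 0) (at (0::real))" by metis
    qed
    then have "((\<lambda>t. (max 0 t) ^ Suc n) has_real_derivative 0) (at 0)" unfolding DERIV_def .
    moreover have "real (Suc n) * (max 0 t) ^ n = 0" using 3 assms by simp
    ultimately show ?thesis using 3 by metis
  qed
qed

lemma pos_part_power_deriv_shift:
  assumes "n \<ge> 1"
  shows "((\<lambda>t. (max 0 (t - c)) ^ Suc n) has_real_derivative real (Suc n) * (max 0 (t - c)) ^ n) (at t)"
  using DERIV_shift[of "\<lambda>t. (max 0 t) ^ Suc n" "real (Suc n) * (max 0 (t - c)) ^ n" t "- c"]
    pos_part_power_deriv[OF assms, of "t - c"] by simp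

text \<open>Smooth substitutes for powers of the positive part. Vanishing on the negative axis
  localises the test function, the bounded derivative keeps it in \<open>H10_grad\<close>, and
  monotonicity gives the gradient term its sign.\<close>

definition test_shape :: "(real \<Rightarrow> real) \<Rightarrow> (real \<Rightarrow> real) \<Rightarrow> real \<Rightarrow> bool" where
  "test_shape \<beta> \<beta>' L \<longleftrightarrow> (\<forall>t. (\<beta> has_real_derivative \<beta>' t) (at t)) \<and> continuous_on UNIV \<beta>' \<and>
     (\<forall>t\<le>0. \<beta> t = 0 \<and> \<beta>' t = 0) \<and> (\<forall>t. 0 \<le> \<beta>' t \<and> \<beta>' t \<le> L)"

lemma test_shapeD:
  assumes "test_shape \<beta> \<beta>' L"
  shows "(\<beta> has_real_derivative \<beta>' t) (at t)" "continuous_on UNIV \<beta>" "continuous_on UNIV \<beta>'"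
    "t \<le> 0 \<Longrightarrow> \<beta> t = 0" "t \<le> 0 \<Longrightarrow> \<beta>' t = 0" "\<beta>' t \<ge> 0" "\<bar>\<beta>' t\<bar> \<le> L"
    "\<bar>\<beta> s - \<beta> t\<bar> \<le> L * \<bar>s - t\<bar>" "0 \<le> \<beta> t"
proof -
  show d: "(\<beta> has_real_derivative \<beta>' t) (at t)" for t using assms by (simp add: test_shape_def)
  show "continuous_on UNIV \<beta>"
    using d by (meson DERIV_isCont continuous_at_imp_continuous_on)
  have b: "0 \<le> \<beta>' t \<and> \<beta>' t \<le> L" for t using assms unfolding test_shape_def by blast
  show "continuous_on UNIV \<beta>'" "t \<le> 0 \<Longrightarrow> \<beta>' t = 0"
    using assms unfolding test_shape_def by blast+
  show z: "t \<le> 0 \<Longrightarrow> \<beta> t = 0" for t using assms unfolding test_shape_def by blast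
  show "\<beta>' t \<ge> 0" "\<bar>\<beta>' t\<bar> \<le> L" using b[of t] by simp_all
  have "norm (\<beta> s - \<beta> t) \<le> L * norm (s - t)"
    by (rule field_differentiable_bound[of UNIV _ \<beta>']) (simp_all add: d b)
  then show "\<bar>\<beta> s - \<beta> t\<bar> \<le> L * \<bar>s - t\<bar>" by simp
  show "0 \<le> \<beta> t"
  proof (cases "t \<le> 0")
    case False
    have "\<beta> 0 \<le> \<beta> t"
      using False d b by (intro DERIV_nonneg_imp_nondecreasing[of 0 t \<beta>]) (simp, blast)
    then show ?thesis using z[of 0] by simp
  qed (simp add: z)
qed

text \<open>Equal to \<open>t^2\<close> on \<open>[0, M]\<close> and continued beyond
  \<open>M\<close> by the tangent line, which keeps the derivative bounded by
  \<open>2 * M\<close>.\<close>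

definition sq_trunc :: "real \<Rightarrow> real \<Rightarrow> real" where
  "sq_trunc M t = (max 0 t)\<^sup>2 - (max 0 (t - M))\<^sup>2"
definition sq_trunc' :: "real \<Rightarrow> real \<Rightarrow> real" where
  "sq_trunc' M t = 2 * max 0 t - 2 * max 0 (t - M)"
text \<open>The analogue for \<open>t^3\<close>: beyond \<open>M\<close> the three terms combine to
  the tangent line of slope \<open>3 * M^2\<close>.\<close>

definition cube_trunc :: "real \<Rightarrow> real \<Rightarrow> real" where
  "cube_trunc M t = (max 0 t) ^ 3 - (max 0 (t - M)) ^ 3 - 3 * M * (max 0 (t - M))\<^sup>2"
definition cube_trunc' :: "real \<Rightarrow> real \<Rightarrow> real" where
  "cube_trunc' M t = 3 * (max 0 t)\<^sup>2 - 3 * (max 0 (t - M))\<^sup>2 - 6 * M * max 0 (t - M)"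

lemma test_shape_sq_trunc:
  assumes "M > 0"
  shows "test_shape (sq_trunc M) (sq_trunc' M) (2 * M)"
  unfolding test_shape_def
proof (intro conjI allI impI)
  fix t
  show "(sq_trunc M has_real_derivative sq_trunc' M t) (at t)"
    unfolding sq_trunc_def[abs_def] sq_trunc'_def
    using DERIV_diff[OF pos_part_power_deriv[of 1 t] pos_part_power_deriv_shift[of 1 M t]]
    by (simp add: numeral_2_eq_2)
  show "continuous_on UNIV (sq_trunc' M)"
    unfolding sq_trunc'_def[abs_def] by (intro continuous_intros)
qed (use assms in \<open>auto simp: sq_trunc_def sq_trunc'_def max_def\<close>)

lemma test_shape_cube_trunc:
  assumes "M > 0"
  shows "test_shape (cube_trunc M) (cube_trunc' M) (3 * M\<^sup>2)"
  unfolding test_shape_def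
proof (intro conjI allI impI)
  fix t
  have "((\<lambda>t. (max 0 t) ^ Suc 2 - (max 0 (t - M)) ^ Suc 2 - 3 * M * (max 0 (t - M)) ^ Suc 1)
      has_real_derivative real (Suc 2) * (max 0 t)\<^sup>2 - real (Suc 2) * (max 0 (t - M))\<^sup>2 - 3 * M * (real (Suc 1) * (max 0 (t - M)) ^ 1)) (at t)"
    by (intro DERIV_diff DERIV_cmult pos_part_power_deriv pos_part_power_deriv_shift) auto
  then show "(cube_trunc M has_real_derivative cube_trunc' M t) (at t)"
    unfolding cube_trunc_def[abs_def] cube_trunc'_def
    by (simp add: numeral_2_eq_2 numeral_3_eq_3 algebra_simps)
  show "continuous_on UNIV (cube_trunc' M)"
    unfolding cube_trunc'_def[abs_def] by (intro continuous_intros)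
  have eq: "cube_trunc' M t = (if t \<le> 0 then 0 else if t \<le> M then 3 * t\<^sup>2 else 3 * M\<^sup>2)"
    using assms by (auto simp: cube_trunc'_def max_def power2_eq_square algebra_simps)
  show "0 \<le> cube_trunc' M t" by (simp add: eq)
  show "cube_trunc' M t \<le> 3 * M\<^sup>2" using assms by (auto simp: eq intro!: power_mono)
qed (use assms in \<open>auto simp: cube_trunc_def cube_trunc'_def max_def\<close>)

text \<open>For a nonnegative solution bounded by \<open>M\<close> the differences stay below
  \<open>M\<close>, so the truncation is invisible and exact powers of the positive part
  appear.\<close>

lemma trunc_values:
  assumes "t \<le> M"
  shows "sq_trunc M t = (max 0 t)\<^sup>2" "sq_trunc' M t = 2 * max 0 t"
    "cube_trunc M t = (max 0 t) ^ 3" "cube_trunc' M t = 3 * (max 0 t)\<^sup>2"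
  using assms by (auto simp: sq_trunc_def sq_trunc'_def cube_trunc_def cube_trunc'_def max_def)

lemma C1c_comp:
  assumes C: "C1c_ball R \<phi> D" and b: "\<And>t. (b has_real_derivative b' t) (at t)" "continuous_on UNIV b'" "b 0 = 0"
  shows "C1c_ball R (\<lambda>x. b (\<phi> x)) (\<lambda>x. b' (\<phi> x) *\<^sub>R D x)"
  unfolding C1c_ball_def
proof (intro conjI allI)
  obtain K where K: "compact K" "K \<subseteq> ball 0 R" "\<And>x. x \<notin> K \<Longrightarrow> \<phi> x = 0"
    using C1c_ballE[OF C] by metis
  show "((\<lambda>x. b (\<phi> x)) has_derivative (\<lambda>h. (b' (\<phi> x) *\<^sub>R D x) \<bullet> h)) (at x)" for x
    using has_derivative_compose[OF C1c_ballD(1)[OF C, of x] b(1)[of "\<phi> x", unfolded has_field_derivative_def]] by simp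
  show "continuous_on UNIV (\<lambda>x. b' (\<phi> x) *\<^sub>R D x)"
    by (intro continuous_intros continuous_on_compose2[OF b(2)] C1c_ballD(2,3)[OF C]) auto
  show "\<exists>K. compact K \<and> K \<subseteq> ball 0 R \<and> (\<forall>x. x \<notin> K \<longrightarrow> b (\<phi> x) = 0)"
    using K b(3) by auto
qed

text \<open>Nonnegative approximants are what later gives truncated differences compact support.
  They arise by composition with a smoothed positive part whose scale \<open>c k\<close> tends to 0;
  strict positivity of \<open>u\<close> in the ball makes the derivative factor tend to 1
  there.\<close>

lemma H10_grad_nonneg_seq:
  fixes u :: "real^'n::idx \<Rightarrow> real"
  assumes H: "H10_grad R u g" and pos: "\<And>x. x \<in> ball 0 R \<Longrightarrow> u x > 0"
  obtains a A where "\<And>k::nat. C1c_ball R (a k) (A k)" "\<And>k x. 0 \<le> a k x"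
    "(\<lambda>k. l2sq (\<lambda>x. a k x - u x)) \<longlonglongrightarrow> 0" "(\<lambda>k. l2sq (\<lambda>x. A k x - g x)) \<longlonglongrightarrow> 0"
    "AE x in lborel. (\<lambda>k. a k x) \<longlonglongrightarrow> u x"
proof -
  obtain \<phi> D where C: "\<And>k::nat. C1c_ball R (\<phi> k) (D k)"
    and l: "(\<lambda>k. l2sq (\<lambda>x. \<phi> k x - u x)) \<longlonglongrightarrow> 0" "(\<lambda>k. l2sq (\<lambda>x. D k x - g x)) \<longlonglongrightarrow> 0"
    and ae: "AE x in lborel. (\<lambda>k. \<phi> k x) \<longlonglongrightarrow> u x" "AE x in lborel. (\<lambda>k. D k x) \<longlonglongrightarrow> g x"
    by (rule H10_gradE[OF H]) blast
  note out = H10_grad_outside[OF H]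
  define c where "c k = 1 / real (Suc k)" for k
  have c: "c k > 0" for k by (simp add: c_def)
  have c0: "c \<longlonglongrightarrow> 0" unfolding c_def using LIMSEQ_inverse_real_of_nat by (simp add: inverse_eq_divide)
  \<comment> \<open>A C^1 version of the positive part: slope between 0 and 1, slope exactly 1 from
    \<open>c k\<close> on, and error at most \<open>c k\<close> on the nonnegative axis.\<close>
  define b where "b k t = sq_trunc (c k) t / (2 * c k)" for k t
  define b' where "b' k t = sq_trunc' (c k) t / (2 * c k)" for k t
  note ts = test_shapeD[OF test_shape_sq_trunc[OF c]]
  have b_deriv: "(b k has_real_derivative b' k t) (at t)" for k t
    unfolding b_def[abs_def] b'_def by (intro DERIV_cdivide ts)
  have b'_cont: "continuous_on UNIV (b' k)" for k
    unfolding b'_def[abs_def] by (intro continuous_intros ts) (use c[of k] in auto)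
  have b_cont: "continuous_on UNIV (b k)" for k
    using b_deriv by (meson DERIV_isCont continuous_at_imp_continuous_on)
  have b0: "b k t \<ge> 0" "b k 0 = 0" for k t
    using ts(9)[of k t] ts(4)[of 0 k] c[of k] by (auto simp: b_def)
  have b_lip: "\<bar>b k s - b k t\<bar> \<le> \<bar>s - t\<bar>" for k s t
  proof -
    have "\<bar>b k s - b k t\<bar> = \<bar>sq_trunc (c k) s - sq_trunc (c k) t\<bar> / (2 * c k)"
      using c[of k] by (simp add: b_def diff_divide_distrib[symmetric])
    also have "\<dots> \<le> (2 * c k * \<bar>s - t\<bar>) / (2 * c k)"
      using ts(8)[of k s t] c[of k] by (intro divide_right_mono) auto
    finally show ?thesis using c[of k] by simp
  qed
  have b'_bd: "0 \<le> b' k t" "b' k t \<le> 1" for k t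
    using ts(6)[of k t] ts(7)[of k t] c[of k] by (auto simp: b'_def field_simps)
  have b'_1: "b' k t = 1" if "t \<ge> c k" for k t
    using that c[of k] by (simp add: b'_def sq_trunc'_def max_def)
  have b_near: "\<bar>b k t - t\<bar> \<le> t" "\<bar>b k t - t\<bar> \<le> c k" if "t \<ge> 0" for k t
  proof -
    have 1: "\<bar>b k t - t\<bar> = t - b k t"
    proof -
      have "b k t \<le> t" using b_lip[of k t 0] b0[of k] that by auto
      then show ?thesis by simp
    qed
    show "\<bar>b k t - t\<bar> \<le> t" using b0(1)[of k t] unfolding 1 by simp
    show "\<bar>b k t - t\<bar> \<le> c k"
    proof (cases "t \<le> c k")
      case True then show ?thesis using b0(1)[of k t] unfolding 1 by simp
    next
      case False
      then have "b k t = t - c k / 2"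
        using c[of k] by (simp add: b_def sq_trunc_def max_def power2_eq_square field_simps)
      then show ?thesis using c[of k] by simp
    qed
  qed
  have [measurable]: "u \<in> borel_measurable borel" "g \<in> borel_measurable borel"
      "\<phi> k \<in> borel_measurable borel" "D k \<in> borel_measurable borel" "b k \<in> borel_measurable borel" "b' k \<in> borel_measurable borel" for k
    using C1c_ballD[OF C] H10_grad_measurable[OF H] b_cont b'_cont by (auto intro: borel_measurable_continuous_onI)
  have u0: "AE x in lborel. u x \<ge> 0"
    using out by eventually_elim (metis pos less_imp_le order_refl)
  show thesis
  proof (rule that[of "\<lambda>k x. b k (\<phi> k x)" "\<lambda>k x. b' k (\<phi> k x) *\<^sub>R D k x"])
    show "C1c_ball R (\<lambda>x. b k (\<phi> k x)) (\<lambda>x. b' k (\<phi> k x) *\<^sub>R D k x)" for k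
      by (rule C1c_comp[OF C b_deriv b'_cont b0(2)])
    show "0 \<le> b k (\<phi> k x)" for k x by (rule b0)
    have near: "(\<lambda>k. b k (u x) - u x) \<longlonglongrightarrow> 0" if "u x \<ge> 0" for x
      by (rule Lim_null_comparison[OF _ c0]) (use b_near(2)[OF that] in auto)
    have 1: "(\<lambda>k. l2sq (\<lambda>x. b k (\<phi> k x) - b k (u x))) \<longlonglongrightarrow> 0"
      by (rule l2sq_tendsto_le[OF _ _ _ l(1), of 1]) (auto simp: b_lip)
    have 2: "(\<lambda>k. l2sq (\<lambda>x. b k (u x) - u x)) \<longlonglongrightarrow> 0"
    proof (rule l2sq_dominated[where w = u])
      show "AE x in lborel. norm (b k (u x) - u x) \<le> norm (u x)" for k
        using u0 by eventually_elim (use b_near(1) in auto)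
      show "AE x in lborel. (\<lambda>k. b k (u x) - u x) \<longlonglongrightarrow> 0"
        using u0 by eventually_elim (rule near)
      show "l2sq u < \<infinity>" by (rule H10_grad_l2[OF H])
    qed measurable
    show "(\<lambda>k. l2sq (\<lambda>x. b k (\<phi> k x) - u x)) \<longlonglongrightarrow> 0"
      using l2sq_add_tendsto[OF _ _ 1 2] by simp
    have 3: "(\<lambda>k. l2sq (\<lambda>x. b' k (\<phi> k x) *\<^sub>R (D k x - g x))) \<longlonglongrightarrow> 0"
      by (rule l2sq_tendsto_le[OF _ _ _ l(2), of 1]) (auto intro!: mult_left_le_one_le simp: b'_bd)
    have 4: "(\<lambda>k. l2sq (\<lambda>x. (b' k (\<phi> k x) - 1) *\<^sub>R g x)) \<longlonglongrightarrow> 0"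
    proof (rule l2sq_dominated[where w = g])
      show "AE x in lborel. norm ((b' k (\<phi> k x) - 1) *\<^sub>R g x) \<le> norm (g x)" for k
        using b'_bd by (intro AE_I2) (auto intro!: mult_left_le_one_le simp: abs_le_iff)
      show "l2sq g < \<infinity>" by (rule H10_grad_l2[OF H])
      show "AE x in lborel. (\<lambda>k. (b' k (\<phi> k x) - 1) *\<^sub>R g x) \<longlonglongrightarrow> 0"
        using ae(1) out
      proof eventually_elim
        fix x assume x: "(\<lambda>k. \<phi> k x) \<longlonglongrightarrow> u x" "x \<notin> ball 0 R \<longrightarrow> u x = 0 \<and> g x = 0"
        show "(\<lambda>k. (b' k (\<phi> k x) - 1) *\<^sub>R g x) \<longlonglongrightarrow> 0"
        proof (cases "x \<in> ball 0 R")
          \<comment> \<open>Eventually \<open>\<phi> k x\<close> exceeds \<open>u x / 2\<close>,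
            which in turn exceeds \<open>c k\<close>; there \<open>b' k\<close> is exactly
            1.\<close>
          case True
          then have "\<forall>\<^sub>F k in sequentially. \<phi> k x > u x / 2" "\<forall>\<^sub>F k in sequentially. c k < u x / 2"
            using order_tendstoD(1)[OF x(1), of "u x / 2"] order_tendstoD(2)[OF c0, of "u x / 2"] pos[OF True] by auto
          then have "\<forall>\<^sub>F k in sequentially. (b' k (\<phi> k x) - 1) *\<^sub>R g x = 0"
            by eventually_elim (simp add: b'_1)
          then show ?thesis by (rule tendsto_eventually)
        qed (use x in simp)
      qed
    qed measurable
    show "(\<lambda>k. l2sq (\<lambda>x. b' k (\<phi> k x) *\<^sub>R D k x - g x)) \<longlonglongrightarrow> 0"
      using l2sq_add_tendsto[OF _ _ 3 4] by (simp add: algebra_simps)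
    show "AE x in lborel. (\<lambda>k. b k (\<phi> k x)) \<longlonglongrightarrow> u x"
      using ae(1) u0
    proof eventually_elim
      fix x assume x: "(\<lambda>k. \<phi> k x) \<longlonglongrightarrow> u x" "u x \<ge> 0"
      have "(\<lambda>k. b k (\<phi> k x) - u x) \<longlonglongrightarrow> 0"
      proof (rule Lim_null_comparison)
        show "\<forall>\<^sub>F k in sequentially. norm (b k (\<phi> k x) - u x) \<le> \<bar>\<phi> k x - u x\<bar> + c k"
        proof (intro always_eventually allI)
          fix k show "norm (b k (\<phi> k x) - u x) \<le> \<bar>\<phi> k x - u x\<bar> + c k"
            using b_lip[of k "\<phi> k x" "u x"] b_near(2)[OF x(2), of k] by simp
        qed
        have "(\<lambda>k. \<bar>\<phi> k x - u x\<bar> + c k) \<longlonglongrightarrow> \<bar>u x - u x\<bar> + 0"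
          by (intro tendsto_intros x c0)
        then show "(\<lambda>k. \<bar>\<phi> k x - u x\<bar> + c k) \<longlonglongrightarrow> 0" by simp
      qed
      then show "(\<lambda>k. b k (\<phi> k x)) \<longlonglongrightarrow> u x" by (rule LIM_zero_cancel)
    qed
  qed
qed

text \<open>On the plane the two values of \<open>a\<close> agree and \<open>h\<close> vanishes, so
  \<open>\<beta>\<close> and \<open>\<beta>'\<close> are evaluated at 0 and the cut-off by 0 stays
  continuously differentiable. Near the sphere, within the half-space, only the term with the minus
  sign can survive, which makes the argument of \<open>\<beta>\<close> nonpositive.\<close>

lemma C1c_halfspace:
  fixes e :: "real^'n::idx"
  assumes e: "norm e = 1" and l: "0 \<le> l"
    and a: "C1c_ball R a A" "\<And>x. 0 \<le> a x"
    and h: "C1c_ball R h Dh" "\<And>x. x \<bullet> e \<le> l \<Longrightarrow> h x = 0"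
    and \<beta>: "test_shape \<beta> \<beta>' L"
  defines "\<psi> \<equiv> \<lambda>x. if x \<in> {x. l < x \<bullet> e} then \<beta> (a x - a (hrefl e l x) + h x) else 0"
    and "D \<equiv> \<lambda>x. if x \<in> {x. l < x \<bullet> e} then \<beta>' (a x - a (hrefl e l x) + h x) *\<^sub>R (A x - hrefl e 0 (A (hrefl e l x)) + Dh x) else 0"
  shows "C1c_ball R \<psi> D" "C1c_ball R (\<lambda>x. \<psi> (hrefl e l x)) (\<lambda>x. hrefl e 0 (D (hrefl e l x)))"
proof -
  note Ca = C1c_ballD[OF a(1)] and Ch = C1c_ballD[OF h(1)] and T = test_shapeD[OF \<beta>]
  define w where "w x = a x - a (hrefl e l x) + h x" for x
  define G where "G x = A x - hrefl e 0 (A (hrefl e l x)) + Dh x" for x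
  have \<psi>: "\<psi> x = (if l < x \<bullet> e then \<beta> (w x) else 0)" for x by (simp add: \<psi>_def w_def)
  have D: "D x = (if l < x \<bullet> e then \<beta>' (w x) *\<^sub>R G x else 0)" for x by (simp add: D_def w_def G_def)
  have w0: "w x = 0" if "x \<bullet> e = l" for x using that h(2)[of x] by (simp add: w_def hrefl_fixed)
  have dw: "(w has_derivative (\<lambda>v. G x \<bullet> v)) (at x)" for x
  proof -
    have "((\<lambda>x. a (hrefl e l x)) has_derivative (\<lambda>v. A (hrefl e l x) \<bullet> hrefl e 0 v)) (at x)"
      by (rule has_derivative_compose[OF has_derivative_hrefl Ca(1)])
    from has_derivative_add[OF has_derivative_diff[OF Ca(1) this] Ch(1)]
    show ?thesis unfolding w_def[abs_def]
      by (rule has_derivative_eq_rhs) (auto simp: G_def inner_add_left inner_diff_left hrefl_adjoint)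
  qed
  have cw: "continuous_on UNIV w"
    using dw by (meson has_derivative_continuous continuous_at_imp_continuous_on)
  have cG: "continuous_on UNIV G" unfolding G_def[abs_def]
    by (intro continuous_intros Ca Ch continuous_on_compose2[OF Ca(2)] continuous_hrefl) auto
  have dbw: "((\<lambda>x. \<beta> (w x)) has_derivative (\<lambda>v. (\<beta>' (w x) *\<^sub>R G x) \<bullet> v)) (at x)" for x
    using has_derivative_compose[OF dw[of x] T(1)[of "w x", unfolded has_field_derivative_def]] by simp
  have d: "(\<psi> has_derivative (\<lambda>v. D x \<bullet> v)) (at x)" for x
  proof -
    consider "x \<bullet> e > l" | "x \<bullet> e < l" | "x \<bullet> e = l" by linarith
    then show ?thesis
    proof cases
      case 1
      have o: "open {x. l < x \<bullet> e}" by (intro open_Collect_less continuous_intros)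
      show ?thesis
        using has_derivative_transform_within_open[OF dbw[of x] o, of \<psi>] 1 by (simp add: \<psi> D)
    next
      case 2
      have o: "open {x. x \<bullet> e < l}" by (intro open_Collect_less continuous_intros)
      have "((\<lambda>x. 0) has_derivative (\<lambda>v. 0)) (at x)" by simp
      from has_derivative_transform_within_open[OF this o, of \<psi>] 2 show ?thesis by (simp add: \<psi> D)
    next
      case 3
      have b0: "\<beta> (w x) = 0" "\<beta>' (w x) = 0" using w0[OF 3] T(4,5)[of 0] by auto
      have "((\<lambda>y. norm (\<beta> (w y) - \<beta> (w x) - 0) / norm (y - x)) \<longlongrightarrow> 0) (at x)"
        using dbw[of x] b0 by (simp add: has_derivative_iff_norm)
      \<comment> \<open>Beyond the plane \<open>\<psi>\<close> equals \<open>\<beta> (w y)\<close>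
        and elsewhere it is 0, so it is dominated by a function whose derivative at \<open>x\<close>
        is 0.\<close>
      then have "((\<lambda>y. norm (\<psi> y - \<psi> x - 0) / norm (y - x)) \<longlongrightarrow> 0) (at x)"
        by (rule Lim_null_comparison[rotated])
           (auto intro!: always_eventually divide_right_mono simp: \<psi> 3 b0)
      then have "(\<psi> has_derivative (\<lambda>v. 0)) (at x)"
        by (simp add: has_derivative_iff_norm)
      then show ?thesis using 3 by (simp add: D)
    qed
  qed
  have cD: "continuous_on UNIV D"
  proof -
    have "continuous_on ({x. l \<le> x \<bullet> e} \<union> {x. x \<bullet> e \<le> l}) (\<lambda>x. if l \<le> x \<bullet> e then \<beta>' (w x) *\<^sub>R G x else 0)"
    proof (rule continuous_on_cases)
      show "closed {x. l \<le> x \<bullet> e}" "closed {x. x \<bullet> e \<le> l}"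
        by (intro closed_Collect_le continuous_intros)+
      show "continuous_on {x. l \<le> x \<bullet> e} (\<lambda>x. \<beta>' (w x) *\<^sub>R G x)"
        by (rule continuous_on_subset[OF _ subset_UNIV])
           (intro continuous_intros continuous_on_compose2[OF T(3) cw] cG, auto)
      show "\<forall>x. x \<in> {x. l \<le> x \<bullet> e} \<and> \<not> l \<le> x \<bullet> e \<or> x \<in> {x. x \<bullet> e \<le> l} \<and> l \<le> x \<bullet> e \<longrightarrow> \<beta>' (w x) *\<^sub>R G x = 0"
        using w0 T(5)[of 0] by (auto dest!: order_antisym)
    qed simp
    moreover have "{x. l \<le> x \<bullet> e} \<union> {x. x \<bullet> e \<le> l} = UNIV" by auto
    moreover have "(\<lambda>x. if l \<le> x \<bullet> e then \<beta>' (w x) *\<^sub>R G x else 0) = D"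
    proof
      fix x show "(if l \<le> x \<bullet> e then \<beta>' (w x) *\<^sub>R G x else 0) = D x"
        using w0[of x] T(5)[of 0] by (auto simp: D not_less)
    qed
    ultimately show ?thesis by metis
  qed
  obtain K where K: "compact K" "K \<subseteq> ball 0 R" "\<And>x. x \<notin> K \<Longrightarrow> a x = 0"
    using C1c_ballE[OF a(1)] by metis
  obtain K' where K': "compact K'" "K' \<subseteq> ball 0 R" "\<And>x. x \<notin> K' \<Longrightarrow> h x = 0"
    using C1c_ballE[OF h(1)] by metis
  define Q where "Q = (K \<union> K') \<inter> {x. l \<le> x \<bullet> e}"
  have Q: "compact Q" unfolding Q_def
    by (intro compact_Int_closed compact_Un K K' closed_Collect_le continuous_intros)
  have Q0: "\<psi> x = 0" if "x \<notin> Q" for x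
  proof (cases "l < x \<bullet> e")
    case True
    \<comment> \<open>Outside \<open>Q\<close> on this side both \<open>a x\<close> and
      \<open>h x\<close> are 0, which leaves minus a nonnegative value.\<close>
    then have "w x \<le> 0" using that K(3)[of x] K'(3)[of x] a(2)[of "hrefl e l x"] by (auto simp: Q_def w_def)
    then show ?thesis using T(4) by (simp add: \<psi>)
  qed (simp add: \<psi>)
  have QB: "Q \<subseteq> ball 0 R" using K K' by (auto simp: Q_def)
  show "C1c_ball R \<psi> D"
    unfolding C1c_ball_def using d cD Q QB Q0 by blast
  show "C1c_ball R (\<lambda>x. \<psi> (hrefl e l x)) (\<lambda>x. hrefl e 0 (D (hrefl e l x)))"
    unfolding C1c_ball_def
  proof (intro conjI allI exI[of _ "hrefl e l ` Q"])
    show "((\<lambda>x. \<psi> (hrefl e l x)) has_derivative (\<lambda>v. hrefl e 0 (D (hrefl e l x)) \<bullet> v)) (at x)" for x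
      unfolding hrefl_adjoint by (rule has_derivative_compose[OF has_derivative_hrefl d])
    show "continuous_on UNIV (\<lambda>x. hrefl e 0 (D (hrefl e l x)))"
      by (intro continuous_intros continuous_on_compose2[OF cD] continuous_hrefl) auto
    show "compact (hrefl e l ` Q)" by (intro compact_continuous_image continuous_hrefl Q)
    show "hrefl e l ` Q \<subseteq> ball 0 R"
    proof
      fix y assume "y \<in> hrefl e l ` Q"
      then obtain x where x: "x \<in> Q" "y = hrefl e l x" by auto
      then have "0 \<le> 4 * l * (x \<bullet> e - l)" using l by (auto simp: Q_def)
      then have "(norm y)\<^sup>2 \<le> (norm x)\<^sup>2" using norm_hrefl_sq[OF e, of l x] x by simp
      then have "norm y \<le> norm x" by (rule power2_le_imp_le) simp
      then show "y \<in> ball 0 R" using QB x by auto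
    qed
    show "x \<notin> hrefl e l ` Q \<longrightarrow> \<psi> (hrefl e l x) = 0" for x
      using Q0[of "hrefl e l x"] e by (metis hrefl_hrefl image_eqI)
  qed
qed

text \<open>The truncated difference and its mirror image are the two test functions of the
  reflected weak equation. The bump \<open>h\<close> serves the strict comparison; taking it 0 gives
  the plain difference.\<close>

lemma H10_halfspace:
  fixes e :: "real^'n::idx"
  assumes e: "norm e = 1" and l: "0 \<le> l"
    and H: "H10_grad R u g" and pos: "\<And>x. x \<in> ball 0 R \<Longrightarrow> u x > 0"
    and h: "C1c_ball R h Dh" "\<And>x. x \<bullet> e \<le> l \<Longrightarrow> h x = 0"
    and \<beta>: "test_shape \<beta> \<beta>' L"
  defines "\<psi> \<equiv> \<lambda>x. if x \<in> {x. l < x \<bullet> e} then \<beta> (u x - u (hrefl e l x) + h x) else 0"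
    and "D \<equiv> \<lambda>x. if x \<in> {x. l < x \<bullet> e} then \<beta>' (u x - u (hrefl e l x) + h x) *\<^sub>R (g x - hrefl e 0 (g (hrefl e l x)) + Dh x) else 0"
  shows "H10_grad R \<psi> D" "H10_grad R (\<lambda>x. \<psi> (hrefl e l x)) (\<lambda>x. hrefl e 0 (D (hrefl e l x)))"
proof -
  obtain a A where C: "\<And>k::nat. C1c_ball R (a k) (A k)" and a0: "\<And>k x. 0 \<le> a k x"
    and la: "(\<lambda>k. l2sq (\<lambda>x. a k x - u x)) \<longlonglongrightarrow> 0" "(\<lambda>k. l2sq (\<lambda>x. A k x - g x)) \<longlonglongrightarrow> 0"
    and ae: "AE x in lborel. (\<lambda>k. a k x) \<longlonglongrightarrow> u x"
    by (rule H10_grad_nonneg_seq[OF H pos]) blast+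
  let ?\<Omega> = "{x. l < x \<bullet> e}"
  note Ch = C1c_ballD[OF h(1)] and T = test_shapeD[OF \<beta>]
  have [measurable]: "u \<in> borel_measurable borel" "g \<in> borel_measurable borel" "h \<in> borel_measurable borel" "Dh \<in> borel_measurable borel"
      "a k \<in> borel_measurable borel" "A k \<in> borel_measurable borel" "\<beta> \<in> borel_measurable borel" "\<beta>' \<in> borel_measurable borel" for k
    using C1c_ballD[OF C] H10_grad_measurable[OF H] Ch T(2,3) by (auto intro: borel_measurable_continuous_onI)
  have om [measurable]: "?\<Omega> \<in> sets borel"
    by (intro borel_open open_Collect_less continuous_intros)
  define W where "W k x = a k x - a k (hrefl e l x) + h x" for k x
  define G where "G k x = A k x - hrefl e 0 (A k (hrefl e l x)) + Dh x" for k x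
  define w where "w x = u x - u (hrefl e l x) + h x" for x
  define gw where "gw x = g x - hrefl e 0 (g (hrefl e l x)) + Dh x" for x
  have mw [measurable]: "W k \<in> borel_measurable borel" "G k \<in> borel_measurable borel" "w \<in> borel_measurable borel" "gw \<in> borel_measurable borel" for k
    unfolding W_def[abs_def] G_def[abs_def] w_def[abs_def] gw_def[abs_def] by measurable
  have r1: "(\<lambda>k. l2sq (\<lambda>x. u (hrefl e l x) - a k (hrefl e l x))) \<longlonglongrightarrow> 0"
    using la(1) l2sq_hrefl[OF e, of "\<lambda>x. u x - a _ x" l] by (simp add: l2sq_commute[of u])
  have r2: "(\<lambda>k. l2sq (\<lambda>x. hrefl e 0 (g (hrefl e l x) - A k (hrefl e l x)))) \<longlonglongrightarrow> 0"
  proof -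
    have "l2sq (\<lambda>x. hrefl e 0 (g (hrefl e l x) - A k (hrefl e l x))) = l2sq (\<lambda>x. g (hrefl e l x) - A k (hrefl e l x))" for k
      using e by (simp add: l2sq_def)
    then show ?thesis
      using la(2) l2sq_hrefl[OF e, of "\<lambda>x. g x - A _ x" l] by (simp add: l2sq_commute[of g])
  qed
  have lW: "(\<lambda>k. l2sq (\<lambda>x. W k x - w x)) \<longlonglongrightarrow> 0"
    using l2sq_add_tendsto[OF _ _ la(1) r1] by (simp add: W_def w_def algebra_simps)
  have lG: "(\<lambda>k. l2sq (\<lambda>x. G k x - gw x)) \<longlonglongrightarrow> 0"
  proof -
    have "G k x - gw x = (A k x - g x) + hrefl e 0 (g (hrefl e l x) - A k (hrefl e l x))" for k x
      by (simp add: G_def gw_def linear_diff[OF linear_hrefl_0])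
    then show ?thesis
      using l2sq_add_tendsto[OF _ _ la(2) r2] by simp
  qed
  have fg: "l2sq gw < \<infinity>"
  proof -
    have 1: "l2sq (\<lambda>x. - hrefl e 0 (g (hrefl e l x))) = l2sq g"
    proof -
      have "l2sq (\<lambda>x. - hrefl e 0 (g (hrefl e l x))) = l2sq (\<lambda>x. g (hrefl e l x))"
        using e by (simp add: l2sq_def)
      then show ?thesis using l2sq_hrefl[OF e, of g l] by simp
    qed
    have "l2sq (\<lambda>x. (g x + - hrefl e 0 (g (hrefl e l x))) + Dh x) < \<infinity>"
      using H10_grad_l2(2)[OF H] 1 by (intro l2sq_finite_add C1c_l2(2)[OF h(1)]) simp_all
    then show ?thesis by (simp add: gw_def[abs_def])
  qed
  have aeW: "AE x in lborel. x \<in> ?\<Omega> \<longrightarrow> (\<lambda>k. W k x) \<longlonglongrightarrow> w x"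
    using ae AE_hrefl[OF e ae, of l]
    by eventually_elim (auto simp: W_def w_def intro!: tendsto_intros)
  have lim: "(\<lambda>k. l2sq (\<lambda>x. (if x \<in> ?\<Omega> then \<beta> (W k x) else 0) - (if x \<in> ?\<Omega> then \<beta> (w x) else 0))) \<longlonglongrightarrow> 0"
    "(\<lambda>k. l2sq (\<lambda>x. (if x \<in> ?\<Omega> then \<beta>' (W k x) *\<^sub>R G k x else 0) - (if x \<in> ?\<Omega> then \<beta>' (w x) *\<^sub>R gw x else 0))) \<longlonglongrightarrow> 0"
  proof -
    have i: "(\<lambda>k. l2sq (\<lambda>x. indicator ?\<Omega> x *\<^sub>R (W k x - w x))) \<longlonglongrightarrow> 0"
      by (rule l2sq_tendsto_le[OF _ _ _ lW, of 1]) (auto simp: indicator_def)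
    have ii: "(\<lambda>k. l2sq (\<lambda>x. indicator ?\<Omega> x *\<^sub>R (G k x - gw x))) \<longlonglongrightarrow> 0"
      by (rule l2sq_tendsto_le[OF _ _ _ lG, of 1]) (auto simp: indicator_def)
    have iii: "l2sq (\<lambda>x. indicator ?\<Omega> x *\<^sub>R gw x) < \<infinity>"
      by (rule l2sq_finite_le[OF _ _ _ fg, of 1]) (auto simp: indicator_def)
    note * = l2_comp_limit[OF om mw(1) mw(3) mw(2) mw(4) T(8) T(7) T(2,3) i ii aeW iii]
    show "(\<lambda>k. l2sq (\<lambda>x. (if x \<in> ?\<Omega> then \<beta> (W k x) else 0) - (if x \<in> ?\<Omega> then \<beta> (w x) else 0))) \<longlonglongrightarrow> 0"
      by (rule *(1))
    show "(\<lambda>k. l2sq (\<lambda>x. (if x \<in> ?\<Omega> then \<beta>' (W k x) *\<^sub>R G k x else 0) - (if x \<in> ?\<Omega> then \<beta>' (w x) *\<^sub>R gw x else 0))) \<longlonglongrightarrow> 0"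
      by (rule *(2))
  qed
  define \<psi>k where "\<psi>k k x = (if x \<in> ?\<Omega> then \<beta> (W k x) else 0)" for k x
  define Dk where "Dk k x = (if x \<in> ?\<Omega> then \<beta>' (W k x) *\<^sub>R G k x else 0)" for k x
  have \<psi>: "\<psi> = (\<lambda>x. if x \<in> ?\<Omega> then \<beta> (w x) else 0)" unfolding \<psi>_def w_def ..
  have D: "D = (\<lambda>x. if x \<in> ?\<Omega> then \<beta>' (w x) *\<^sub>R gw x else 0)" unfolding D_def w_def gw_def ..
  have m\<psi> [measurable]: "\<psi> \<in> borel_measurable borel" "D \<in> borel_measurable borel"
    unfolding \<psi> D by measurable
  have m\<psi>k [measurable]: "\<psi>k k \<in> borel_measurable borel" "Dk k \<in> borel_measurable borel" for k
    unfolding \<psi>k_def[abs_def] Dk_def[abs_def] by measurable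
  note CC = C1c_halfspace[OF e l C a0 h \<beta>, folded W_def G_def, folded \<psi>k_def Dk_def]
  have lim1: "(\<lambda>k. l2sq (\<lambda>x. \<psi>k k x - \<psi> x)) \<longlonglongrightarrow> 0" and lim2: "(\<lambda>k. l2sq (\<lambda>x. Dk k x - D x)) \<longlonglongrightarrow> 0"
    using lim by (simp_all add: \<psi>k_def \<psi> Dk_def D)
  show "H10_grad R \<psi> D"
    by (rule H10_gradI[OF m\<psi> CC(1) lim1 lim2])
  show "H10_grad R (\<lambda>x. \<psi> (hrefl e l x)) (\<lambda>x. hrefl e 0 (D (hrefl e l x)))"
  proof (rule H10_gradI[OF _ _ CC(2)])
    show "(\<lambda>k. l2sq (\<lambda>x. \<psi>k k (hrefl e l x) - \<psi> (hrefl e l x))) \<longlonglongrightarrow> 0"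
      using lim1 l2sq_hrefl[OF e, of "\<lambda>x. \<psi>k _ x - \<psi> x" l] by simp
    have "l2sq (\<lambda>x. hrefl e 0 (Dk k (hrefl e l x)) - hrefl e 0 (D (hrefl e l x))) = l2sq (\<lambda>x. Dk k (hrefl e l x) - D (hrefl e l x))" for k
      using e by (simp add: l2sq_def flip: linear_diff[OF linear_hrefl_0])
    then show "(\<lambda>k. l2sq (\<lambda>x. hrefl e 0 (Dk k (hrefl e l x)) - hrefl e 0 (D (hrefl e l x)))) \<longlonglongrightarrow> 0"
      using lim2 l2sq_hrefl[OF e, of "\<lambda>x. Dk _ x - D x" l] by simp
  qed measurable
qed

section \<open>The Green potential and the weak equation\<close>

lemma powr_diff_le:
  assumes "p \<ge> 1" "0 \<le> b" "b \<le> (a::real)"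
  shows "a powr p - b powr p \<le> p * a powr (p - 1) * (a - b)"
proof (cases "b < a")
  case True
  obtain z where z: "b < z" "z < a" "a powr p - b powr p = (a - b) * (p * z powr (p - 1))"
  proof (rule mvt[OF True])
    show "continuous_on {b..a} (\<lambda>x. x powr p)"
      using assms by (intro continuous_on_powr' continuous_intros) auto
    show "((\<lambda>x. x powr p) has_derivative (\<lambda>h. h * (p * x powr (p - 1)))) (at x)" if "b < x" "x < a" for x
      using that assms
      by (intro has_derivative_eq_rhs[OF has_real_derivative_powr[of x p, unfolded has_field_derivative_def]])
         (auto simp: fun_eq_iff)
  qed
  have "z powr (p - 1) \<le> a powr (p - 1)" using z assms by (intro powr_mono2) auto
  then have "(a - b) * (p * z powr (p - 1)) \<le> (a - b) * (p * a powr (p - 1))"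
    using assms by (intro mult_left_mono) auto
  then show ?thesis using z(3) by (simp add: ac_simps)
qed (use assms in auto)

lemma powr_diff_abs_le:
  assumes "p \<ge> 1" "0 \<le> a" "0 \<le> b" "a \<le> K" "b \<le> (K::real)"
  shows "\<bar>a powr p - b powr p\<bar> \<le> p * K powr (p - 1) * \<bar>a - b\<bar>"
proof -
  have *: "\<bar>a powr p - b powr p\<bar> \<le> p * K powr (p - 1) * \<bar>a - b\<bar>" if "0 \<le> b" "b \<le> a" "a \<le> K" for a b
  proof -
    have "b powr p \<le> a powr p" using that assms by (intro powr_mono2) auto
    then have "\<bar>a powr p - b powr p\<bar> = a powr p - b powr p" by simp
    also have "\<dots> \<le> p * a powr (p - 1) * (a - b)" using that assms by (intro powr_diff_le) auto
    also have "\<dots> \<le> p * K powr (p - 1) * (a - b)"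
      using that assms by (intro mult_right_mono mult_left_mono powr_mono2) auto
    finally show ?thesis using that by simp
  qed
  show ?thesis
    using *[of b a] *[of a b] assms by (cases "b \<le> a") (auto simp: abs_minus_commute)
qed

text \<open>Comparable on the ball to the distance from the sphere, but polynomial and with an
  explicit change under reflections.\<close>

definition bdist :: "real \<Rightarrow> 'a::euclidean_space \<Rightarrow> real" where
  "bdist R x = R\<^sup>2 - (norm x)\<^sup>2"

lemma bdist_pos: "x \<in> ball 0 R \<Longrightarrow> bdist R x > 0"
  by (auto simp: bdist_def intro!: power_strict_mono)

lemma bdist_le: "bdist R x \<le> R\<^sup>2"
  by (simp add: bdist_def)

text \<open>The quantity under the root equals
  \<open>R^2 * (norm (x - y))^2 + bdist R x * bdist R y\<close>, so both parts of the Green function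
  are one and the same power, taken at the squared distance and at a larger value.\<close>

lemma greenG_alt:
  fixes x y :: "real^'n::idx"
  assumes R: "R > 0" and x: "x \<in> ball 0 R" and y: "y \<in> ball 0 R"
  shows "greenG R x y = ((norm (x - y))\<^sup>2) powr (- (real CARD('n) - 2) / 2)
     - ((norm (x - y))\<^sup>2 + bdist R x * bdist R y / R\<^sup>2) powr (- (real CARD('n) - 2) / 2)"
proof -
  let ?q = "(norm (x - y))\<^sup>2 + bdist R x * bdist R y / R\<^sup>2"
  have e1: "(norm x)^2 * (norm y)^2 - 2 * R^2 * (x \<bullet> y) + R^4 = R\<^sup>2 * ?q"
  proof -
    have n: "(norm (x - y))\<^sup>2 = (norm x)\<^sup>2 + (norm y)\<^sup>2 - 2 * (x \<bullet> y)"
      by (simp add: power2_norm_eq_inner inner_diff_left inner_diff_right inner_commute)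
    have r: "R^4 = R\<^sup>2 * R\<^sup>2" by (simp add: power2_eq_square power4_eq_xxxx)
    have "R\<^sup>2 * ?q = R\<^sup>2 * (norm (x - y))\<^sup>2 + bdist R x * bdist R y"
      using R by (simp add: distrib_left)
    also have "\<dots> = (norm x)^2 * (norm y)^2 - 2 * R^2 * (x \<bullet> y) + R^4"
      unfolding n r bdist_def by (simp add: algebra_simps)
    finally show ?thesis by simp
  qed
  have q: "?q \<ge> 0" using bdist_pos[OF x] bdist_pos[OF y] by auto
  have "(1 / R) * sqrt (R\<^sup>2 * ?q) = sqrt ?q"
    using R by (simp add: real_sqrt_mult)
  then have e2: "(1 / R) * sqrt ((norm x)^2 * (norm y)^2 - 2 * R^2 * (x \<bullet> y) + R^4) = sqrt ?q"
    unfolding e1 .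
  have s: "sqrt t powr (2 - real CARD('n)) = t powr (- (real CARD('n) - 2) / 2)" if "t \<ge> 0" for t
  proof -
    have "sqrt t powr (2 - real CARD('n)) = (t powr (1/2)) powr (2 - real CARD('n))"
      using that by (simp add: powr_half_sqrt)
    also have "\<dots> = t powr ((1/2) * (2 - real CARD('n)))" by (rule powr_powr)
    also have "(1/2) * (2 - real CARD('n)) = - (real CARD('n) - 2) / 2" by (simp add: field_simps)
    finally show ?thesis .
  qed
  have "norm (x - y) = sqrt ((norm (x - y))\<^sup>2)" by simp
  then show ?thesis
    unfolding greenG_def e2 using s[OF q] s[of "(norm (x - y))\<^sup>2"] by simp
qed

lemma norm_powr_sq:
  "norm z powr (2 - real n) = ((norm z)\<^sup>2) powr (- (real n - 2) / 2)"
proof -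
  have "((norm z)\<^sup>2) powr (- (real n - 2) / 2) = (norm z powr 2) powr (- (real n - 2) / 2)"
    by (cases "z = 0") (simp_all add: powr_numeral)
  also have "\<dots> = norm z powr (2 * (- (real n - 2) / 2))" by (rule powr_powr)
  also have "2 * (- (real n - 2) / 2) = 2 - real n" by (simp add: field_simps)
  finally show ?thesis by simp
qed

section \<open>The Green kernel, its potential and the weak form of criticality\<close>

locale green_ball =
  fixes R :: real and dim :: "'n::idx itself"
  assumes R: "R > 0" and dim3: "CARD('n) \<ge> 3"
begin

text \<open>An integrable convolution kernel dominating the Green function; differences of points of
  the ball lie in the ball of radius \<open>2 * R\<close>.\<close>

definition kern :: "(real, 'n) vec \<Rightarrow> real" where
  "kern z = indicator (ball 0 (2 * R)) z * norm z powr (2 - real CARD('n))"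

definition kern_mass :: real where
  "kern_mass = (LINT z|lborel. kern z)"

text \<open>Extension by zero lets potentials be integrated over the whole space, where reflections
  and Fubini apply without regard to the domain.\<close>

definition gker :: "(real, 'n) vec \<Rightarrow> (real, 'n) vec \<Rightarrow> real" where
  "gker x y = indicator (ball 0 R) x * indicator (ball 0 R) y * greenG R x y"

definition pot :: "((real, 'n) vec \<Rightarrow> real) \<Rightarrow> (real, 'n) vec \<Rightarrow> real" where
  "pot f x = (LINT y|lborel. gker x y * f y)"

lemma kern_measurable [measurable]: "kern \<in> borel_measurable borel"
  unfolding kern_def[abs_def] by (auto intro!: borel_measurable_times borel_measurable_indicator powr_real_measurable)

lemma kern_nonneg: "kern z \<ge> 0" by (simp add: kern_def)

lemma kern_integrable: "integrable lborel kern"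
  unfolding kern_def[abs_def] using R dim3 by (intro integrable_norm_powr) auto

lemma kern_mass_nonneg: "kern_mass \<ge> 0"
  unfolding kern_mass_def by (intro integral_nonneg_AE) (auto simp: kern_nonneg)

lemma kern_minus: "kern (x - y) = kern (y - x)"
  by (simp add: kern_def indicator_def norm_minus_commute)

lemma kern_shift: "integrable lborel (\<lambda>y. kern (x - y))" "(LINT y|lborel. kern (x - y)) = kern_mass"
proof -
  have "integrable lborel (\<lambda>y. kern ((- x) + y))" "(LINT y|lborel. kern ((- x) + y)) = kern_mass"
    using integrable_distr[of "(+) (- x)" lborel borel kern] integral_distr[of "(+) (- x)" lborel borel kern]
      lborel_distr_plus[of "- x"] kern_integrable by (simp_all add: kern_mass_def)
  moreover have "(\<lambda>y. kern ((- x) + y)) = (\<lambda>y. kern (x - y))"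
    using kern_minus by (simp add: fun_eq_iff)
  ultimately show "integrable lborel (\<lambda>y. kern (x - y))" "(LINT y|lborel. kern (x - y)) = kern_mass" by simp_all
qed

text \<open>The diagonal has to be excluded because \<open>0 powr a\<close> is 0 for every
  \<open>a\<close>, so that \<open>gker x x\<close> is negative inside the ball; in integrals it is
  discarded as a null set.\<close>

lemma gker_bounds:
  assumes "x \<noteq> y"
  shows "0 \<le> gker x y" "gker x y \<le> kern (x - y)"
proof -
  have "0 \<le> gker x y \<and> gker x y \<le> kern (x - y)"
  proof (cases "x \<in> ball 0 R \<and> y \<in> ball 0 R")
    case True
    let ?t = "(norm (x - y))\<^sup>2" and ?q = "bdist R x * bdist R y / R\<^sup>2" and ?a = "- (real CARD('n) - 2) / 2"
    have t: "?t > 0" using assms by simp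
    have q: "?q \<ge> 0" using True bdist_pos[of x R] bdist_pos[of y R] by simp
    have "(?t + ?q) powr ?a \<le> ?t powr ?a"
      using t q dim3 by (intro powr_mono2') auto
    moreover have "norm (x - y) < 2 * R" using True norm_triangle_ineq4[of x y] by simp
    moreover have "gker x y = ?t powr ?a - (?t + ?q) powr ?a"
      using True greenG_alt[OF R, of x y] by (simp add: gker_def)
    moreover have "norm (x - y) powr (2 - real CARD('n)) = ?t powr ?a" by (rule norm_powr_sq)
    ultimately show ?thesis by (simp add: kern_def)
  qed (auto simp: gker_def kern_nonneg)
  then show "0 \<le> gker x y" "gker x y \<le> kern (x - y)" by auto
qed

lemma gker_sym: "gker x y = gker y x"
  by (simp add: gker_def greenG_def norm_minus_commute inner_commute mult.commute mult.left_commute)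

lemma gker_measurable [measurable]: "(\<lambda>z. gker (fst z) (snd z)) \<in> borel_measurable (borel \<Otimes>\<^sub>M borel)"
  unfolding gker_def greenG_def
  by (intro borel_measurable_times borel_measurable_diff powr_real_measurable) (measurable; simp)+

lemma AE_neq: "AE y in lborel. y \<noteq> (x::(real, 'n) vec)"
  by (rule AE_lborel_singleton)

lemma pot_integrable:
  assumes [measurable]: "f \<in> borel_measurable borel" and "\<And>y. \<bar>f y\<bar> \<le> B"
  shows "integrable lborel (\<lambda>y. gker x y * f y)"
proof (rule Bochner_Integration.integrable_bound)
  show "integrable lborel (\<lambda>y. B * kern (x - y))" using kern_shift(1) by simp
  show "(\<lambda>y. gker x y * f y) \<in> borel_measurable lborel"
    using measurable_compose[OF measurable_Pair1'[of x borel borel] gker_measurable] by simp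
  show "AE y in lborel. norm (gker x y * f y) \<le> norm (B * kern (x - y))"
    using AE_neq[of x]
  proof eventually_elim
    fix y assume "y \<noteq> x"
    then have "\<bar>gker x y\<bar> * \<bar>f y\<bar> \<le> kern (x - y) * B"
      using gker_bounds[of x y] assms(2)[of y] kern_nonneg by (intro mult_mono) auto
    then have "norm (gker x y * f y) \<le> B * kern (x - y)" by (simp add: abs_mult mult.commute)
    also have "\<dots> \<le> norm (B * kern (x - y))" by (metis abs_ge_self real_norm_def)
    finally show "norm (gker x y * f y) \<le> norm (B * kern (x - y))" .
  qed
qed

lemma pot_bound:
  assumes [measurable]: "f \<in> borel_measurable borel" and "\<And>y. \<bar>f y\<bar> \<le> B"
  shows "\<bar>pot f x\<bar> \<le> B * kern_mass"
proof -
  have "\<bar>pot f x\<bar> \<le> (LINT y|lborel. \<bar>gker x y * f y\<bar>)" unfolding pot_def by (rule integral_abs_bound)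
  also have "\<dots> \<le> (LINT y|lborel. B * kern (x - y))"
  proof (rule integral_mono_AE)
    show "AE y in lborel. \<bar>gker x y * f y\<bar> \<le> B * kern (x - y)"
      using AE_neq[of x]
    proof eventually_elim
      fix y assume "y \<noteq> x"
      then have "\<bar>gker x y\<bar> * \<bar>f y\<bar> \<le> kern (x - y) * B"
        using gker_bounds[of x y] assms(2)[of y] kern_nonneg by (intro mult_mono) auto
      then show "\<bar>gker x y * f y\<bar> \<le> B * kern (x - y)" by (simp add: abs_mult mult.commute)
    qed
  qed (use pot_integrable[OF assms] kern_shift(1) in auto)
  also have "\<dots> = B * kern_mass" using kern_shift by simp
  finally show ?thesis .
qed

lemma pot_measurable [measurable]:
  assumes [measurable]: "f \<in> borel_measurable borel"
  shows "pot f \<in> borel_measurable borel"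
proof -
  have "(\<lambda>z. gker (fst z) (snd z) * f (snd z)) \<in> borel_measurable (borel \<Otimes>\<^sub>M lborel)"
    by measurable
  then show ?thesis unfolding pot_def[abs_def]
    using lborel.borel_measurable_lebesgue_integral[of "\<lambda>x y. gker x y * f y" borel]
    by (simp add: case_prod_beta')
qed

lemma pot_outside: "x \<notin> ball 0 R \<Longrightarrow> pot f x = 0"
  by (simp add: pot_def gker_def)

lemma integrable_bounded_ball:
  fixes f :: "(real, 'n) vec \<Rightarrow> real"
  assumes "f \<in> borel_measurable borel" "\<And>x. \<bar>f x\<bar> \<le> B" "\<And>x. x \<notin> ball 0 R \<Longrightarrow> f x = 0"
  shows "integrable lborel f"
proof (rule Bochner_Integration.integrable_bound)
  show "integrable lborel (\<lambda>x. indicator (ball (0::(real, 'n) vec) R) x * B)"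
    using emeasure_lborel_ball_finite[of "0::(real, 'n) vec" R] by simp
  show "AE x in lborel. norm (f x) \<le> norm (indicator (ball 0 R) x * B)"
    using assms(2,3) by (intro AE_I2) (auto simp: indicator_def intro: order_trans[OF _ abs_ge_self])
qed (use assms in simp)

lemma pot_dominated:
  assumes [measurable]: "\<And>n. f n \<in> borel_measurable borel" "h \<in> borel_measurable borel"
    and "\<And>n y. \<bar>f n y\<bar> \<le> B" "\<And>y. (\<lambda>n. f n y) \<longlonglongrightarrow> h y"
  shows "(\<lambda>n. pot (f n) x) \<longlonglongrightarrow> pot h x"
  unfolding pot_def
proof (rule integral_dominated_convergence[where w = "\<lambda>y. B * kern (x - y)"])
  have [measurable]: "(\<lambda>y. gker x y) \<in> borel_measurable borel"
    using measurable_compose[OF measurable_Pair1'[of x borel borel] gker_measurable] by simp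
  show "(\<lambda>y. gker x y * h y) \<in> borel_measurable lborel" "\<And>i. (\<lambda>y. gker x y * f i y) \<in> borel_measurable lborel"
    by measurable
  show "integrable lborel (\<lambda>y. B * kern (x - y))" using kern_shift(1) by simp
  show "AE y in lborel. (\<lambda>i. gker x y * f i y) \<longlonglongrightarrow> gker x y * h y"
    using assms(4) by (intro AE_I2 tendsto_intros)
  show "AE y in lborel. norm (gker x y * f i y) \<le> B * kern (x - y)" for i
    using AE_neq[of x]
  proof eventually_elim
    fix y assume "y \<noteq> x"
    then have "\<bar>gker x y\<bar> * \<bar>f i y\<bar> \<le> kern (x - y) * B"
      using gker_bounds[of x y] assms(3)[of i y] kern_nonneg by (intro mult_mono) auto
    then show "norm (gker x y * f i y) \<le> B * kern (x - y)" by (simp add: abs_mult mult.commute)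
  qed
qed

text \<open>Symmetry of the kernel and Fubini; the majorant \<open>kern\<close> supplies the joint
  integrability.\<close>

lemma pot_symmetric:
  assumes [measurable]: "f \<in> borel_measurable borel" "h \<in> borel_measurable borel"
    and b: "\<And>y. \<bar>f y\<bar> \<le> B" "\<And>y. \<bar>h y\<bar> \<le> B'"
  shows "(LINT x|lborel. f x * pot h x) = (LINT x|lborel. h x * pot f x)"
proof -
  have m: "(\<lambda>(x, y). f x * (gker x y * h y)) \<in> borel_measurable (lborel \<Otimes>\<^sub>M lborel)"
    by (simp add: case_prod_beta')
  have i: "integrable (lborel \<Otimes>\<^sub>M lborel) (\<lambda>(x, y). f x * (gker x y * h y))"
  proof (rule lborel_pair.Fubini_integrable[OF m])
    show "AE x in lborel. integrable lborel (\<lambda>y. (\<lambda>(x, y). f x * (gker x y * h y)) (x, y))"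
      using pot_integrable[OF assms(2) b(2)] by simp
    have mn: "(\<lambda>x. LINT y|lborel. norm (f x * (gker x y * h y))) \<in> borel_measurable borel"
      using lborel.borel_measurable_lebesgue_integral[of "\<lambda>x y. norm (f x * (gker x y * h y))" borel]
      by (simp add: case_prod_beta')
    have "integrable lborel (\<lambda>x. LINT y|lborel. norm (f x * (gker x y * h y)))"
    proof (rule integrable_bounded_ball[OF mn])
      fix x
      show "\<bar>LINT y|lborel. norm (f x * (gker x y * h y))\<bar> \<le> B * (B' * kern_mass)"
      proof -
        have "(LINT y|lborel. norm (f x * (gker x y * h y))) = \<bar>f x\<bar> * (LINT y|lborel. \<bar>gker x y * h y\<bar>)"
          by (simp add: abs_mult)
        also have "(LINT y|lborel. \<bar>gker x y * h y\<bar>) \<le> (LINT y|lborel. B' * kern (x - y))"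
        proof (rule integral_mono_AE)
          show "AE y in lborel. \<bar>gker x y * h y\<bar> \<le> B' * kern (x - y)"
            using AE_neq[of x]
          proof eventually_elim
            fix y assume "y \<noteq> x"
            then have "\<bar>gker x y\<bar> * \<bar>h y\<bar> \<le> kern (x - y) * B'"
              using gker_bounds[of x y] b(2)[of y] kern_nonneg by (intro mult_mono) auto
            then show "\<bar>gker x y * h y\<bar> \<le> B' * kern (x - y)" by (simp add: abs_mult mult.commute)
          qed
        qed (use pot_integrable[OF assms(2) b(2)] kern_shift(1) in auto)
        also have "(LINT y|lborel. B' * kern (x - y)) = B' * kern_mass" using kern_shift by simp
        finally have "(LINT y|lborel. norm (f x * (gker x y * h y))) \<le> \<bar>f x\<bar> * (B' * kern_mass)"
          by (simp add: mult_left_mono)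
        also have "\<dots> \<le> B * (B' * kern_mass)"
          using b(1)[of x] b(2)[of x] kern_mass_nonneg by (intro mult_right_mono mult_nonneg_nonneg) auto
        finally show ?thesis by (simp add: abs_of_nonneg integral_nonneg_AE)
      qed
      show "x \<notin> ball 0 R \<Longrightarrow> (LINT y|lborel. norm (f x * (gker x y * h y))) = 0" by (simp add: gker_def)
    qed
    then show "integrable lborel (\<lambda>x. LINT y|lborel. norm ((\<lambda>(x, y). f x * (gker x y * h y)) (x, y)))" by simp
  qed
  have "(LINT x|lborel. f x * pot h x) = (LINT x|lborel. (LINT y|lborel. f x * (gker x y * h y)))"
    unfolding pot_def by simp
  also have "\<dots> = (LINT y|lborel. (LINT x|lborel. f x * (gker x y * h y)))"
    using lborel_pair.Fubini_integral[OF i] by simp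
  also have "\<dots> = (LINT y|lborel. h y * pot f y)"
    unfolding pot_def by (intro Bochner_Integration.integral_cong refl)
      (simp add: gker_sym[of _ "_::(real, 'n) vec"] ac_simps flip: integral_mult_right_zero)
  finally show ?thesis .
qed

lemma energy_double_integral:
  "(LINT x:ball 0 R|lborel. LINT y:ball 0 R|lborel. greenG R x y * \<bar>w y\<bar> powr p * \<bar>w x\<bar> powr p)
   = (LINT x|lborel. (indicator (ball 0 R) x * \<bar>w x\<bar> powr p) * pot (\<lambda>y. indicator (ball 0 R) y * \<bar>w y\<bar> powr p) x)"
  for w :: "(real, 'n) vec \<Rightarrow> real"
  unfolding set_lebesgue_integral_def pot_def
proof (intro Bochner_Integration.integral_cong refl)
  fix x :: "(real, 'n) vec"
  show "indicator (ball 0 R) x *\<^sub>R (LINT y|lborel. indicator (ball 0 R) y *\<^sub>R (greenG R x y * \<bar>w y\<bar> powr p * \<bar>w x\<bar> powr p))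
    = indicator (ball 0 R) x * \<bar>w x\<bar> powr p * (LINT y|lborel. gker x y * (indicator (ball 0 R) y * \<bar>w y\<bar> powr p))"
  proof (cases "x \<in> ball 0 R")
    case True
    have "(LINT y|lborel. indicator (ball 0 R) y *\<^sub>R (greenG R x y * \<bar>w y\<bar> powr p * \<bar>w x\<bar> powr p))
      = (LINT y|lborel. \<bar>w x\<bar> powr p * (gker x y * (indicator (ball 0 R) y * \<bar>w y\<bar> powr p)))"
      using True by (intro Bochner_Integration.integral_cong refl) (simp add: gker_def indicator_def)
    then show ?thesis using True by simp
  qed simp
qed

text \<open>Symmetry of the potential turns the increment into the pairing of
  \<open>f n - f0\<close> with \<open>pot (f n) + pot f0\<close>, and dominated convergence gives
  twice the pairing at the limit. The step sizes \<open>1 / real (Suc n)\<close> suffice, since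
  differentiability of the energy along lines is part of being a critical point.\<close>

lemma double_integral_derivative:
  fixes u v :: "(real, 'n) vec \<Rightarrow> real"
  assumes p: "p > 1" and [measurable]: "u \<in> borel_measurable borel" "v \<in> borel_measurable borel"
    and u: "\<And>x. x \<in> ball 0 R \<Longrightarrow> 0 < u x \<and> u x \<le> M" and v: "\<And>x. x \<in> ball 0 R \<Longrightarrow> \<bar>v x\<bar> \<le> B"
  defines "DD \<equiv> \<lambda>w. LINT x:ball 0 R|lborel. LINT y:ball 0 R|lborel. greenG R x y * \<bar>w y\<bar> powr p * \<bar>w x\<bar> powr p"
  shows "(\<lambda>n. (DD (\<lambda>x. u x + (1 / real (Suc n)) * v x) - DD u) / (1 / real (Suc n)))
     \<longlonglongrightarrow> 2 * p * (LINT x|lborel. pot (\<lambda>y. indicator (ball 0 R) y * u y powr p) x * (indicator (ball 0 R) x * u x powr (p - 1) * v x))"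
proof -
  let ?I = "\<lambda>x. indicator (ball (0::(real, 'n) vec) R) x :: real"
  define t where "t n = 1 / real (Suc n)" for n
  have t: "t n > 0" "t n \<le> 1" for n by (auto simp: t_def)
  have t0: "t \<longlonglongrightarrow> 0" unfolding t_def using LIMSEQ_inverse_real_of_nat by (simp add: inverse_eq_divide)
  define f where "f n x = ?I x * \<bar>u x + t n * v x\<bar> powr p" for n x
  define f0 where "f0 x = ?I x * u x powr p" for x
  define q where "q n x = (f n x - f0 x) / t n" for n x
  define q0 where "q0 x = p * (?I x * u x powr (p - 1) * v x)" for x
  \<comment> \<open>A common bound on the ball for \<open>u\<close> and all perturbed functions, the
    step sizes being at most 1.\<close>
  define K where "K = max M 0 + max B 0"
  have K: "K \<ge> 0" by (simp add: K_def)
  define Bf where "Bf = K powr p"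
  define Bq where "Bq = p * K powr (p - 1) * K"
  have mm: "f n \<in> borel_measurable borel" "f0 \<in> borel_measurable borel" "q n \<in> borel_measurable borel" "q0 \<in> borel_measurable borel" for n
    unfolding f_def[abs_def] f0_def[abs_def] q_def[abs_def] q0_def[abs_def] by (measurable; simp)+
  note [measurable] = mm
  have ab: "\<bar>u x + t n * v x\<bar> \<le> K" if "x \<in> ball 0 R" for n x
  proof -
    have "\<bar>u x + t n * v x\<bar> \<le> \<bar>u x\<bar> + t n * \<bar>v x\<bar>"
      using t(1)[of n] abs_triangle_ineq[of "u x" "t n * v x"] by (simp add: abs_mult)
    also have "\<dots> \<le> M + 1 * B"
      using u[OF that] v[OF that] t[of n] by (intro add_mono mult_mono) auto
    finally show ?thesis by (simp add: K_def)
  qed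
  have fb: "\<bar>f n x\<bar> \<le> Bf" for n x
    using ab[of x n] p by (auto simp: f_def Bf_def indicator_def intro!: powr_mono2)
  have f0b: "\<bar>f0 x\<bar> \<le> Bf" for x
    using u[of x] p by (auto simp: f0_def Bf_def K_def indicator_def intro!: powr_mono2)
  have qb: "\<bar>q n x\<bar> \<le> Bq" for n x
  proof (cases "x \<in> ball 0 R")
    case True
    have "\<bar>\<bar>u x + t n * v x\<bar> powr p - u x powr p\<bar> \<le> p * K powr (p - 1) * \<bar>\<bar>u x + t n * v x\<bar> - u x\<bar>"
      using p u[OF True] ab[OF True] by (intro powr_diff_abs_le) (auto simp: K_def)
    also have "\<dots> \<le> p * K powr (p - 1) * (t n * K)"
    proof (rule mult_left_mono)
      have "\<bar>\<bar>u x + t n * v x\<bar> - \<bar>u x\<bar>\<bar> \<le> \<bar>t n * v x\<bar>" using abs_triangle_ineq3[of "u x + t n * v x" "u x"] by simp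
      then have "\<bar>\<bar>u x + t n * v x\<bar> - u x\<bar> \<le> t n * \<bar>v x\<bar>" using u[OF True] t(1)[of n] by (simp add: abs_mult)
      also have "t n * \<bar>v x\<bar> \<le> t n * K" using v[OF True] t(1)[of n] by (intro mult_left_mono) (auto simp: K_def)
      finally show "\<bar>\<bar>u x + t n * v x\<bar> - u x\<bar> \<le> t n * K" .
    qed (use p in simp)
    also have "\<dots> = t n * Bq" by (simp add: Bq_def)
    finally have "\<bar>\<bar>u x + t n * v x\<bar> powr p - u x powr p\<bar> \<le> t n * Bq" .
    then show ?thesis
      using True t(1)[of n] by (simp add: q_def f_def f0_def divide_le_eq mult.commute)
  next
    case False
    then show ?thesis using p K by (simp add: q_def f_def f0_def Bq_def)
  qed
  have ql: "(\<lambda>n. q n x) \<longlonglongrightarrow> q0 x" for x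
  proof (cases "x \<in> ball 0 R")
    case True
    have "((\<lambda>s. (u x + s * v x) powr p) has_real_derivative p * (u x + 0 * v x) powr (p - 1) * v x) (at 0)"
    proof -
      have "((\<lambda>s. u x + s * v x) has_real_derivative v x) (at 0)"
        by (auto intro!: derivative_eq_intros)
      from DERIV_chain2[where f = "\<lambda>z. z powr p" and g = "\<lambda>s. u x + s * v x" and x = 0, OF has_real_derivative_powr this]
      show ?thesis using u[OF True] by simp
    qed
    then have "((\<lambda>s. ((u x + s * v x) powr p - u x powr p) / s) \<longlongrightarrow> p * u x powr (p - 1) * v x) (at 0)"
      by (simp add: DERIV_def)
    moreover have "filterlim t (at 0) sequentially"
      using t0 t(1) by (intro filterlim_atI) (auto simp: less_imp_neq[THEN not_sym])
    ultimately have l: "(\<lambda>n. ((u x + t n * v x) powr p - u x powr p) / t n) \<longlonglongrightarrow> p * u x powr (p - 1) * v x"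
      by (rule filterlim_compose)
    have "(\<lambda>n. u x + t n * v x) \<longlonglongrightarrow> u x + 0 * v x" by (intro tendsto_intros t0)
    then have "\<forall>\<^sub>F n in sequentially. u x + t n * v x > 0"
      using u[OF True] by (intro order_tendstoD(1)) auto
    then have "\<forall>\<^sub>F n in sequentially. ((u x + t n * v x) powr p - u x powr p) / t n = q n x"
      by eventually_elim (use True in \<open>simp add: q_def f_def f0_def\<close>)
    from Lim_transform_eventually[OF l this] show ?thesis using True by (simp add: q0_def mult.assoc)
  qed (simp add: q_def f_def f0_def q0_def)
  have DDn: "DD (\<lambda>x. u x + t n * v x) = (LINT x|lborel. f n x * pot (f n) x)" for n
    unfolding DD_def energy_double_integral f_def[abs_def] ..
  have DD0: "DD u = (LINT x|lborel. f0 x * pot f0 x)"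
  proof -
    have "(\<lambda>x. ?I x * \<bar>u x\<bar> powr p) = f0"
      using u[THEN conjunct1] by (auto simp: f0_def indicator_def fun_eq_iff abs_of_pos)
    then show ?thesis unfolding DD_def energy_double_integral by (metis (no_types, lifting))
  qed
  have fo: "x \<notin> ball 0 R \<Longrightarrow> f n x = 0" "x \<notin> ball 0 R \<Longrightarrow> f0 x = 0" "x \<notin> ball 0 R \<Longrightarrow> q n x = 0" for n x
    by (auto simp: f_def f0_def q_def)
  have ib: "integrable lborel (\<lambda>x. a x * pot b x)"
    if "a \<in> borel_measurable borel" "b \<in> borel_measurable borel" "\<And>x. \<bar>a x\<bar> \<le> A1" "\<And>x. \<bar>b x\<bar> \<le> A2" for a b A1 A2
  proof (rule integrable_bounded_ball)
    show "\<bar>a x * pot b x\<bar> \<le> A1 * (A2 * kern_mass)" for x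
      unfolding abs_mult using that(3)[of x] pot_bound[OF that(2,4), of x] by (intro mult_mono) auto
    show "x \<notin> ball 0 R \<Longrightarrow> a x * pot b x = 0" for x by (simp add: pot_outside)
    show "(\<lambda>x. a x * pot b x) \<in> borel_measurable borel" using that(1,2) by measurable
  qed
  have quot: "(DD (\<lambda>x. u x + t n * v x) - DD u) / t n = (LINT x|lborel. q n x * (pot (f n) x + pot f0 x))" for n
  proof -
    have i1: "integrable lborel (\<lambda>x. f n x * pot (f n) x)" "integrable lborel (\<lambda>x. f0 x * pot f0 x)"
      "integrable lborel (\<lambda>x. f n x * pot f0 x)" "integrable lborel (\<lambda>x. f0 x * pot (f n) x)"
      by (rule ib[OF mm(1) mm(1) fb fb], rule ib[OF mm(2) mm(2) f0b f0b], rule ib[OF mm(1) mm(2) fb f0b], rule ib[OF mm(2) mm(1) f0b fb])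
    have "(LINT x|lborel. q n x * (pot (f n) x + pot f0 x))
      = (LINT x|lborel. ((f n x * pot (f n) x + f n x * pot f0 x) - (f0 x * pot (f n) x + f0 x * pot f0 x)) / t n)"
      by (intro Bochner_Integration.integral_cong refl) (simp add: q_def field_simps)
    also have "\<dots> = (((LINT x|lborel. f n x * pot (f n) x) + (LINT x|lborel. f n x * pot f0 x))
        - ((LINT x|lborel. f0 x * pot (f n) x) + (LINT x|lborel. f0 x * pot f0 x))) / t n"
      using i1 by simp
    \<comment> \<open>By symmetry the two cross terms cancel.\<close>
    also have "(LINT x|lborel. f n x * pot f0 x) = (LINT x|lborel. f0 x * pot (f n) x)"
      by (rule pot_symmetric[OF mm(1,2) fb f0b])
    finally show ?thesis unfolding DDn DD0 by simp
  qed
  have "(\<lambda>n. LINT x|lborel. q n x * (pot (f n) x + pot f0 x)) \<longlonglongrightarrow> (LINT x|lborel. q0 x * (pot f0 x + pot f0 x))"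
  proof (rule integral_dominated_convergence[where w = "\<lambda>x. ?I x * (Bq * (Bf * kern_mass + Bf * kern_mass))"])
    show "integrable lborel (\<lambda>x. ?I x * (Bq * (Bf * kern_mass + Bf * kern_mass)))"
      using emeasure_lborel_ball_finite[of "0::(real, 'n) vec" R] by simp
    show "AE x in lborel. (\<lambda>n. q n x * (pot (f n) x + pot f0 x)) \<longlonglongrightarrow> q0 x * (pot f0 x + pot f0 x)"
    proof (intro AE_I2 tendsto_intros ql pot_dominated[where B = Bf] mm fb)
      fix y
      have "(\<lambda>n. f0 y + t n * q n y) \<longlonglongrightarrow> f0 y + 0 * q0 y" by (intro tendsto_intros t0 ql)
      moreover have "f0 y + t n * q n y = f n y" for n using t(1)[of n] by (simp add: q_def)
      ultimately show "(\<lambda>n. f n y) \<longlonglongrightarrow> f0 y" by simp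
    qed
    show "AE x in lborel. norm (q n x * (pot (f n) x + pot f0 x)) \<le> ?I x * (Bq * (Bf * kern_mass + Bf * kern_mass))" for n
    proof (intro AE_I2)
      fix x
      have "\<bar>pot (f n) x + pot f0 x\<bar> \<le> Bf * kern_mass + Bf * kern_mass"
        using pot_bound[OF mm(1) fb, of n x] pot_bound[OF mm(2) f0b, of x] by linarith
      then have "\<bar>q n x\<bar> * \<bar>pot (f n) x + pot f0 x\<bar> \<le> Bq * (Bf * kern_mass + Bf * kern_mass)"
        using qb[of n x] by (intro mult_mono) auto
      then show "norm (q n x * (pot (f n) x + pot f0 x)) \<le> ?I x * (Bq * (Bf * kern_mass + Bf * kern_mass))"
        using fo(3)[of x n] by (cases "x \<in> ball 0 R") (auto simp: abs_mult)
    qed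
  qed measurable
  also have "(LINT x|lborel. q0 x * (pot f0 x + pot f0 x)) = (LINT x|lborel. 2 * p * (pot f0 x * (?I x * u x powr (p - 1) * v x)))"
    by (intro Bochner_Integration.integral_cong refl) (simp add: q0_def)
  also have "\<dots> = 2 * p * (LINT x|lborel. pot f0 x * (?I x * u x powr (p - 1) * v x))" by simp
  finally have "(\<lambda>n. (DD (\<lambda>x. u x + t n * v x) - DD u) / t n) \<longlonglongrightarrow> 2 * p * (LINT x|lborel. pot f0 x * (?I x * u x powr (p - 1) * v x))"
    unfolding quot .
  then show ?thesis unfolding t_def f0_def .
qed

text \<open>The gradient part of the energy is a quadratic polynomial in \<open>t\<close>. The
  double integral is thus a combination of the energy and a polynomial, so its derivative is known
  from criticality; comparison with the limit of the difference quotients gives the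
  equation.\<close>

lemma weak_equation:
  fixes u v :: "(real, 'n) vec \<Rightarrow> real"
  assumes p: "p > 1" and crit: "critical_point R p u" and H: "H10_grad R u g" and Hv: "H10_grad R v gv"
    and u: "\<And>x. x \<in> ball 0 R \<Longrightarrow> 0 < u x \<and> u x \<le> M" and v: "\<And>x. x \<in> ball 0 R \<Longrightarrow> \<bar>v x\<bar> \<le> B"
  shows "(LINT x|lborel. g x \<bullet> gv x) + (LINT x|lborel. u x * v x)
    = (LINT x|lborel. pot (\<lambda>y. indicator (ball 0 R) y * u y powr p) x * (indicator (ball 0 R) x * u x powr (p - 1) * v x))" (is "_ = ?F")
proof -
  let ?I = "\<lambda>x. indicator (ball (0::(real, 'n) vec) R) x :: real"
  define DD where "DD w = (LINT x:ball 0 R|lborel. LINT y:ball 0 R|lborel. greenG R x y * \<bar>w y\<bar> powr p * \<bar>w x\<bar> powr p)" for w :: "(real, 'n) vec \<Rightarrow> real"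
  note mu = H10_grad_measurable[OF H] and mv = H10_grad_measurable[OF Hv]
  note [measurable] = mu mv
  note lu = H10_grad_l2[OF H] and lv = H10_grad_l2[OF Hv]
  define E where "E t = energyI R p (\<lambda>x. u x + t * v x)" for t
  have E: "(E has_real_derivative 0) (at 0)"
    using crit Hv unfolding critical_point_def H10_def E_def[abs_def] by blast
  define A0 where "A0 = (LINT x|lborel. (norm (g x))\<^sup>2) + (LINT x|lborel. (norm (u x))\<^sup>2)"
  define A1 where "A1 = (LINT x|lborel. g x \<bullet> gv x) + (LINT x|lborel. u x * v x)"
  define A2 where "A2 = (LINT x|lborel. (norm (gv x))\<^sup>2) + (LINT x|lborel. (norm (v x))\<^sup>2)"
  have En: "E t = (1/2) * (A0 + 2 * t * A1 + t\<^sup>2 * A2) - (1 / (2 * p)) * DD (\<lambda>x. u x + t * v x)" for t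
  proof -
    have Ht: "H10_grad R (\<lambda>x. u x + t * v x) (\<lambda>x. g x + t *\<^sub>R gv x)" by (rule H10_grad_lincomb[OF H Hv])
    \<comment> \<open>\<open>wgrad\<close> is an arbitrary choice among the weak gradients;
      uniqueness identifies it almost everywhere with the linear combination.\<close>
    have "H10_grad R (\<lambda>x. u x + t * v x) (wgrad R (\<lambda>x. u x + t * v x))"
      unfolding wgrad_def by (rule someI[of "H10_grad R (\<lambda>x. u x + t * v x)", OF Ht])
    note Hw = this
    have aeq: "AE x in lborel. wgrad R (\<lambda>x. u x + t * v x) x = g x + t *\<^sub>R gv x"
      by (rule H10_grad_unique[OF Hw Ht])
    have [measurable]: "wgrad R (\<lambda>x. u x + t * v x) \<in> borel_measurable borel" by (rule H10_grad_measurable[OF Hw])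
    have i: "integrable lborel (\<lambda>x. (norm (g x))\<^sup>2)" "integrable lborel (\<lambda>x. (norm (gv x))\<^sup>2)"
      "integrable lborel (\<lambda>x. (norm (u x))\<^sup>2)" "integrable lborel (\<lambda>x. (norm (v x))\<^sup>2)"
      by (rule l2sq_integrable(1)[OF mu(2) lu(2)], rule l2sq_integrable(1)[OF mv(2) lv(2)],
          rule l2sq_integrable(1)[OF mu(1) lu(1)], rule l2sq_integrable(1)[OF mv(1) lv(1)])
    have i': "integrable lborel (\<lambda>x. g x \<bullet> gv x)" "integrable lborel (\<lambda>x. u x \<bullet> v x)"
      by (rule l2_inner_integrable[OF mu(2) mv(2) lu(2) lv(2)], rule l2_inner_integrable[OF mu(1) mv(1) lu(1) lv(1)])
    have "(LINT x:ball 0 R|lborel. (norm (wgrad R (\<lambda>x. u x + t * v x) x))\<^sup>2 + (u x + t * v x)\<^sup>2)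
      = (LINT x|lborel. ((norm (g x))\<^sup>2 + 2 * t * (g x \<bullet> gv x) + t\<^sup>2 * (norm (gv x))\<^sup>2)
          + ((norm (u x))\<^sup>2 + 2 * t * (u x \<bullet> v x) + t\<^sup>2 * (norm (v x))\<^sup>2))"
      unfolding set_lebesgue_integral_def
    proof (rule integral_cong_AE)
      show "AE x in lborel. ?I x *\<^sub>R ((norm (wgrad R (\<lambda>x. u x + t * v x) x))\<^sup>2 + (u x + t * v x)\<^sup>2)
        = ((norm (g x))\<^sup>2 + 2 * t * (g x \<bullet> gv x) + t\<^sup>2 * (norm (gv x))\<^sup>2)
          + ((norm (u x))\<^sup>2 + 2 * t * (u x \<bullet> v x) + t\<^sup>2 * (norm (v x))\<^sup>2)"
        using aeq H10_grad_outside[OF H] H10_grad_outside[OF Hv]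
      proof eventually_elim
        fix x assume x: "wgrad R (\<lambda>x. u x + t * v x) x = g x + t *\<^sub>R gv x"
          "x \<notin> ball 0 R \<longrightarrow> u x = 0 \<and> g x = 0" "x \<notin> ball 0 R \<longrightarrow> v x = 0 \<and> gv x = 0"
        have e1: "(norm (g x + t *\<^sub>R gv x))\<^sup>2 = (norm (g x))\<^sup>2 + 2 * t * (g x \<bullet> gv x) + t\<^sup>2 * (norm (gv x))\<^sup>2"
          unfolding power2_norm_eq_inner
          by (simp add: inner_add_left inner_add_right inner_commute[of "gv x" "g x"] algebra_simps power2_eq_square[of t])
        have e2: "(u x + t * v x)\<^sup>2 = (norm (u x))\<^sup>2 + 2 * t * (u x \<bullet> v x) + t\<^sup>2 * (norm (v x))\<^sup>2"
          by (simp add: power2_sum power_mult_distrib)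
        show "?I x *\<^sub>R ((norm (wgrad R (\<lambda>x. u x + t * v x) x))\<^sup>2 + (u x + t * v x)\<^sup>2)
        = ((norm (g x))\<^sup>2 + 2 * t * (g x \<bullet> gv x) + t\<^sup>2 * (norm (gv x))\<^sup>2)
          + ((norm (u x))\<^sup>2 + 2 * t * (u x \<bullet> v x) + t\<^sup>2 * (norm (v x))\<^sup>2)"
          unfolding x(1) e1 e2 using x(2,3) by (cases "x \<in> ball 0 R") auto
      qed
    qed measurable
    also have "\<dots> = A0 + 2 * t * A1 + t\<^sup>2 * A2"
      using i i' by (simp add: A0_def A1_def A2_def distrib_left)
    finally show ?thesis unfolding E_def energyI_def DD_def by simp
  qed
  have DDE: "DD (\<lambda>x. u x + t * v x) = 2 * p * ((1/2) * (A0 + 2 * t * A1 + t\<^sup>2 * A2) - E t)" for t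
    using En[of t] p by (simp add: field_simps)
  have "((\<lambda>t. 2 * p * ((1/2) * (A0 + 2 * t * A1 + t\<^sup>2 * A2) - E t)) has_real_derivative 2 * p * A1) (at 0)"
    by (auto intro!: derivative_eq_intros E)
  then have "((\<lambda>t. DD (\<lambda>x. u x + t * v x)) has_real_derivative 2 * p * A1) (at 0)"
    unfolding DDE .
  then have "((\<lambda>t. (DD (\<lambda>x. u x + t * v x) - DD u) / t) \<longlongrightarrow> 2 * p * A1) (at 0)"
    by (simp add: DERIV_def)
  moreover have "(\<lambda>n. 1 / real (Suc n)) \<longlonglongrightarrow> 0"
    using LIMSEQ_inverse_real_of_nat by (simp add: inverse_eq_divide)
  then have "filterlim (\<lambda>n. 1 / real (Suc n)) (at 0) sequentially"
    by (rule filterlim_atI) auto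
  ultimately have "(\<lambda>n. (DD (\<lambda>x. u x + (1 / real (Suc n)) * v x) - DD u) / (1 / real (Suc n))) \<longlonglongrightarrow> 2 * p * A1"
    by (rule filterlim_compose)
  moreover have "(\<lambda>n. (DD (\<lambda>x. u x + (1 / real (Suc n)) * v x) - DD u) / (1 / real (Suc n))) \<longlonglongrightarrow> 2 * p * ?F"
    unfolding DD_def by (rule double_integral_derivative[OF p mu(1) mv(1) u v])
  ultimately have "2 * p * A1 = 2 * p * ?F" by (rule LIMSEQ_unique)
  then show ?thesis using p by (simp add: A1_def)
qed

end

section \<open>Reflections of the Green potential\<close>

lemma AE_not_hyperplane:
  fixes e :: "'a::euclidean_space"
  assumes "e \<noteq> 0"
  shows "AE y in lborel. y \<bullet> e \<noteq> l"
proof -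
  have "negligible {y. e \<bullet> y = l}" using assms by (intro negligible_hyperplane) simp
  then have "{y. e \<bullet> y = l} \<in> null_sets lebesgue" by (simp add: negligible_iff_null_sets)
  moreover have "{y. e \<bullet> y = l} \<in> sets borel"
    by (intro borel_closed closed_Collect_eq continuous_intros)
  ultimately have "{y. e \<bullet> y = l} \<in> null_sets lborel"
    by (simp add: null_sets_completion_iff)
  then show ?thesis by (rule AE_I') (auto simp: inner_commute)
qed

lemma norm_hrefl_le:
  assumes "norm e = 1" "0 \<le> l" "l \<le> x \<bullet> e"
  shows "norm (hrefl e l x) \<le> norm x"
proof -
  have "(norm (hrefl e l x))\<^sup>2 \<le> (norm x)\<^sup>2"
    unfolding norm_hrefl_sq[OF assms(1)] using assms by simp
  then show ?thesis by (rule power2_le_imp_le) simp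
qed

text \<open>By convexity of the negative power, its decrease over an interval of fixed length
  \<open>d\<close> is smaller the further right the interval lies.\<close>

lemma powr_neg_drop_antimono:
  fixes a b c d :: real
  assumes "c > 0" "0 < a" "a \<le> b" "0 \<le> d"
  shows "b powr (- c) - (b + d) powr (- c) \<le> a powr (- c) - (a + d) powr (- c)"
proof (rule DERIV_nonpos_imp_nonincreasing[OF assms(3)])
  fix r assume r: "a \<le> r" "r \<le> b"
  have "((\<lambda>r. r powr (- c) - (r + d) powr (- c)) has_real_derivative
      (- c) * r powr (- c - 1) - (- c) * (r + d) powr (- c - 1)) (at r)"
    using r assms by (auto intro!: derivative_eq_intros)
  moreover have "(r + d) powr (- c - 1) \<le> r powr (- c - 1)"
    using r assms by (intro powr_mono2') auto
  then have "(- c) * r powr (- c - 1) - (- c) * (r + d) powr (- c - 1) \<le> 0"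
    using assms by (simp add: mult_left_mono)
  ultimately show "\<exists>y. ((\<lambda>r. r powr (- c) - (r + d) powr (- c)) has_real_derivative y) (at r) \<and> y \<le> 0"
    by blast
qed

context green_ball
begin

text \<open>Half of \<open>N - 2\<close>, since the kernels are written as powers of squared
  distances.\<close>

definition kap :: real where "kap = (real CARD('n) - 2) / 2"

lemma kap_pos: "kap > 0" using dim3 by (simp add: kap_def)

lemma gker_alt:
  assumes "x \<in> ball 0 R" "y \<in> ball 0 R"
  shows "gker x y = ((norm (x - y))\<^sup>2) powr (- kap) - ((norm (x - y))\<^sup>2 + bdist R x * bdist R y / R\<^sup>2) powr (- kap)"
  using greenG_alt[OF R assms] assms by (simp add: gker_def kap_def minus_divide_left)

lemma bdist_hrefl:
  "norm e = 1 \<Longrightarrow> bdist R (hrefl e l x) = bdist R x + 4 * l * (x \<bullet> e - l)" for e :: "(real, 'n) vec"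
  by (simp add: bdist_def norm_hrefl_sq)

text \<open>Reflecting \<open>x\<close> brings it nearer to \<open>y\<close> and enlarges the
  product of the \<open>bdist\<close> terms by at least \<open>4 * l * \<eta> * bdist R y\<close>.
  Both effects raise the kernel, and the second is measured at the largest possible argument:
  \<open>5 * R^2\<close> is \<open>4 * R^2\<close> for the squared distance plus \<open>R^2\<close>
  for the other term. This makes the bound independent of \<open>x\<close>.\<close>

lemma gker_hrefl_lower:
  assumes e: "norm e = 1" and l: "0 \<le> l" and x: "x \<in> ball 0 R" "l < x \<bullet> e"
    and y: "y \<in> ball 0 R" "y \<bullet> e \<le> l" "y \<noteq> hrefl e l x" and \<eta>: "0 \<le> \<eta>" "\<eta> \<le> x \<bullet> e - l"
  shows "(5 * R\<^sup>2) powr (- kap) - (5 * R\<^sup>2 + 4 * l * \<eta> * bdist R y / R\<^sup>2) powr (- kap) \<le> gker (hrefl e l x) y - gker x y"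
proof -
  define t where "t = (norm (x - y))\<^sup>2"
  define t' where "t' = (norm (hrefl e l x - y))\<^sup>2"
  define q where "q = bdist R x * bdist R y / R\<^sup>2"
  define q' where "q' = bdist R (hrefl e l x) * bdist R y / R\<^sup>2"
  define d where "d = 4 * l * \<eta> * bdist R y / R\<^sup>2"
  have sx: "hrefl e l x \<in> ball 0 R" using norm_hrefl_le[OF e l, of x] x by auto
  have bp: "bdist R y > 0" "bdist R x > 0" using bdist_pos x y by auto
  have t': "t' > 0" using y(3) by (auto simp: t'_def)
  have tt: "t' \<le> t"
  proof -
    have "t' = t + 4 * (x \<bullet> e - l) * (y \<bullet> e - l)"
      unfolding t'_def t_def dist_hrefl_swap[OF e] dist_hrefl_sq[OF e] ..
    moreover have "4 * (x \<bullet> e - l) * (y \<bullet> e - l) \<le> 0" using x y by (simp add: mult_le_0_iff)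
    ultimately show ?thesis by simp
  qed
  have q0: "q \<ge> 0" using bp by (simp add: q_def)
  have qq: "q' - q \<ge> d"
  proof -
    have "q' - q = 4 * l * (x \<bullet> e - l) * bdist R y / R\<^sup>2"
      unfolding q'_def q_def bdist_hrefl[OF e] using R by (simp add: field_simps)
    moreover have "4 * l * \<eta> * bdist R y / R\<^sup>2 \<le> 4 * l * (x \<bullet> e - l) * bdist R y / R\<^sup>2"
      using l \<eta> bp by (intro divide_right_mono mult_right_mono mult_left_mono) auto
    ultimately show ?thesis by (simp add: d_def)
  qed
  have d0: "d \<ge> 0" using l \<eta> bp by (simp add: d_def)
  have T: "t' + q \<le> 5 * R\<^sup>2"
  proof -
    have "norm (x - y) \<le> 2 * R" using x y norm_triangle_ineq4[of x y] by simp
    then have "t \<le> (2 * R)\<^sup>2" unfolding t_def by (intro power_mono) auto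
    moreover have "q \<le> R\<^sup>2"
    proof -
      have "bdist R x * bdist R y \<le> R\<^sup>2 * R\<^sup>2"
        using bp bdist_le by (intro mult_mono) (auto simp: less_imp_le)
      then show ?thesis using R by (simp add: q_def divide_le_eq)
    qed
    ultimately show ?thesis using tt by (simp add: power_mult_distrib)
  qed
  have "gker (hrefl e l x) y - gker x y = (t' powr (- kap) - (t' + q') powr (- kap)) - (t powr (- kap) - (t + q) powr (- kap))"
    unfolding gker_alt[OF sx y(1)] gker_alt[OF x(1) y(1)] t_def t'_def q_def q'_def ..
  moreover have "t powr (- kap) - (t + q) powr (- kap) \<le> t' powr (- kap) - (t' + q) powr (- kap)"
    by (rule powr_neg_drop_antimono[OF kap_pos t' tt q0])
  moreover have "(t' + q') powr (- kap) \<le> (t' + q + d) powr (- kap)"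
    using t' q0 qq d0 kap_pos by (intro powr_mono2') auto
  moreover have "(5 * R\<^sup>2) powr (- kap) - (5 * R\<^sup>2 + d) powr (- kap) \<le> (t' + q) powr (- kap) - (t' + q + d) powr (- kap)"
    using t' q0 by (intro powr_neg_drop_antimono[OF kap_pos _ T d0]) auto
  ultimately show ?thesis unfolding d_def[symmetric] by linarith
qed

lemma gker_hrefl_mono:
  assumes "norm e = 1" "0 \<le> l" "x \<in> ball 0 R" "l < x \<bullet> e" "y \<bullet> e \<le> l" "y \<noteq> hrefl e l x"
  shows "gker x y \<le> gker (hrefl e l x) y"
proof (cases "y \<in> ball 0 R")
  case True
  then show ?thesis using gker_hrefl_lower[OF assms(1-4) True assms(5,6), of 0] assms(4) by simp
qed (simp add: gker_def)

text \<open>The first summands of the four Green functions cancel; what remains is the comparison of two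
  drops of the convex decreasing function \<open>r \<mapsto> r powr (- kap)\<close>.\<close>
lemma gker_hrefl_four:
  assumes e: "norm e = 1" and l: "0 \<le> l" and x: "x \<in> ball 0 R" "l < x \<bullet> e"
    and y: "y \<in> ball 0 R" "l < y \<bullet> e" "x \<noteq> y"
  shows "gker x y + gker x (hrefl e l y) \<le> gker (hrefl e l x) (hrefl e l y) + gker (hrefl e l x) y"
proof -
  define X X' Y Y' where "X = bdist R x" and "X' = bdist R (hrefl e l x)" and "Y = bdist R y" and "Y' = bdist R (hrefl e l y)"
  define t1 where "t1 = (norm (x - y))\<^sup>2"
  define t2 where "t2 = (norm (x - hrefl e l y))\<^sup>2"
  let ?k = "\<lambda>r. r powr (- kap)"
  have sx: "hrefl e l x \<in> ball 0 R" "hrefl e l y \<in> ball 0 R"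
    using norm_hrefl_le[OF e l, of x] norm_hrefl_le[OF e l, of y] x y by auto
  have pos: "X > 0" "Y > 0" unfolding X_def Y_def using bdist_pos x y by auto
  have XX: "X \<le> X'" "Y \<le> Y'" unfolding X_def Y_def X'_def Y'_def bdist_hrefl[OF e] using l x y by auto
  have t1: "t1 > 0" using y(3) by (simp add: t1_def)
  have t12: "t1 \<le> t2" unfolding t1_def t2_def dist_hrefl_sq[OF e] using x y by simp
  have g: "gker x y = ?k t1 - ?k (t1 + X * Y / R\<^sup>2)" "gker x (hrefl e l y) = ?k t2 - ?k (t2 + X * Y' / R\<^sup>2)"
    "gker (hrefl e l x) (hrefl e l y) = ?k t1 - ?k (t1 + X' * Y' / R\<^sup>2)"
    "gker (hrefl e l x) y = ?k t2 - ?k (t2 + X' * Y / R\<^sup>2)"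
    using gker_alt[OF x(1) y(1)] gker_alt[OF x(1) sx(2)] gker_alt[OF sx] gker_alt[OF sx(1) y(1)]
      dist_hrefl[OF e, of l x y] dist_hrefl_swap[OF e, of l x y]
    by (simp_all add: t1_def t2_def X_def Y_def X'_def Y'_def)
  have R2: "R\<^sup>2 > 0" using R by simp
  have p1: "X * Y \<le> X' * Y" "X * Y \<le> X * Y'" "X' * Y \<le> X' * Y'" "X * Y' \<le> X' * Y'" "0 < X * Y"
    using pos XX by (auto intro!: mult_mono)
  have anti: "?k b \<le> ?k a" if "0 < a" "a \<le> b" for a b
    using that kap_pos by (intro powr_mono2') auto
  have "?k (t2 + X' * Y / R\<^sup>2) - ?k (t2 + X * Y' / R\<^sup>2) \<le> ?k (t1 + X * Y / R\<^sup>2) - ?k (t1 + X' * Y' / R\<^sup>2)"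
  proof (cases "X * Y' \<le> X' * Y")
    case True
    \<comment> \<open>In this case the left-hand side is at most 0 and the right-hand side at least
      0.\<close>
    have "?k (t2 + X' * Y / R\<^sup>2) \<le> ?k (t2 + X * Y' / R\<^sup>2)"
      using t1 t12 p1 True by (intro anti add_pos_nonneg add_left_mono divide_right_mono divide_nonneg_pos R2) auto
    moreover have "?k (t1 + X' * Y' / R\<^sup>2) \<le> ?k (t1 + X * Y / R\<^sup>2)"
      using t1 p1 by (intro anti add_pos_nonneg add_left_mono divide_right_mono divide_nonneg_pos R2) auto
    ultimately show ?thesis by linarith
  next
    case False
    \<comment> \<open>Otherwise the left-hand side is a drop of length \<open>d\<close>; replacing
      \<open>t2\<close> by the smaller \<open>t1\<close> in its starting point makes it
      larger.\<close>
    define d where "d = (X * Y' - X' * Y) / R\<^sup>2"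
    have d: "d \<ge> 0" using False by (simp add: d_def)
    have e1: "t2 + X * Y' / R\<^sup>2 = (t2 + X' * Y / R\<^sup>2) + d" "t1 + X * Y' / R\<^sup>2 = (t1 + X' * Y / R\<^sup>2) + d"
      by (auto simp: d_def diff_divide_distrib)
    have "?k (t2 + X' * Y / R\<^sup>2) - ?k (t2 + X * Y' / R\<^sup>2) \<le> ?k (t1 + X' * Y / R\<^sup>2) - ?k (t1 + X * Y' / R\<^sup>2)"
      unfolding e1 using t1 t12 p1 by (intro powr_neg_drop_antimono[OF kap_pos _ _ d] add_pos_nonneg divide_nonneg_pos R2) auto
    moreover have "?k (t1 + X' * Y / R\<^sup>2) \<le> ?k (t1 + X * Y / R\<^sup>2)"
      using t1 p1 by (intro anti add_pos_nonneg add_left_mono divide_right_mono divide_nonneg_pos R2) auto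
    moreover have "?k (t1 + X' * Y' / R\<^sup>2) \<le> ?k (t1 + X * Y' / R\<^sup>2)"
      using t1 p1 by (intro anti add_pos_nonneg add_left_mono divide_right_mono divide_nonneg_pos R2) auto
    ultimately show ?thesis by linarith
  qed
  then show ?thesis unfolding g by linarith
qed

end

section \<open>Bounded positive solutions and the comparison of their potential at mirror
  points\<close>

locale positive_solution = green_ball R dim for R and dim :: "'n::idx itself" +
  fixes U :: "(real, 'n) vec \<Rightarrow> real" and g :: "(real, 'n) vec \<Rightarrow> (real, 'n) vec" and p M :: real
  assumes p: "p > 1"
    and U_pos: "x \<in> ball 0 R \<Longrightarrow> 0 < U x"
    and U_le: "U x \<le> M"
    and U_out: "x \<notin> ball 0 R \<Longrightarrow> U x = 0"
    and U_cont: "continuous_on (ball 0 R) U"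
    and U_H10: "H10_grad R U g"
    and weak: "H10_grad R v gv \<Longrightarrow> (\<And>x. \<bar>v x\<bar> \<le> B) \<Longrightarrow>
      (LINT x|lborel. g x \<bullet> gv x) + (LINT x|lborel. U x * v x)
        = (LINT x|lborel. pot (\<lambda>y. U y powr p) x * (U x powr (p - 1) * v x))"
begin

definition V :: "(real, 'n) vec \<Rightarrow> real" where "V = pot (\<lambda>y. U y powr p)"

lemma U_meas [measurable]: "U \<in> borel_measurable borel" and g_meas [measurable]: "g \<in> borel_measurable borel"
  using H10_grad_measurable[OF U_H10] by auto

lemma U_nonneg: "0 \<le> U x"
  using U_pos[of x] U_out[of x] by (cases "x \<in> ball 0 R") auto

lemma M_pos: "M > 0"
  using U_pos[of 0] U_le[of 0] R by auto

lemma Up_bound: "\<bar>U y powr p\<bar> \<le> M powr p"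
  using U_nonneg U_le p by (auto intro!: powr_mono2)

lemma Up_meas [measurable]: "(\<lambda>y. U y powr p) \<in> borel_measurable borel"
  by (intro powr_real_measurable) auto

lemma V_meas [measurable]: "V \<in> borel_measurable borel"
  unfolding V_def by measurable

lemma V_bound: "\<bar>V x\<bar> \<le> M powr p * kern_mass"
  unfolding V_def by (rule pot_bound[OF Up_meas Up_bound])

lemma V_nonneg: "0 \<le> V x"
  unfolding V_def pot_def
proof (rule integral_nonneg_AE)
  show "AE y in lborel. 0 \<le> gker x y * U y powr p"
    using AE_neq[of x] by eventually_elim (use gker_bounds in auto)
qed

lemma V_outside: "x \<notin> ball 0 R \<Longrightarrow> V x = 0"
  unfolding V_def by (rule pot_outside)

lemma gker_meas1 [measurable]: "(\<lambda>y. gker x y) \<in> borel_measurable borel"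
  using measurable_compose[OF measurable_Pair1'[of x borel borel] gker_measurable] by simp

text \<open>Folding the integral along the plane, which is a null set, expresses the potential
  through pairs of mirror points.\<close>

lemma V_hrefl_split:
  assumes e: "norm e = 1"
  shows "integrable lborel (\<lambda>y. indicator {y. l < y \<bullet> e} y * (gker x y * U y powr p + gker x (hrefl e l y) * U (hrefl e l y) powr p))"
    "V x = (LINT y|lborel. indicator {y. l < y \<bullet> e} y * (gker x y * U y powr p + gker x (hrefl e l y) * U (hrefl e l y) powr p))"
proof -
  let ?H = "{y. l < y \<bullet> e}"
  have om [measurable]: "?H \<in> sets borel" by (intro borel_open open_Collect_less continuous_intros)
  define f where "f y = gker x y * U y powr p" for y
  have fi: "integrable lborel f" unfolding f_def[abs_def] by (rule pot_integrable[OF Up_meas Up_bound])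
  have [measurable]: "f \<in> borel_measurable borel" using borel_measurable_integrable[OF fi] by simp
  have i1: "integrable lborel (\<lambda>y. indicator ?H y * f y)"
    using integrable_mult_indicator[OF _ fi, of ?H] by simp
  have i2: "integrable lborel (\<lambda>y. indicator (- ?H) y * f y)"
    using integrable_mult_indicator[OF _ fi, of "- ?H"] by simp
  have i3: "integrable lborel (\<lambda>y. indicator (- ?H) (hrefl e l y) * f (hrefl e l y))"
    using integrable_hrefl[OF e i2] .
  have ae: "AE y in lborel. indicator (- ?H) (hrefl e l y) * f (hrefl e l y) = indicator ?H y * f (hrefl e l y)"
  proof -
    have "e \<noteq> 0" using e by auto
    from AE_not_hyperplane[OF this, of l] show ?thesis
      by eventually_elim (auto simp: indicator_def hrefl_inner[OF e])
  qed
  have i4: "integrable lborel (\<lambda>y. indicator ?H y * f (hrefl e l y))"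
    by (rule integrable_cong_AE_imp[OF i3 _ ae]) measurable
  have "integrable lborel (\<lambda>y. indicator ?H y * f y + indicator ?H y * f (hrefl e l y))"
    using i1 i4 by simp
  then show "integrable lborel (\<lambda>y. indicator ?H y * (gker x y * U y powr p + gker x (hrefl e l y) * U (hrefl e l y) powr p))"
    by (simp add: f_def distrib_left)
  have "V x = (LINT y|lborel. f y)" by (simp add: V_def pot_def f_def)
  also have "\<dots> = (LINT y|lborel. indicator ?H y * f y + indicator (- ?H) y * f y)"
    by (intro Bochner_Integration.integral_cong refl) (auto simp: indicator_def)
  also have "\<dots> = (LINT y|lborel. indicator ?H y * f y) + (LINT y|lborel. indicator (- ?H) y * f y)"
    using i1 i2 by simp
  also have "(LINT y|lborel. indicator (- ?H) y * f y) = (LINT y|lborel. indicator (- ?H) (hrefl e l y) * f (hrefl e l y))"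
    by (rule integral_hrefl[OF e, symmetric]) measurable
  also have "\<dots> = (LINT y|lborel. indicator ?H y * f (hrefl e l y))"
    by (rule integral_cong_AE[OF _ _ ae]) measurable
  also have "(LINT y|lborel. indicator ?H y * f y) + (LINT y|lborel. indicator ?H y * f (hrefl e l y))
      = (LINT y|lborel. indicator ?H y * f y + indicator ?H y * f (hrefl e l y))"
    using i1 i4 by simp
  finally show "V x = (LINT y|lborel. indicator ?H y * (gker x y * U y powr p + gker x (hrefl e l y) * U (hrefl e l y) powr p))"
    by (simp add: f_def distrib_left)
qed

text \<open>The weight that the value of \<open>U powr p\<close> at the mirror point of
  \<open>y\<close> receives in \<open>V (hrefl e l x) - V x\<close> after folding.\<close>

definition ckern :: "(real, 'n) vec \<Rightarrow> real \<Rightarrow> (real, 'n) vec \<Rightarrow> (real, 'n) vec \<Rightarrow> real" where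
  "ckern e l x y = gker (hrefl e l x) (hrefl e l y) - gker x (hrefl e l y)"

text \<open>The lower bound compares positions on opposite sides of the plane; the upper bound drops
  the subtracted kernel and uses that reflections are isometries.\<close>

lemma ckern_bounds:
  assumes "norm e = 1" "0 \<le> l" "x \<in> ball 0 R" "l < x \<bullet> e" "l < y \<bullet> e" "y \<noteq> x"
  shows "0 \<le> ckern e l x y" "ckern e l x y \<le> kern (x - y)"
proof -
  have n: "hrefl e l y \<noteq> hrefl e l x" using assms(1,6) by (metis hrefl_hrefl)
  have s: "hrefl e l y \<bullet> e \<le> l" using assms by (simp add: hrefl_inner)
  show "0 \<le> ckern e l x y"
    using gker_hrefl_mono[OF assms(1-4) s n] by (simp add: ckern_def)
  have nx: "x \<noteq> hrefl e l y" using s assms(4) by auto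
  have "ckern e l x y \<le> gker (hrefl e l x) (hrefl e l y)"
    using gker_bounds(1)[OF nx] by (simp add: ckern_def)
  also have "\<dots> \<le> kern (hrefl e l x - hrefl e l y)" using n by (intro gker_bounds) auto
  also have "\<dots> = kern (x - y)" using assms(1) by (simp add: kern_def dist_hrefl indicator_def)
  finally show "ckern e l x y \<le> kern (x - y)" .
qed

lemma ckern_meas [measurable]: "(\<lambda>y. ckern e l x y) \<in> borel_measurable borel"
  unfolding ckern_def by measurable

text \<open>After folding, the coefficient of \<open>U y powr p\<close> is at least
  \<open>- ckern e l x y\<close> by the inequality for four kernels, so the difference of potentials
  is controlled by differences of \<open>U powr p\<close> at mirror points alone. For
  \<open>y\<close> outside the ball that term is 0 because \<open>U y\<close> is.\<close>

lemma V_hrefl_diff: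
  assumes e: "norm e = 1" and l: "0 \<le> l" and x: "x \<in> ball 0 R" "l < x \<bullet> e"
  shows "integrable lborel (\<lambda>y. indicator {y. l < y \<bullet> e} y * (ckern e l x y * (U (hrefl e l y) powr p - U y powr p)))"
    "(LINT y|lborel. indicator {y. l < y \<bullet> e} y * (ckern e l x y * (U (hrefl e l y) powr p - U y powr p))) \<le> V (hrefl e l x) - V x"
proof -
  let ?H = "{y. l < y \<bullet> e}"
  have om [measurable]: "?H \<in> sets borel" by (intro borel_open open_Collect_less continuous_intros)
  show i: "integrable lborel (\<lambda>y. indicator ?H y * (ckern e l x y * (U (hrefl e l y) powr p - U y powr p)))"
  proof (rule Bochner_Integration.integrable_bound)
    show "integrable lborel (\<lambda>y. kern (x - y) * (2 * M powr p))" using kern_shift(1) by simp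
    show "AE y in lborel. norm (indicator ?H y * (ckern e l x y * (U (hrefl e l y) powr p - U y powr p))) \<le> norm (kern (x - y) * (2 * M powr p))"
      using AE_neq[of x]
    proof eventually_elim
      fix y assume y: "y \<noteq> x"
      show "norm (indicator ?H y * (ckern e l x y * (U (hrefl e l y) powr p - U y powr p))) \<le> norm (kern (x - y) * (2 * M powr p))"
      proof (cases "y \<in> ?H")
        case True
        have "\<bar>U (hrefl e l y) powr p - U y powr p\<bar> \<le> 2 * M powr p"
          using Up_bound[of y] Up_bound[of "hrefl e l y"] by linarith
        then have "\<bar>ckern e l x y\<bar> * \<bar>U (hrefl e l y) powr p - U y powr p\<bar> \<le> kern (x - y) * (2 * M powr p)"
          using ckern_bounds[OF e l x _ y] True kern_nonneg by (intro mult_mono) auto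
        then show ?thesis using True kern_nonneg by (simp add: abs_mult)
      qed simp
    qed
  qed (measurable; simp)
  have s1: "V (hrefl e l x) - V x = (LINT y|lborel.
      indicator ?H y * (gker (hrefl e l x) y * U y powr p + gker (hrefl e l x) (hrefl e l y) * U (hrefl e l y) powr p)
      - indicator ?H y * (gker x y * U y powr p + gker x (hrefl e l y) * U (hrefl e l y) powr p))"
    using V_hrefl_split[OF e, where l = l and x = x] V_hrefl_split[OF e, where l = l and x = "hrefl e l x"] by simp
  show "(LINT y|lborel. indicator ?H y * (ckern e l x y * (U (hrefl e l y) powr p - U y powr p))) \<le> V (hrefl e l x) - V x"
    unfolding s1
  proof (rule integral_mono_AE[OF i])
    show "integrable lborel (\<lambda>y. indicator ?H y * (gker (hrefl e l x) y * U y powr p + gker (hrefl e l x) (hrefl e l y) * U (hrefl e l y) powr p)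
      - indicator ?H y * (gker x y * U y powr p + gker x (hrefl e l y) * U (hrefl e l y) powr p))"
      by (intro Bochner_Integration.integrable_diff V_hrefl_split e)
    show "AE y in lborel. indicator ?H y * (ckern e l x y * (U (hrefl e l y) powr p - U y powr p))
      \<le> indicator ?H y * (gker (hrefl e l x) y * U y powr p + gker (hrefl e l x) (hrefl e l y) * U (hrefl e l y) powr p)
      - indicator ?H y * (gker x y * U y powr p + gker x (hrefl e l y) * U (hrefl e l y) powr p)"
      using AE_neq[of x]
    proof eventually_elim
      fix y assume y: "y \<noteq> x"
      show "indicator ?H y * (ckern e l x y * (U (hrefl e l y) powr p - U y powr p))
      \<le> indicator ?H y * (gker (hrefl e l x) y * U y powr p + gker (hrefl e l x) (hrefl e l y) * U (hrefl e l y) powr p)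
      - indicator ?H y * (gker x y * U y powr p + gker x (hrefl e l y) * U (hrefl e l y) powr p)"
      proof (cases "y \<in> ?H")
        case H: True
        have "0 \<le> (gker (hrefl e l x) y - gker x y + ckern e l x y) * U y powr p"
        proof (cases "y \<in> ball 0 R")
          case True
          then show ?thesis
            using gker_hrefl_four[OF e l x True _ y[symmetric]] H
            by (intro mult_nonneg_nonneg) (auto simp: ckern_def)
        qed (use U_out[of y] p in simp)
        then show ?thesis using H by (simp add: ckern_def algebra_simps)
      qed simp
    qed
  qed
qed

text \<open>Only points where \<open>U\<close> exceeds its mirror value can make \<open>V x\<close>
  the larger one; there the power is Lipschitz with constant \<open>p * M powr (p - 1)\<close>, and
  \<open>ckern\<close> is at most \<open>kern\<close>.\<close>

lemma V_hrefl_upper: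
  assumes e: "norm e = 1" and l: "0 \<le> l" and x: "x \<in> ball 0 R" "l < x \<bullet> e"
  shows "V x - V (hrefl e l x) \<le> p * M powr (p - 1) *
    (LINT y|lborel. kern (x - y) * (indicator {y. l < y \<bullet> e} y * max 0 (U y - U (hrefl e l y))))"
proof -
  let ?H = "{y. l < y \<bullet> e}"
  have om [measurable]: "?H \<in> sets borel" by (intro borel_open open_Collect_less continuous_intros)
  define f where "f y = indicator ?H y * (ckern e l x y * (U (hrefl e l y) powr p - U y powr p))" for y
  define h where "h y = kern (x - y) * (indicator ?H y * max 0 (U y - U (hrefl e l y)))" for y
  note d = V_hrefl_diff[OF assms, folded f_def]
  have hi: "integrable lborel h"
  proof (rule Bochner_Integration.integrable_bound)
    show "integrable lborel (\<lambda>y. kern (x - y) * M)" using kern_shift(1) by simp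
    show "AE y in lborel. norm (h y) \<le> norm (kern (x - y) * M)"
    proof (intro AE_I2)
      fix y
      have "\<bar>indicator ?H y * max 0 (U y - U (hrefl e l y))\<bar> \<le> M"
        using U_le[of y] U_nonneg[of y] U_nonneg[of "hrefl e l y"] by (auto simp: indicator_def)
      then have "kern (x - y) * \<bar>indicator ?H y * max 0 (U y - U (hrefl e l y))\<bar> \<le> kern (x - y) * M"
        using kern_nonneg by (intro mult_left_mono)
      then show "norm (h y) \<le> norm (kern (x - y) * M)"
        using kern_nonneg[of "x - y"] M_pos by (simp add: h_def abs_mult)
    qed
    show "h \<in> borel_measurable lborel" unfolding h_def[abs_def] by measurable
  qed
  have "V x - V (hrefl e l x) \<le> - (LINT y|lborel. f y)" using d(2) by linarith
  also have "\<dots> = (LINT y|lborel. - f y)" by simp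
  also have "\<dots> \<le> (LINT y|lborel. p * M powr (p - 1) * h y)"
  proof (rule integral_mono_AE)
    show "AE y in lborel. - f y \<le> p * M powr (p - 1) * h y"
      using AE_neq[of x]
    proof eventually_elim
      fix y assume y: "y \<noteq> x"
      show "- f y \<le> p * M powr (p - 1) * h y"
      proof (cases "y \<in> ?H")
        case True
        have c: "0 \<le> ckern e l x y" "ckern e l x y \<le> kern (x - y)"
          using ckern_bounds[OF e l x _ y] True by auto
        have b: "U y powr p - U (hrefl e l y) powr p \<le> p * M powr (p - 1) * max 0 (U y - U (hrefl e l y))"
        proof (cases "U (hrefl e l y) \<le> U y")
          case True
          then show ?thesis
            using powr_diff_abs_le[of p "U y" "U (hrefl e l y)" M] p U_nonneg U_le by (simp add: abs_le_iff)
        next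
          case False
          then have "U y powr p \<le> U (hrefl e l y) powr p" using p U_nonneg by (intro powr_mono2) auto
          then show ?thesis using False by simp
        qed
        have "- f y = ckern e l x y * (U y powr p - U (hrefl e l y) powr p)"
          using True by (simp add: f_def algebra_simps)
        also have "\<dots> \<le> ckern e l x y * (p * M powr (p - 1) * max 0 (U y - U (hrefl e l y)))"
          by (rule mult_left_mono[OF b c(1)])
        also have "\<dots> \<le> kern (x - y) * (p * M powr (p - 1) * max 0 (U y - U (hrefl e l y)))"
          using p by (intro mult_right_mono c) auto
        finally show ?thesis using True by (simp add: h_def ac_simps)
      qed (simp add: f_def h_def)
    qed
  qed (use d(1) hi in auto)
  also have "\<dots> = p * M powr (p - 1) * (LINT y|lborel. h y)" using hi by simp
  finally show ?thesis unfolding h_def .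
qed

text \<open>The gain comes from the open set \<open>Q\<close> of points beyond the plane and outside
  the closed ball whose mirror image is inside: there \<open>U\<close> is 0, its mirror value is
  positive, and the lower bound for the kernel does not depend on \<open>x\<close>.\<close>

lemma V_hrefl_strict:
  assumes e: "norm e = 1" and l: "0 < l" and \<eta>: "\<eta> > 0"
    and le: "\<And>y. l < y \<bullet> e \<Longrightarrow> U y \<le> U (hrefl e l y)"
  obtains m where "m > 0" "\<And>x. x \<in> ball 0 R \<Longrightarrow> l + \<eta> \<le> x \<bullet> e \<Longrightarrow> m \<le> V (hrefl e l x) - V x"
proof -
  let ?H = "{y. l < y \<bullet> e}"
  define Q where "Q = {y. l < y \<bullet> e} \<inter> {y. R < norm y} \<inter> {y. norm (hrefl e l y) < R}"
  have oQ: "open Q" unfolding Q_def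
    by (intro open_Int open_Collect_less continuous_intros continuous_hrefl)
  then have [measurable]: "Q \<in> sets borel" by simp
  have om [measurable]: "?H \<in> sets borel" by (intro borel_open open_Collect_less continuous_intros)
  \<comment> \<open>The point \<open>(2 * l + r) *\<^sub>R e\<close> has the mirror image
    \<open>(- r) *\<^sub>R e\<close>; since \<open>r < R < 2 * l + r\<close>, it lies in
    \<open>Q\<close>.\<close>
  define r where "r = R - min l (R / 2)"
  have r: "0 < r" "r < R" "R < 2 * l + r" using R l by (auto simp: r_def min_def)
  have "(2 * l + r) *\<^sub>R e \<in> Q"
  proof -
    have "hrefl e l ((2 * l + r) *\<^sub>R e) = (- r) *\<^sub>R e"
      using e by (simp add: hrefl_def dot_square_norm algebra_simps flip: scaleR_add_left scaleR_diff_left)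
    then show ?thesis using e l r by (simp add: Q_def dot_square_norm)
  qed
  then have Qne: "Q \<noteq> {}" by auto
  define c where "c y = (5 * R\<^sup>2) powr (- kap) - (5 * R\<^sup>2 + 4 * l * \<eta> * bdist R (hrefl e l y) / R\<^sup>2) powr (- kap)" for y
  define f where "f y = indicator Q y * (c y * U (hrefl e l y) powr p)" for y
  define m where "m = (LINT y|lborel. f y)"
  have cpos: "c y > 0" if "y \<in> Q" for y
  proof -
    have b: "bdist R (hrefl e l y) > 0" using that by (intro bdist_pos) (auto simp: Q_def)
    have "(5 * R\<^sup>2 + 4 * l * \<eta> * bdist R (hrefl e l y) / R\<^sup>2) powr (- kap) < (5 * R\<^sup>2) powr (- kap)"
      using kap_pos R l \<eta> b by (intro powr_less_mono2_neg) auto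
    then show ?thesis by (simp add: c_def)
  qed
  have fpos: "f y > 0" if "y \<in> Q" for y
    using cpos[OF that] U_pos[of "hrefl e l y"] that by (auto simp: f_def Q_def)
  have f0: "f y \<ge> 0" for y using fpos[of y] by (cases "y \<in> Q") (auto simp: f_def)
  have fm [measurable]: "f \<in> borel_measurable borel"
    unfolding f_def[abs_def] c_def bdist_def by (intro borel_measurable_times borel_measurable_diff powr_real_measurable) (measurable; simp)+
  have key: "AE y in lborel. f y \<le> indicator ?H y * (ckern e l x y * (U (hrefl e l y) powr p - U y powr p))"
    if x: "x \<in> ball 0 R" "l + \<eta> \<le> x \<bullet> e" for x
    using AE_neq[of x]
  proof eventually_elim
    fix y assume y: "y \<noteq> x"
    have xl: "l < x \<bullet> e" using x \<eta> by simp
    show "f y \<le> indicator ?H y * (ckern e l x y * (U (hrefl e l y) powr p - U y powr p))"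
    proof (cases "y \<in> Q")
      case True
      have n: "hrefl e l y \<noteq> hrefl e l x" using e y by (metis hrefl_hrefl)
      have "c y \<le> ckern e l x y"
        unfolding c_def ckern_def
        using True x \<eta> by (intro gker_hrefl_lower[OF e less_imp_le[OF l] x(1) xl _ _ n]) (auto simp: Q_def hrefl_inner[OF e])
      then have "c y * U (hrefl e l y) powr p \<le> ckern e l x y * U (hrefl e l y) powr p"
        by (rule mult_right_mono) simp
      moreover have "U y = 0" using True by (intro U_out) (auto simp: Q_def)
      ultimately show ?thesis using True p by (simp add: f_def Q_def)
    next
      case False
      have "0 \<le> indicator ?H y * (ckern e l x y * (U (hrefl e l y) powr p - U y powr p))"
      proof (cases "y \<in> ?H")
        case True
        have "U y powr p \<le> U (hrefl e l y) powr p"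
          using le[of y] True p U_nonneg by (intro powr_mono2) auto
        then show ?thesis using True ckern_bounds(1)[OF e less_imp_le[OF l] x(1) xl _ y] by simp
      qed simp
      then show ?thesis using False by (simp add: f_def)
    qed
  qed
  show thesis
  proof (cases "integrable lborel f")
    case fi: True
    have "m > 0"
    proof (rule ccontr)
      assume "\<not> m > 0"
      moreover have "m \<ge> 0" unfolding m_def using f0 by (intro integral_nonneg_AE) auto
      ultimately have "(LINT y|lborel. f y) = 0" by (simp add: m_def)
      then have "AE y in lborel. f y = 0" using integral_nonneg_eq_0_iff_AE[OF fi] f0 by simp
      then have "AE y in lborel. y \<notin> Q" by eventually_elim (use fpos in force)
      then have "Q \<in> null_sets lborel" using AE_iff_null_sets[of Q lborel] by simp
      then have "negligible Q" by (simp add: negligible_iff_null_sets null_sets_completionI)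
      then show False using open_not_negligible[OF oQ Qne] by simp
    qed
    moreover have "m \<le> V (hrefl e l x) - V x" if x: "x \<in> ball 0 R" "l + \<eta> \<le> x \<bullet> e" for x
    proof -
      have xl: "l < x \<bullet> e" using x \<eta> by simp
      note d = V_hrefl_diff[OF e less_imp_le[OF l] x(1) xl]
      have "m \<le> (LINT y|lborel. indicator ?H y * (ckern e l x y * (U (hrefl e l y) powr p - U y powr p)))"
        unfolding m_def by (rule integral_mono_AE[OF fi d(1) key[OF x]])
      then show ?thesis using d(2) by linarith
    qed
    ultimately show thesis by (rule that)
  next
    case False
    \<comment> \<open>Any such \<open>x\<close> in the ball would dominate \<open>f\<close> by an
      integrable function. If \<open>f\<close> is not integrable, the claim is therefore vacuous and
      every positive \<open>m\<close> serves.\<close>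
    have "x \<notin> ball 0 R" if x: "l + \<eta> \<le> x \<bullet> e" for x
    proof
      assume b: "x \<in> ball 0 R"
      have xl: "l < x \<bullet> e" using x \<eta> by simp
      have "integrable lborel f"
      proof (rule Bochner_Integration.integrable_bound[OF V_hrefl_diff(1)[OF e less_imp_le[OF l] b xl]])
        show "AE y in lborel. norm (f y) \<le> norm (indicator ?H y * (ckern e l x y * (U (hrefl e l y) powr p - U y powr p)))"
          using key[OF b x] by eventually_elim (use f0 in auto)
      qed simp
      then show False using False by simp
    qed
    then show thesis using that[of 1] by auto
  qed
qed

end

section \<open>Barriers\<close>

text \<open>The set where the inequality fails is open and null, hence empty.\<close>

lemma AE_continuous_le_0:
  fixes f :: "'a::euclidean_space \<Rightarrow> real"
  assumes S: "open S" and c: "continuous_on S f" and ae: "AE x in lborel. x \<in> S \<longrightarrow> f x \<le> 0" and x: "x \<in> S"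
  shows "f x \<le> 0"
proof (rule ccontr)
  assume "\<not> f x \<le> 0"
  define Q where "Q = {x \<in> S. f x \<in> {0<..}}"
  have o: "open Q" using continuous_open_preimage[OF c S open_greaterThan[of 0]]
    by (simp add: Q_def vimage_def Int_def conj_commute)
  then have [measurable]: "Q \<in> sets borel" by simp
  have "AE x in lborel. x \<notin> Q" using ae by eventually_elim (auto simp: Q_def)
  then have "Q \<in> null_sets lborel" using AE_iff_null_sets[of Q lborel] by simp
  then have "negligible Q" by (simp add: negligible_iff_null_sets null_sets_completionI)
  moreover have "x \<in> Q" using x \<open>\<not> f x \<le> 0\<close> by (simp add: Q_def)
  ultimately show False using open_not_negligible[OF o] by auto
qed

text \<open>The field \<open>F\<close> need not decay; restricted to the ball, which carries
  \<open>\<psi>\<close> and \<open>E\<close>, it is square integrable, and the identity passes to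
  the limit from the approximants.\<close>

lemma H10_divergence:
  fixes \<psi> :: "real^'n::idx \<Rightarrow> real" and F :: "real^'n::idx \<Rightarrow> real^'n::idx"
  assumes H: "H10_grad R \<psi> E"
    and F: "\<And>b x. b \<in> Basis \<Longrightarrow> ((\<lambda>x. F x \<bullet> b) has_derivative (\<lambda>h. DF b x \<bullet> h)) (at x)"
    and cF: "continuous_on UNIV F" and DF: "\<And>b. b \<in> Basis \<Longrightarrow> continuous_on UNIV (DF b)"
  shows "(LINT x|lborel. F x \<bullet> E x) = - (LINT x|lborel. (\<Sum>b\<in>Basis. DF b x \<bullet> b) * \<psi> x)"
proof -
  obtain \<phi> D where C: "\<And>k::nat. C1c_ball R (\<phi> k) (D k)"
    and l: "(\<lambda>k. l2sq (\<lambda>x. \<phi> k x - \<psi> x)) \<longlonglongrightarrow> 0" "(\<lambda>k. l2sq (\<lambda>x. D k x - E x)) \<longlonglongrightarrow> 0"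
    and ae: "AE x in lborel. (\<lambda>k. \<phi> k x) \<longlonglongrightarrow> \<psi> x" "AE x in lborel. (\<lambda>k. D k x) \<longlonglongrightarrow> E x"
    by (rule H10_gradE[OF H]) blast
  define dv where "dv x = (\<Sum>b\<in>Basis. DF b x \<bullet> b)" for x
  have cdv: "continuous_on UNIV dv" unfolding dv_def[abs_def] by (intro continuous_intros DF)
  have [measurable]: "\<psi> \<in> borel_measurable borel" "E \<in> borel_measurable borel" "F \<in> borel_measurable borel" "dv \<in> borel_measurable borel"
      "\<phi> k \<in> borel_measurable borel" "D k \<in> borel_measurable borel" for k
    using C1c_ballD[OF C] H10_grad_measurable[OF H] cF cdv by (auto intro: borel_measurable_continuous_onI)
  let ?I = "\<lambda>x. indicator (ball (0::real^'n::idx) R) x :: real"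
  obtain B1 where B1: "\<And>x. x \<in> cball 0 R \<Longrightarrow> norm (F x) \<le> B1"
    using continuous_bounded_ball[OF continuous_on_subset[OF cF subset_UNIV]] by metis
  obtain B2 where B2: "\<And>x. x \<in> cball 0 R \<Longrightarrow> norm (dv x) \<le> B2"
    using continuous_bounded_ball[OF continuous_on_subset[OF cdv subset_UNIV]] by metis
  have f1: "l2sq (\<lambda>x. ?I x *\<^sub>R F x) < \<infinity>" using B1 by (intro l2sq_indicator_bounded[where B = B1]) auto
  have f2: "l2sq (\<lambda>x. ?I x *\<^sub>R dv x) < \<infinity>" using B2 by (intro l2sq_indicator_bounded[where B = B2]) auto
  note fin = H10_grad_l2[OF H]
  have L1: "(\<lambda>k. LINT x|lborel. D k x \<bullet> (?I x *\<^sub>R F x)) \<longlonglongrightarrow> (LINT x|lborel. E x \<bullet> (?I x *\<^sub>R F x))"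
    by (intro l2_inner_tendsto fin f1 l) measurable
  have L2: "(\<lambda>k. LINT x|lborel. \<phi> k x \<bullet> (?I x *\<^sub>R dv x)) \<longlonglongrightarrow> (LINT x|lborel. \<psi> x \<bullet> (?I x *\<^sub>R dv x))"
    by (intro l2_inner_tendsto fin f2 l) measurable
  have eq: "(LINT x|lborel. D k x \<bullet> (?I x *\<^sub>R F x)) = - (LINT x|lborel. \<phi> k x \<bullet> (?I x *\<^sub>R dv x))" for k
  proof -
    note ibp = C1c_integration_by_parts[OF C[of k] F DF]
    have "(LINT x|lborel. D k x \<bullet> (?I x *\<^sub>R F x)) = (LINT x|lborel. (\<Sum>b\<in>Basis. (F x \<bullet> b) * (D k x \<bullet> b)))"
      using C1c_ballD(7)[OF C[of k]]
      by (intro Bochner_Integration.integral_cong refl) (auto simp: indicator_def inner_commute euclidean_inner[of "F _" "D k _"])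
    also have "\<dots> = (\<Sum>b\<in>Basis. LINT x|lborel. (F x \<bullet> b) * (D k x \<bullet> b))"
      by (rule Bochner_Integration.integral_sum) (rule ibp)
    also have "\<dots> = (\<Sum>b\<in>Basis. - (LINT x|lborel. \<phi> k x * (DF b x \<bullet> b)))"
      by (intro sum.cong refl ibp)
    also have "\<dots> = - (LINT x|lborel. (\<Sum>b\<in>Basis. \<phi> k x * (DF b x \<bullet> b)))"
      by (subst Bochner_Integration.integral_sum) (auto intro: ibp simp: sum_negf)
    also have "(LINT x|lborel. (\<Sum>b\<in>Basis. \<phi> k x * (DF b x \<bullet> b))) = (LINT x|lborel. \<phi> k x \<bullet> (?I x *\<^sub>R dv x))"
      using C1c_ballD(6)[OF C[of k]]
      by (intro Bochner_Integration.integral_cong refl) (auto simp: indicator_def dv_def sum_distrib_left)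
    finally show ?thesis .
  qed
  have "(LINT x|lborel. E x \<bullet> (?I x *\<^sub>R F x)) = - (LINT x|lborel. \<psi> x \<bullet> (?I x *\<^sub>R dv x))"
    by (rule LIMSEQ_unique[OF L1[unfolded eq] tendsto_minus[OF L2]])
  moreover have "(LINT x|lborel. F x \<bullet> E x) = (LINT x|lborel. E x \<bullet> (?I x *\<^sub>R F x))"
  proof (rule integral_cong_AE)
    show "AE x in lborel. F x \<bullet> E x = E x \<bullet> (?I x *\<^sub>R F x)"
      using H10_grad_outside[OF H] by eventually_elim (auto simp: indicator_def inner_commute)
  qed measurable
  moreover have "(LINT x|lborel. dv x * \<psi> x) = (LINT x|lborel. \<psi> x \<bullet> (?I x *\<^sub>R dv x))"
  proof (rule integral_cong_AE)
    show "AE x in lborel. dv x * \<psi> x = \<psi> x \<bullet> (?I x *\<^sub>R dv x)"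
      using H10_grad_outside[OF H] by eventually_elim (auto simp: indicator_def)
  qed measurable
  ultimately show ?thesis by (simp add: dv_def)
qed

lemma has_derivative_norm_sq:
  "((\<lambda>x. (norm (x - c))\<^sup>2) has_derivative (\<lambda>h. (2 *\<^sub>R (x - c)) \<bullet> h)) (at (x::'a::real_inner))"
  unfolding power2_norm_eq_inner
  by (auto intro!: derivative_eq_intros simp: inner_commute)

lemma radial_gradient:
  fixes c :: "'a::real_inner"
  assumes "\<And>t. (\<eta> has_real_derivative \<eta>' t) (at t)"
  shows "((\<lambda>x. \<eta> ((norm (x - c))\<^sup>2)) has_derivative (\<lambda>h. ((2 * \<eta>' ((norm (x - c))\<^sup>2)) *\<^sub>R (x - c)) \<bullet> h)) (at x)"
  using has_derivative_compose[OF has_derivative_norm_sq[of c x] assms[unfolded has_field_derivative_def]]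
  by (simp add: ac_simps)

text \<open>If \<open>\<eta>\<close> is a primitive of \<open>\<eta>'\<close>, the field on the left
  is the gradient of \<open>\<eta> ((norm (x - c))^2)\<close> and the bracket on the right its
  Laplacian.\<close>

lemma H10_radial_laplacian:
  fixes \<psi> :: "real^'n::idx \<Rightarrow> real" and c :: "real^'n::idx"
  assumes H: "H10_grad R \<psi> E"
    and \<eta>: "\<And>t. (\<eta>' has_real_derivative \<eta>'' t) (at t)" "continuous_on UNIV \<eta>''"
  shows "(LINT x|lborel. ((2 * \<eta>' ((norm (x - c))\<^sup>2)) *\<^sub>R (x - c)) \<bullet> E x)
     = - (LINT x|lborel. (2 * real CARD('n) * \<eta>' ((norm (x - c))\<^sup>2) + 4 * \<eta>'' ((norm (x - c))\<^sup>2) * (norm (x - c))\<^sup>2) * \<psi> x)"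
proof -
  define T where "T x = (norm (x - c))\<^sup>2" for x
  define F where "F x = (2 * \<eta>' (T x)) *\<^sub>R (x - c)" for x
  define DF where "DF b x = (2 * \<eta>' (T x)) *\<^sub>R b + (4 * \<eta>'' (T x) * ((x - c) \<bullet> b)) *\<^sub>R (x - c)" for b x
  have c\<eta>: "continuous_on UNIV \<eta>'" using \<eta>(1) by (meson DERIV_isCont continuous_at_imp_continuous_on)
  have cT: "continuous_on UNIV T" unfolding T_def[abs_def] by (intro continuous_intros)
  have cF: "continuous_on UNIV F" unfolding F_def[abs_def]
    by (intro continuous_intros continuous_on_compose2[OF c\<eta> cT]) auto
  have cDF: "continuous_on UNIV (DF b)" for b unfolding DF_def[abs_def]
    by (intro continuous_intros continuous_on_compose2[OF c\<eta> cT] continuous_on_compose2[OF \<eta>(2) cT]) auto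
  have dF: "((\<lambda>x. F x \<bullet> b) has_derivative (\<lambda>h. DF b x \<bullet> h)) (at x)" for b x
  proof -
    have 1: "((\<lambda>x. \<eta>' (T x)) has_derivative (\<lambda>h. ((2 * \<eta>'' (T x)) *\<^sub>R (x - c)) \<bullet> h)) (at x)"
      unfolding T_def by (rule radial_gradient[OF \<eta>(1)])
    have 2: "((\<lambda>x. (x - c) \<bullet> b) has_derivative (\<lambda>h. h \<bullet> b)) (at x)"
      by (auto intro!: derivative_eq_intros)
    from has_derivative_mult[OF has_derivative_mult_right[OF 1, of 2] 2]
    have "((\<lambda>x. (2 * \<eta>' (T x)) * ((x - c) \<bullet> b)) has_derivative (\<lambda>h. DF b x \<bullet> h)) (at x)"
      by (rule has_derivative_eq_rhs) (auto simp: DF_def fun_eq_iff inner_add_left inner_commute algebra_simps)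
    then show ?thesis by (simp add: F_def)
  qed
  have "(\<Sum>b\<in>Basis. DF b x \<bullet> b) = 2 * real CARD('n) * \<eta>' (T x) + 4 * \<eta>'' (T x) * (norm (x - c))\<^sup>2" for x
  proof -
    have "(\<Sum>b\<in>Basis. DF b x \<bullet> b) = (\<Sum>b\<in>(Basis :: (real^'n::idx) set). 2 * \<eta>' (T x) + 4 * \<eta>'' (T x) * (((x - c) \<bullet> b) * ((x - c) \<bullet> b)))"
      by (intro sum.cong refl) (auto simp: DF_def inner_add_left inner_same_Basis)
    also have "\<dots> = real DIM(real^'n::idx) * (2 * \<eta>' (T x)) + 4 * \<eta>'' (T x) * ((x - c) \<bullet> (x - c))"
      by (simp only: sum.distrib sum_constant sum_distrib_left[symmetric] euclidean_inner[of "x - c" "x - c"])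
    also have "\<dots> = 2 * real CARD('n) * \<eta>' (T x) + 4 * \<eta>'' (T x) * (norm (x - c))\<^sup>2"
      by (simp add: power2_norm_eq_inner)
    finally show ?thesis .
  qed
  with H10_divergence[OF H dF cF cDF] show ?thesis
    unfolding F_def T_def by simp
qed

text \<open>Between \<open>K\<close> and the sphere \<open>w\<close> is nonpositive and the
  composition vanishes, so cutting off at the sphere creates no singularity.\<close>

lemma C1c_ball_cutoff:
  fixes w :: "real^'n::idx \<Rightarrow> real"
  assumes dw: "\<And>x. (w has_derivative (\<lambda>v. G x \<bullet> v)) (at x)" and cG: "continuous_on UNIV G"
    and \<beta>: "test_shape \<beta> \<beta>' L" and K: "compact K" "K \<subseteq> ball 0 R" and w: "\<And>x. x \<in> ball 0 R \<Longrightarrow> x \<notin> K \<Longrightarrow> w x \<le> 0"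
  shows "C1c_ball R (\<lambda>x. if x \<in> ball 0 R then \<beta> (w x) else 0) (\<lambda>x. if x \<in> ball 0 R then \<beta>' (w x) *\<^sub>R G x else 0)"
proof -
  note T = test_shapeD[OF \<beta>]
  define \<psi> where "\<psi> x = (if x \<in> ball 0 R then \<beta> (w x) else 0)" for x
  define D where "D x = (if x \<in> ball 0 R then \<beta>' (w x) *\<^sub>R G x else 0)" for x
  have oK: "open (- K)" using K(1) by (simp add: open_Compl compact_imp_closed)
  have z: "\<psi> x = 0" "D x = 0" if "x \<notin> K" for x
    using w[of x] that T(4,5)[of "w x"] by (auto simp: \<psi>_def D_def simp del: mem_ball)
  have cw: "continuous_on UNIV w" using dw by (meson has_derivative_continuous continuous_at_imp_continuous_on)
  have "(\<psi> has_derivative (\<lambda>h. D x \<bullet> h)) (at x)" for x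
  proof (cases "x \<in> K")
    case True
    then have x: "x \<in> ball 0 R" using K by auto
    have "((\<lambda>x. \<beta> (w x)) has_derivative (\<lambda>v. (\<beta>' (w x) *\<^sub>R G x) \<bullet> v)) (at x)"
      using has_derivative_compose[OF dw[of x] T(1)[of "w x", unfolded has_field_derivative_def]] by simp
    from has_derivative_transform_within_open[OF this open_ball x, of \<psi>] show ?thesis
      using x by (simp add: \<psi>_def D_def)
  next
    case False
    have "((\<lambda>x. 0) has_derivative (\<lambda>v. 0)) (at x)" by simp
    from has_derivative_transform_within_open[OF this oK, of \<psi>] z False show ?thesis by simp
  qed
  moreover have "continuous_on UNIV D"
  proof -
    have "continuous_on (ball 0 R) (\<lambda>x. \<beta>' (w x) *\<^sub>R G x)"
      by (rule continuous_on_subset[OF _ subset_UNIV]) (intro continuous_intros continuous_on_compose2[OF T(3) cw] cG, auto)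
    then have 1: "continuous_on (ball 0 R) D" by (rule continuous_on_eq) (simp add: D_def)
    have 2: "continuous_on (- K) D" by (rule continuous_on_eq[OF continuous_on_const[of _ 0]]) (simp add: z)
    have "ball 0 R \<union> - K = UNIV" using K by auto
    then show ?thesis using continuous_on_open_Un[OF open_ball oK 1 2] by simp
  qed
  ultimately show ?thesis
    unfolding C1c_ball_def \<psi>_def[symmetric, abs_def] D_def[symmetric, abs_def] using K z by auto
qed

context positive_solution
begin

text \<open>Weak comparison on the ball, with the test function \<open>(h - \<epsilon> - U)\<^sup>+\<close> in smoothed form; the shift
  by \<open>\<epsilon>\<close> gives it compact support.\<close>
lemma radial_barrier:
  fixes \<eta> \<eta>' \<eta>'' :: "real \<Rightarrow> real"
  assumes \<eta>: "\<And>t. (\<eta> has_real_derivative \<eta>' t) (at t)" "\<And>t. (\<eta>' has_real_derivative \<eta>'' t) (at t)" "continuous_on UNIV \<eta>''"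
    and bd: "\<eta> (R\<^sup>2) = 0"
    and sub: "\<And>x. x \<in> ball 0 R \<Longrightarrow> - (2 * real CARD('n) * \<eta>' ((norm x)\<^sup>2) + 4 * \<eta>'' ((norm x)\<^sup>2) * (norm x)\<^sup>2) + \<eta> ((norm x)\<^sup>2)
        \<le> V x * U x powr (p - 1)"
    and x: "x \<in> ball 0 R"
  shows "\<eta> ((norm x)\<^sup>2) \<le> U x"
proof -
  let ?B = "ball (0::(real, 'n) vec) R"
  define h where "h x = \<eta> ((norm x)\<^sup>2)" for x :: "(real, 'n) vec"
  define Dh where "Dh x = (2 * \<eta>' ((norm x)\<^sup>2)) *\<^sub>R x" for x :: "(real, 'n) vec"
  define lap where "lap x = 2 * real CARD('n) * \<eta>' ((norm x)\<^sup>2) + 4 * \<eta>'' ((norm x)\<^sup>2) * (norm x)\<^sup>2" for x :: "(real, 'n) vec"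
  have dh: "(h has_derivative (\<lambda>v. Dh x \<bullet> v)) (at x)" for x
    using radial_gradient[OF \<eta>(1), of 0 x] by (simp add: h_def[abs_def] Dh_def)
  have ch: "continuous_on UNIV h" using dh by (meson has_derivative_continuous continuous_at_imp_continuous_on)
  have c\<eta>: "continuous_on UNIV \<eta>'" using \<eta>(2) by (meson DERIV_isCont continuous_at_imp_continuous_on)
  have cDh: "continuous_on UNIV Dh" unfolding Dh_def[abs_def]
    by (intro continuous_intros continuous_on_compose2[OF c\<eta>]) auto
  have clap: "continuous_on UNIV lap" unfolding lap_def[abs_def]
    by (intro continuous_intros continuous_on_compose2[OF c\<eta>] continuous_on_compose2[OF \<eta>(3)]) auto
  obtain Bh where Bh: "Bh > 0" "\<And>x. x \<in> cball 0 R \<Longrightarrow> norm (h x) \<le> Bh"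
    using continuous_bounded_ball[OF continuous_on_subset[OF ch subset_UNIV]] by metis
  have main: "h x \<le> U x + \<epsilon>" if \<epsilon>: "\<epsilon> > 0" and x: "x \<in> ?B" for \<epsilon> x
  proof -
    obtain a A where C: "\<And>k::nat. C1c_ball R (a k) (A k)" and a0: "\<And>k x. 0 \<le> a k x"
      and la: "(\<lambda>k. l2sq (\<lambda>x. a k x - U x)) \<longlonglongrightarrow> 0" "(\<lambda>k. l2sq (\<lambda>x. A k x - g x)) \<longlonglongrightarrow> 0"
      and ae: "AE x in lborel. (\<lambda>k. a k x) \<longlonglongrightarrow> U x"
      by (rule H10_grad_nonneg_seq[OF U_H10 U_pos]) blast+
    define \<beta> where "\<beta> = sq_trunc 1"
    define \<beta>' where "\<beta>' = sq_trunc' 1"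
    have \<beta>: "test_shape \<beta> \<beta>' (2 * 1)" unfolding \<beta>_def \<beta>'_def by (rule test_shape_sq_trunc) simp
    note T = test_shapeD[OF \<beta>]
    have \<beta>pos: "\<beta> t > 0" if "t > 0" for t
    proof (cases "t \<le> 1")
      case True then show ?thesis using that by (simp add: \<beta>_def sq_trunc_def)
    next
      case False
      then have "\<beta> t = 2 * t - 1" by (simp add: \<beta>_def sq_trunc_def power2_eq_square algebra_simps)
      then show ?thesis using False by simp
    qed
    define w where "w x = h x - \<epsilon> - U x" for x
    define gw where "gw x = Dh x - g x" for x
    define W where "W k x = h x - \<epsilon> - a k x" for k x
    define G where "G k x = Dh x - A k x" for k x
    define \<psi> where "\<psi> x = (if x \<in> ?B then \<beta> (w x) else 0)" for x
    define D where "D x = (if x \<in> ?B then \<beta>' (w x) *\<^sub>R gw x else 0)" for x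
    have [measurable]: "h \<in> borel_measurable borel" "Dh \<in> borel_measurable borel" "lap \<in> borel_measurable borel"
        "a k \<in> borel_measurable borel" "A k \<in> borel_measurable borel" "\<beta> \<in> borel_measurable borel" "\<beta>' \<in> borel_measurable borel" for k
      using ch cDh clap C1c_ballD[OF C] T(2,3) by (auto intro: borel_measurable_continuous_onI)
    have mw [measurable]: "W k \<in> borel_measurable borel" "G k \<in> borel_measurable borel" "w \<in> borel_measurable borel" "gw \<in> borel_measurable borel" for k
      unfolding W_def[abs_def] G_def[abs_def] w_def[abs_def] gw_def[abs_def] by measurable
    have mB: "?B \<in> sets borel" by simp
    have m\<psi> [measurable]: "\<psi> \<in> borel_measurable borel" "D \<in> borel_measurable borel"
      unfolding \<psi>_def[abs_def] D_def[abs_def] by (measurable; simp)+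
    have lW: "(\<lambda>k. l2sq (\<lambda>x. indicator ?B x *\<^sub>R (W k x - w x))) \<longlonglongrightarrow> 0"
      by (rule l2sq_tendsto_le[OF _ _ _ la(1), of 1]) (auto simp: indicator_def W_def w_def)
    have lG: "(\<lambda>k. l2sq (\<lambda>x. indicator ?B x *\<^sub>R (G k x - gw x))) \<longlonglongrightarrow> 0"
      by (rule l2sq_tendsto_le[OF _ _ _ la(2), of 1]) (auto simp: indicator_def G_def gw_def norm_minus_commute)
    have aeW: "AE x in lborel. x \<in> ?B \<longrightarrow> (\<lambda>k. W k x) \<longlonglongrightarrow> w x"
      using ae by eventually_elim (auto simp: W_def w_def intro!: tendsto_intros)
    obtain BD where BD: "\<And>x. x \<in> cball 0 R \<Longrightarrow> norm (Dh x) \<le> BD"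
      using continuous_bounded_ball[OF continuous_on_subset[OF cDh subset_UNIV]] by metis
    have fDh: "l2sq (\<lambda>x. indicator ?B x *\<^sub>R Dh x) < \<infinity>"
      using BD by (intro l2sq_indicator_bounded[where B = BD]) auto
    have fg: "l2sq (\<lambda>x. indicator ?B x *\<^sub>R gw x) < \<infinity>"
    proof -
      have "l2sq (\<lambda>x. indicator ?B x *\<^sub>R Dh x + - (indicator ?B x *\<^sub>R g x)) < \<infinity>"
      proof (intro l2sq_finite_add fDh)
        show "l2sq (\<lambda>x. - (indicator ?B x *\<^sub>R g x)) < \<infinity>"
          by (rule l2sq_finite_le[OF g_meas _ _ H10_grad_l2(2)[OF U_H10], of 1]) (auto simp: indicator_def)
      qed (measurable; simp)+
      then show ?thesis by (simp add: gw_def scaleR_diff_right)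
    qed
    \<comment> \<open>Where \<open>h \<ge> \<epsilon>\<close> the sphere is avoided because
      \<open>\<eta> (R^2) = 0\<close>; elsewhere in the ball \<open>h x - \<epsilon> - a k x\<close>
      is negative because \<open>a k\<close> is nonnegative. Thus \<open>K\<close> contains the
      supports of all approximants.\<close>
    define K where "K = {x. norm x \<le> R} \<inter> {x. \<epsilon> \<le> h x}"
    have K: "compact K" unfolding K_def
      by (intro compact_Int_closed closed_Collect_le continuous_intros ch)
         (use compact_cball[of "0::(real, 'n) vec" R] in \<open>simp add: cball_def dist_norm\<close>)
    have KB: "K \<subseteq> ?B"
    proof
      fix y assume y: "y \<in> K"
      have "norm y \<noteq> R" using y bd \<epsilon> by (auto simp: K_def h_def)
      then show "y \<in> ?B" using y by (auto simp: K_def)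
    qed
    have CC: "C1c_ball R (\<lambda>x. if x \<in> ?B then \<beta> (W k x) else 0) (\<lambda>x. if x \<in> ?B then \<beta>' (W k x) *\<^sub>R G k x else 0)" for k
    proof (rule C1c_ball_cutoff[OF _ _ \<beta> K KB])
      show "(W k has_derivative (\<lambda>v. G k x \<bullet> v)) (at x)" for x
        unfolding W_def[abs_def]
        by (rule has_derivative_eq_rhs[OF has_derivative_diff[OF has_derivative_diff[OF dh has_derivative_const] C1c_ballD(1)[OF C]]])
           (auto simp: G_def inner_diff_left)
      show "continuous_on UNIV (G k)" unfolding G_def[abs_def] by (intro continuous_intros cDh C1c_ballD(2)[OF C])
      show "W k x \<le> 0" if "x \<in> ?B" "x \<notin> K" for x
        using that a0[of k x] by (auto simp: K_def W_def)
    qed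
    have lim: "(\<lambda>k. l2sq (\<lambda>x. (if x \<in> ?B then \<beta> (W k x) else 0) - \<psi> x)) \<longlonglongrightarrow> 0"
      "(\<lambda>k. l2sq (\<lambda>x. (if x \<in> ?B then \<beta>' (W k x) *\<^sub>R G k x else 0) - D x)) \<longlonglongrightarrow> 0"
      unfolding \<psi>_def D_def
      by (rule l2_comp_limit[OF mB mw(1) mw(3) mw(2) mw(4) T(8) T(7) T(2,3) lW lG aeW fg])+
    have H\<psi>: "H10_grad R \<psi> D" by (rule H10_gradI[OF m\<psi> CC lim])
    have \<psi>0: "0 \<le> \<psi> x" for x using T(9) by (simp add: \<psi>_def)
    have \<psi>b: "\<bar>\<psi> x\<bar> \<le> 2 * (Bh + \<epsilon>)" for x
    proof (cases "x \<in> ?B \<and> w x > 0")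
      case True
      then have "\<bar>\<beta> (w x) - \<beta> 0\<bar> \<le> 2 * 1 * \<bar>w x - 0\<bar>" by (intro T(8))
      moreover have "\<bar>w x\<bar> \<le> Bh + \<epsilon>" using True Bh(2)[of x] \<epsilon> U_nonneg[of x] by (auto simp: w_def)
      ultimately show ?thesis using True T(4)[of 0] by (simp add: \<psi>_def)
    next
      case False
      then have "\<psi> x = 0" using T(4)[of "w x"] by (auto simp: \<psi>_def simp del: mem_ball)
      then show ?thesis using Bh \<epsilon> by simp
    qed
    have out: "x \<notin> ?B \<Longrightarrow> \<psi> x = 0" for x by (simp add: \<psi>_def)
    note wk = weak[OF H\<psi> \<psi>b]
    have lp: "(LINT x|lborel. Dh x \<bullet> D x) = - (LINT x|lborel. lap x * \<psi> x)"
      using H10_radial_laplacian[OF H\<psi> \<eta>(2,3), of 0] by (simp add: Dh_def lap_def)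
    note D2 = H10_grad_l2(2)[OF H\<psi>]
    have i1: "integrable lborel (\<lambda>x. g x \<bullet> D x)"
      by (rule l2_inner_integrable[OF g_meas m\<psi>(2) H10_grad_l2(2)[OF U_H10] D2])
    have i2: "integrable lborel (\<lambda>x. Dh x \<bullet> D x)"
    proof -
      have "integrable lborel (\<lambda>x. (indicator ?B x *\<^sub>R Dh x) \<bullet> D x)"
        by (rule l2_inner_integrable[OF _ m\<psi>(2) fDh D2]) (measurable; simp)
      moreover have "(\<lambda>x. (indicator ?B x *\<^sub>R Dh x) \<bullet> D x) = (\<lambda>x. Dh x \<bullet> D x)"
        by (auto simp: fun_eq_iff indicator_def D_def)
      ultimately show ?thesis by simp
    qed
    have ibd: "integrable lborel (\<lambda>x. f x * \<psi> x)" if "f \<in> borel_measurable borel" "\<And>x. x \<in> ?B \<Longrightarrow> \<bar>f x\<bar> \<le> Bf" for f Bf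
    proof (rule integrable_bounded_ball[where B = "\<bar>Bf\<bar> * (2 * (Bh + \<epsilon>))"])
      show "\<bar>f x * \<psi> x\<bar> \<le> \<bar>Bf\<bar> * (2 * (Bh + \<epsilon>))" for x
      proof (cases "x \<in> ?B")
        case True
        then show ?thesis unfolding abs_mult using that(2)[of x] \<psi>b[of x] by (intro mult_mono) auto
      qed (use out Bh \<epsilon> in simp)
      show "(\<lambda>x. f x * \<psi> x) \<in> borel_measurable borel" using that(1) by measurable
    qed (use out in simp)
    obtain Bl where Bl: "\<And>x. x \<in> cball 0 R \<Longrightarrow> norm (lap x) \<le> Bl"
      using continuous_bounded_ball[OF continuous_on_subset[OF clap subset_UNIV]] by metis
    have il: "integrable lborel (\<lambda>x. lap x * \<psi> x)" using Bl by (intro ibd[where Bf = Bl]) auto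
    have iU: "integrable lborel (\<lambda>x. U x * \<psi> x)" using U_nonneg U_le by (intro ibd[where Bf = M]) auto
    have ih: "integrable lborel (\<lambda>x. h x * \<psi> x)" using Bh by (intro ibd[where Bf = Bh]) auto
    have iF: "integrable lborel (\<lambda>x. (V x * U x powr (p - 1)) * \<psi> x)"
    proof (rule ibd[where Bf = "(M powr p * kern_mass) * M powr (p - 1)"])
      show "(\<lambda>x. V x * U x powr (p - 1)) \<in> borel_measurable borel"
        by (intro borel_measurable_times powr_real_measurable) auto
      show "\<bar>V x * U x powr (p - 1)\<bar> \<le> (M powr p * kern_mass) * M powr (p - 1)" for x
        unfolding abs_mult using V_bound[of x] U_nonneg[of x] U_le[of x] p by (intro mult_mono) (auto intro!: powr_mono2)
    qed
    \<comment> \<open>The gradient term is \<open>\<beta>' (w x)\<close> times a square. With the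
      weak equation and the subsolution inequality it forces the integral of
      \<open>(h x - U x) * \<psi> x\<close> to be at most 0, while the first factor exceeds
      \<open>\<epsilon>\<close> wherever \<open>\<psi>\<close> is nonzero.\<close>
    have "0 \<le> (LINT x|lborel. (Dh x - g x) \<bullet> D x)"
    proof (rule integral_nonneg_AE, intro AE_I2)
      fix x show "0 \<le> (Dh x - g x) \<bullet> D x"
        using T(6)[of "w x"] by (simp add: D_def gw_def)
    qed
    also have "\<dots> = (LINT x|lborel. Dh x \<bullet> D x) - (LINT x|lborel. g x \<bullet> D x)"
      using i1 i2 by (simp add: inner_diff_left)
    also have "\<dots> = - (LINT x|lborel. lap x * \<psi> x) - ((LINT x|lborel. (V x * U x powr (p - 1)) * \<psi> x) - (LINT x|lborel. U x * \<psi> x))"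
      using wk lp by (simp add: V_def ac_simps)
    also have "\<dots> = (LINT x|lborel. U x * \<psi> x - (lap x * \<psi> x + (V x * U x powr (p - 1)) * \<psi> x))"
      using il iU iF by simp
    also have "\<dots> \<le> (LINT x|lborel. U x * \<psi> x - h x * \<psi> x)"
    proof (rule integral_mono)
      fix x
      show "U x * \<psi> x - (lap x * \<psi> x + (V x * U x powr (p - 1)) * \<psi> x) \<le> U x * \<psi> x - h x * \<psi> x"
      proof (cases "x \<in> ?B")
        case True
        have "h x \<le> lap x + V x * U x powr (p - 1)" using sub[OF True] by (simp add: lap_def h_def)
        from mult_right_mono[OF this \<psi>0[of x]] show ?thesis by (simp add: distrib_right)
      qed (simp add: out)
    qed (use il iU iF ih in auto)
    finally have nn: "0 \<le> (LINT x|lborel. U x * \<psi> x - h x * \<psi> x)" .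
    have np: "(h x - U x) * \<psi> x \<ge> 0" for x
    proof (cases "x \<in> ?B \<and> w x > 0")
      case True then show ?thesis using \<psi>0[of x] \<epsilon> by (auto simp: w_def)
    next
      case False
      then have "\<psi> x = 0" using T(4)[of "w x"] by (auto simp: \<psi>_def simp del: mem_ball)
      then show ?thesis by simp
    qed
    have i3: "integrable lborel (\<lambda>x. (h x - U x) * \<psi> x)" using ih iU by (simp add: left_diff_distrib)
    have "(LINT x|lborel. (h x - U x) * \<psi> x) = - (LINT x|lborel. U x * \<psi> x - h x * \<psi> x)"
      using ih iU by (simp add: left_diff_distrib)
    then have "(LINT x|lborel. (h x - U x) * \<psi> x) = 0"
      using nn integral_nonneg_AE[of "\<lambda>x. (h x - U x) * \<psi> x" lborel] np by simp
    then have "AE x in lborel. (h x - U x) * \<psi> x = 0"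
      using integral_nonneg_eq_0_iff_AE[OF i3] np by simp
    then have "AE x in lborel. x \<in> ?B \<longrightarrow> w x \<le> 0"
    proof eventually_elim
      fix x assume z: "(h x - U x) * \<psi> x = 0"
      show "x \<in> ?B \<longrightarrow> w x \<le> 0"
      proof (rule ccontr)
        assume c: "\<not> (x \<in> ?B \<longrightarrow> w x \<le> 0)"
        then have "\<psi> x > 0" using \<beta>pos[of "w x"] by (auto simp: \<psi>_def)
        moreover have "h x - U x > 0" using c \<epsilon> by (auto simp: w_def)
        ultimately show False using z by simp
      qed
    qed
    moreover have "continuous_on ?B w" unfolding w_def[abs_def]
      by (intro continuous_intros U_cont continuous_on_subset[OF ch]) auto
    ultimately have "w x \<le> 0" using x by (intro AE_continuous_le_0[OF open_ball]) auto
    then show ?thesis by (simp add: w_def)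
  qed
  show ?thesis
    using field_le_epsilon[of "h x" "U x"] main x by (simp add: h_def)
qed

end

section \<open>Boundary behaviour of the potential and of the solution\<close>

lemma powr_neg_diff_le:
  fixes a b m :: real
  assumes "0 < a" "a \<le> b" "m > 0"
  shows "a powr (- m) - b powr (- m) \<le> m * a powr (- m - 1) * (b - a)"
proof (cases "a < b")
  case True
  obtain z where z: "a < z" "z < b" "b powr (- m) - a powr (- m) = (b - a) * ((- m) * z powr (- m - 1))"
  proof (rule mvt[OF True])
    show "continuous_on {a..b} (\<lambda>x. x powr (- m))"
      using assms by (intro continuous_intros) auto
    show "((\<lambda>x. x powr (- m)) has_derivative (\<lambda>h. h * ((- m) * x powr (- m - 1)))) (at x)" if "a < x" "x < b" for x
      using that assms
      by (intro has_derivative_eq_rhs[OF has_real_derivative_powr[of x "- m", unfolded has_field_derivative_def]])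
         (auto simp: fun_eq_iff)
  qed
  have "z powr (- m - 1) \<le> a powr (- m - 1)" using z assms by (intro powr_mono2') auto
  then have "(b - a) * (m * z powr (- m - 1)) \<le> (b - a) * (m * a powr (- m - 1))"
    using assms by (intro mult_left_mono) auto
  then show ?thesis using z(3) by (simp add: ac_simps)
qed (use assms in auto)

context positive_solution
begin

text \<open>With \<open>b\<close> the root of \<open>a^2 + q\<close> the kernel is a difference of
  negative powers at \<open>a \<le> b\<close>, hence at most a multiple of \<open>b - a\<close>.
  From \<open>(b - a) * b \<le> q\<close> and \<open>bdist R y \<le> 2 * R * b\<close> one factor
  \<open>b\<close> cancels, which leaves a multiple of \<open>bdist R x\<close>.\<close>

lemma gker_le_bdist:
  assumes x: "x \<in> ball 0 R" and y: "y \<in> ball 0 R" and "x \<noteq> y"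
  shows "gker x y \<le> (real CARD('n) - 2) * norm (x - y) powr (1 - real CARD('n)) * (2 * bdist R x / R)"
proof -
  define a where "a = norm (x - y)"
  define q where "q = bdist R x * bdist R y / R\<^sup>2"
  define b where "b = sqrt (a\<^sup>2 + q)"
  have a: "a > 0" using assms by (simp add: a_def)
  have X: "bdist R x > 0" "bdist R y > 0" using bdist_pos x y by auto
  have q: "q \<ge> 0" using X by (simp add: q_def)
  have ny: "norm y < R" "norm x < R" using x y by auto
  have b2: "b\<^sup>2 = a\<^sup>2 + q" using q by (simp add: b_def)
  have b0: "b \<ge> 0" using q by (simp add: b_def)
  have ab: "a \<le> b" by (rule power2_le_imp_le[OF _ b0]) (simp add: b2 q)
  \<comment> \<open>Replacing \<open>a\<close> by the smaller
    \<open>\<bar>norm x - norm y\<bar>\<close> turns \<open>a^2 + q\<close> into the perfect square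
    \<open>((R^2 - norm x * norm y) / R)^2\<close>, which is at least
    \<open>(R - norm y)^2\<close>.\<close>
  have bR: "b \<ge> R - norm y"
  proof (rule power2_le_imp_le[OF _ b0])
    have t: "(norm x - norm y)\<^sup>2 \<le> a\<^sup>2"
      unfolding a_def by (rule power2_le_iff_abs_le[THEN iffD2]) (auto simp: norm_triangle_ineq3)
    have "R\<^sup>2 * (norm x - norm y)\<^sup>2 + bdist R x * bdist R y = (R\<^sup>2 - norm x * norm y)\<^sup>2"
      by (simp add: bdist_def power2_eq_square algebra_simps)
    moreover have "(R * (R - norm y))\<^sup>2 \<le> (R\<^sup>2 - norm x * norm y)\<^sup>2"
    proof (rule power_mono)
      have "norm x * norm y \<le> R * norm y" using ny by (intro mult_right_mono) auto
      then show "R * (R - norm y) \<le> R\<^sup>2 - norm x * norm y" by (simp add: power2_eq_square algebra_simps)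
      show "0 \<le> R * (R - norm y)" using ny R by simp
    qed
    ultimately have "R\<^sup>2 * (R - norm y)\<^sup>2 \<le> R\<^sup>2 * (norm x - norm y)\<^sup>2 + bdist R x * bdist R y"
      by (simp add: power_mult_distrib)
    also have "\<dots> \<le> R\<^sup>2 * a\<^sup>2 + bdist R x * bdist R y" using t by (simp add: mult_left_mono)
    also have "\<dots> = R\<^sup>2 * (a\<^sup>2 + q)" using R by (simp add: q_def distrib_left)
    finally show "(R - norm y)\<^sup>2 \<le> b\<^sup>2" unfolding b2 using R by simp
  qed
  have Y: "bdist R y \<le> 2 * R * b"
  proof -
    have "bdist R y = (R + norm y) * (R - norm y)" by (simp add: bdist_def power2_eq_square algebra_simps)
    also have "\<dots> \<le> (2 * R) * b" using ny bR R by (intro mult_mono) auto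
    finally show ?thesis .
  qed
  have bpos: "b > 0" using a ab by linarith
  have "(b - a) * b \<le> (b - a) * (b + a)" using a ab by (intro mult_left_mono) auto
  also have "\<dots> = q" using b2 by (simp add: power2_eq_square algebra_simps)
  also have "q \<le> bdist R x * (2 * R * b) / R\<^sup>2"
    unfolding q_def using X Y by (intro divide_right_mono mult_left_mono) auto
  also have "\<dots> = (2 * bdist R x / R) * b" using R by (simp add: power2_eq_square)
  finally have ba: "b - a \<le> 2 * bdist R x / R" by (rule mult_right_le_imp_le[OF _ bpos])
  have ka: "(a\<^sup>2) powr (- kap) = a powr (2 - real CARD('n))" "(b\<^sup>2) powr (- kap) = b powr (2 - real CARD('n))"
    using norm_powr_sq[of a "CARD('n)"] norm_powr_sq[of b "CARD('n)"] a b0 by (simp_all add: kap_def minus_divide_left)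
  have "gker x y = a powr (- (real CARD('n) - 2)) - b powr (- (real CARD('n) - 2))"
    using gker_alt[OF x y] ka unfolding b2 by (simp add: a_def q_def)
  also have "\<dots> \<le> (real CARD('n) - 2) * a powr (- (real CARD('n) - 2) - 1) * (b - a)"
    using a ab dim3 by (intro powr_neg_diff_le) auto
  also have "\<dots> \<le> (real CARD('n) - 2) * a powr (- (real CARD('n) - 2) - 1) * (2 * bdist R x / R)"
    using dim3 by (intro mult_left_mono ba) auto
  finally show ?thesis by (simp add: a_def)
qed

text \<open>The factor \<open>bdist R x\<close> costs one power of the distance, and the resulting
  kernel of order \<open>1 - N\<close> is still integrable.\<close>

lemma V_le_bdist:
  obtains C where "C > 0" "\<And>x. x \<in> ball 0 R \<Longrightarrow> V x \<le> C * bdist R x"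
proof -
  define k1 where "k1 z = indicator (ball (0::(real, 'n) vec) (2 * R)) z * norm z powr (1 - real CARD('n))" for z
  define m1 where "m1 = (LINT z|lborel. k1 z)"
  have k1: "integrable lborel k1" unfolding k1_def[abs_def] using R dim3 by (intro integrable_norm_powr) auto
  have k1m [measurable]: "k1 \<in> borel_measurable borel" using borel_measurable_integrable[OF k1] by simp
  have k10: "k1 z \<ge> 0" for z by (simp add: k1_def)
  have sh: "integrable lborel (\<lambda>y. k1 (x - y))" "(LINT y|lborel. k1 (x - y)) = m1" for x
  proof -
    have "integrable lborel (\<lambda>y. k1 ((- x) + y))" "(LINT y|lborel. k1 ((- x) + y)) = m1"
      using integrable_distr[of "(+) (- x)" lborel borel k1] integral_distr[of "(+) (- x)" lborel borel k1]
        lborel_distr_plus[of "- x"] k1 by (simp_all add: m1_def)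
    moreover have "(\<lambda>y. k1 ((- x) + y)) = (\<lambda>y. k1 (x - y))"
      by (auto simp: fun_eq_iff k1_def indicator_def norm_minus_commute)
    ultimately show "integrable lborel (\<lambda>y. k1 (x - y))" "(LINT y|lborel. k1 (x - y)) = m1" by simp_all
  qed
  have m10: "m1 \<ge> 0" unfolding m1_def using k10 by (intro integral_nonneg_AE) auto
  define c where "c = (real CARD('n) - 2) * (2 / R) * M powr p"
  have c0: "c \<ge> 0" using dim3 R by (simp add: c_def)
  have "V x \<le> (c * m1 + 1) * bdist R x" if x: "x \<in> ball 0 R" for x
  proof -
    have "V x \<le> (LINT y|lborel. c * bdist R x * k1 (x - y))"
      unfolding V_def pot_def
    proof (rule integral_mono_AE)
      show "AE y in lborel. gker x y * U y powr p \<le> c * bdist R x * k1 (x - y)"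
        using AE_neq[of x]
      proof eventually_elim
        fix y assume y: "y \<noteq> x"
        show "gker x y * U y powr p \<le> c * bdist R x * k1 (x - y)"
        proof (cases "y \<in> ball 0 R")
          case True
          have "gker x y * U y powr p \<le> ((real CARD('n) - 2) * norm (x - y) powr (1 - real CARD('n)) * (2 * bdist R x / R)) * M powr p"
            using gker_le_bdist[OF x True] gker_bounds(1)[of x y] y Up_bound[of y]  by (intro mult_mono) auto
          moreover have "norm (x - y) < 2 * R" using x True norm_triangle_ineq4[of x y] by simp
          ultimately show ?thesis using R by (simp add: c_def k1_def field_simps)
        next
          case False
          then show ?thesis using c0 k10[of "x - y"] bdist_pos[OF x] by (simp add: gker_def)
        qed
      qed
    qed (use sh pot_integrable[OF Up_meas Up_bound] in auto)
    also have "\<dots> = c * bdist R x * m1" using sh by simp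
    also have "\<dots> \<le> (c * m1 + 1) * bdist R x" using bdist_pos[OF x] by (simp add: distrib_right)
    finally show ?thesis .
  qed
  moreover have "c * m1 + 1 > 0" using c0 m10 by (simp add: add_nonneg_pos)
  ultimately show thesis using that by blast
qed

text \<open>For points with \<open>bdist R x \<ge> s0\<close> the kernel has a positive lower bound
  depending only on \<open>y\<close>: the drop of the negative power over the length
  \<open>s0 * bdist R y / R^2\<close>, taken at an argument above every squared distance in the
  ball.\<close>

lemma V_pos_interior:
  assumes s0: "s0 > 0"
  obtains m where "m > 0" "\<And>x. x \<in> ball 0 R \<Longrightarrow> s0 \<le> bdist R x \<Longrightarrow> m \<le> V x"
proof -
  define f where "f y = indicator (ball (0::(real, 'n) vec) R) y * (((5 * R\<^sup>2) powr (- kap) - (5 * R\<^sup>2 + s0 * bdist R y / R\<^sup>2) powr (- kap)) * U y powr p)" for y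
  have cpos: "(5 * R\<^sup>2) powr (- kap) - (5 * R\<^sup>2 + s0 * bdist R y / R\<^sup>2) powr (- kap) > 0" if "y \<in> ball 0 R" for y :: "(real, 'n) vec"
    using kap_pos R s0 bdist_pos[OF that] by (simp add: powr_less_mono2_neg)
  have fpos: "f y > 0" if "y \<in> ball 0 R" for y
    using cpos[OF that] U_pos[OF that] that by (simp add: f_def)
  have f0: "f y \<ge> 0" for y using fpos[of y] by (cases "y \<in> ball 0 R") (auto simp: f_def)
  have fm [measurable]: "f \<in> borel_measurable borel"
    unfolding f_def[abs_def] bdist_def by (intro borel_measurable_times borel_measurable_diff powr_real_measurable) (measurable; simp)+
  have fi: "integrable lborel f"
  proof (rule integrable_bounded_ball[OF fm])
    fix y
    show "\<bar>f y\<bar> \<le> (5 * R\<^sup>2) powr (- kap) * M powr p"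
    proof (cases "y \<in> ball 0 R")
      case True
      have "((5 * R\<^sup>2) powr (- kap) - (5 * R\<^sup>2 + s0 * bdist R y / R\<^sup>2) powr (- kap)) * U y powr p \<le> (5 * R\<^sup>2) powr (- kap) * M powr p"
        using cpos[OF True] Up_bound[of y] by (intro mult_mono) auto
      then show ?thesis using True fpos[OF True] by (simp add: f_def)
    qed (simp add: f_def)
  qed (simp add: f_def)
  define m where "m = (LINT y|lborel. f y)"
  have "m > 0"
  proof (rule ccontr)
    assume "\<not> m > 0"
    moreover have "m \<ge> 0" unfolding m_def using f0 by (intro integral_nonneg_AE) auto
    ultimately have "(LINT y|lborel. f y) = 0" by (simp add: m_def)
    then have "AE y in lborel. f y = 0" using integral_nonneg_eq_0_iff_AE[OF fi] f0 by simp
    then have "AE y in lborel. y \<in> ball (0::(real, 'n) vec) R \<longrightarrow> (1::real) \<le> 0" by eventually_elim (use fpos in force)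
    then have "(1::real) \<le> 0" using R by (intro AE_continuous_le_0[of "ball (0::(real, 'n) vec) R" "\<lambda>_. 1" 0]) auto
    then show False by simp
  qed
  moreover have "m \<le> V x" if x: "x \<in> ball 0 R" "s0 \<le> bdist R x" for x
    unfolding m_def V_def pot_def
  proof (rule integral_mono_AE[OF fi pot_integrable[OF Up_meas Up_bound]])
    show "AE y in lborel. f y \<le> gker x y * U y powr p"
      using AE_neq[of x]
    proof eventually_elim
      fix y assume y: "y \<noteq> x"
      show "f y \<le> gker x y * U y powr p"
      proof (cases "y \<in> ball 0 R")
        case True
        define t where "t = (norm (x - y))\<^sup>2"
        define d where "d = s0 * bdist R y / R\<^sup>2"
        have t: "t > 0" using y by (simp add: t_def)
        have "norm (x - y) \<le> 2 * R" using x True norm_triangle_ineq4[of x y] by simp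
        then have "t \<le> (2 * R)\<^sup>2" unfolding t_def by (intro power_mono) auto
        then have "t \<le> 4 * R\<^sup>2" by (simp add: power_mult_distrib)
        then have t5: "t \<le> 5 * R\<^sup>2" using zero_le_power2[of R] by linarith
        have d: "d \<ge> 0" using s0 bdist_pos[OF True] by (simp add: d_def)
        have "(5 * R\<^sup>2) powr (- kap) - (5 * R\<^sup>2 + d) powr (- kap) \<le> t powr (- kap) - (t + d) powr (- kap)"
          by (rule powr_neg_drop_antimono[OF kap_pos t t5 d])
        also have "\<dots> \<le> t powr (- kap) - (t + bdist R x * bdist R y / R\<^sup>2) powr (- kap)"
        proof -
          have "d \<le> bdist R x * bdist R y / R\<^sup>2"
            unfolding d_def using x bdist_pos[OF True] by (intro divide_right_mono mult_right_mono) auto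
          then have "(t + bdist R x * bdist R y / R\<^sup>2) powr (- kap) \<le> (t + d) powr (- kap)"
            using t d kap_pos by (intro powr_mono2') auto
          then show ?thesis by simp
        qed
        also have "\<dots> = gker x y" unfolding gker_alt[OF x(1) True] t_def ..
        finally have "((5 * R\<^sup>2) powr (- kap) - (5 * R\<^sup>2 + d) powr (- kap)) * U y powr p \<le> gker x y * U y powr p"
          by (rule mult_right_mono) simp
        then show ?thesis using True by (simp add: f_def d_def)
      next
        case False
        then show ?thesis using gker_bounds(1)[of x y] y by (simp add: f_def)
      qed
    qed
  qed
  ultimately show thesis using that by blast
qed

text \<open>Hopf-type bound. The barrier is \<open>s + A s\<^sup>2\<close> with \<open>s = R\<^sup>2 - |x|\<^sup>2\<close>; the choice \<open>A = N / R\<^sup>2\<close> makes it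
  a strict subsolution near the boundary, and in the interior the positive right-hand side leaves room.\<close>
lemma U_ge_bdist:
  obtains c where "c > 0" "\<And>x. x \<in> ball 0 R \<Longrightarrow> c * bdist R x \<le> U x"
proof -
  define n where "n = real CARD('n)"
  have n: "n \<ge> 3" using dim3 by (simp add: n_def)
  define A where "A = n / R\<^sup>2"
  have A: "A > 0" "A * R\<^sup>2 = n" using R n by (auto simp: A_def)
  \<comment> \<open>With \<open>s = bdist R x\<close>, the left side of the subsolution inequality
    is \<open>c\<close> times a constant plus terms in \<open>s\<close>. The choice of
    \<open>A\<close> makes the constant \<open>- 6 * n\<close>, and \<open>a1\<close> collects the
    coefficients of \<open>s\<close> after the estimate
    \<open>A * s^2 \<le> A * R^2 * s\<close>.\<close>
  define a1 where "a1 = 4 * n * A + 8 * A + 1 + A * R\<^sup>2"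
  have a1: "a1 > 0" using A n by (simp add: a1_def add_pos_pos)
  \<comment> \<open>As long as \<open>s\<close> is at most this value,
    \<open>- 6 * n + s * a1\<close> is at most 0.\<close>
  define s0 where "s0 = 6 * n / a1"
  have s0: "s0 > 0" using a1 n by (simp add: s0_def)
  obtain mV where mV: "mV > 0" "\<And>x. x \<in> ball 0 R \<Longrightarrow> s0 \<le> bdist R x \<Longrightarrow> mV \<le> V x"
    using V_pos_interior[OF s0] by metis
  define K where "K = {x::(real, 'n) vec. norm x \<le> R} \<inter> {x. s0 \<le> bdist R x}"
  have K: "compact K" unfolding K_def bdist_def
    by (intro compact_Int_closed closed_Collect_le continuous_intros)
       (use compact_cball[of "0::(real, 'n) vec" R] in \<open>simp add: cball_def dist_norm\<close>)
  have KB: "K \<subseteq> ball 0 R"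
  proof
    fix y assume y: "y \<in> K"
    have "norm y \<noteq> R" using y s0 by (auto simp: K_def bdist_def)
    then show "y \<in> ball 0 R" using y by (auto simp: K_def)
  qed
  obtain mU where mU: "mU > 0" "\<And>x. x \<in> K \<Longrightarrow> mU \<le> U x"
  proof (cases "K = {}")
    case True then show thesis using that[of 1] by auto
  next
    case False
    obtain z where "z \<in> K" "\<And>y. y \<in> K \<Longrightarrow> U z \<le> U y"
      using continuous_attains_inf[OF K False continuous_on_subset[OF U_cont KB]] by blast
    then show thesis using that[of "U z"] U_pos[of z] KB by auto
  qed
  define m where "m = mV * mU powr (p - 1)"
  have m: "m > 0" using mV mU by (simp add: m_def)
  \<comment> \<open>\<open>C1\<close> dominates \<open>- 6 * n + s * a1\<close> on the whole ball,
    so the factor \<open>c = m / C1\<close> keeps the expression below the interior lower bound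
    \<open>m\<close> of the right-hand side.\<close>
  define C1 where "C1 = 2 * n + R\<^sup>2 * a1"
  have C1: "C1 > 0" using n a1 R by (simp add: C1_def add_pos_pos)
  define c where "c = m / C1"
  have c: "c > 0" using m C1 by (simp add: c_def)
  define \<eta> where "\<eta> t = c * ((R\<^sup>2 - t) + A * (R\<^sup>2 - t)\<^sup>2)" for t
  define \<eta>' where "\<eta>' t = - c * (1 + 2 * A * (R\<^sup>2 - t))" for t
  define \<eta>'' where "\<eta>'' t = 2 * A * c" for t :: real
  have d1: "(\<eta> has_real_derivative \<eta>' t) (at t)" for t
    unfolding \<eta>_def[abs_def] \<eta>'_def by (auto intro!: derivative_eq_intros simp: algebra_simps)
  have d2: "(\<eta>' has_real_derivative \<eta>'' t) (at t)" for t
    unfolding \<eta>'_def[abs_def] \<eta>''_def by (auto intro!: derivative_eq_intros simp: algebra_simps)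
  have sub: "- (2 * real CARD('n) * \<eta>' ((norm x)\<^sup>2) + 4 * \<eta>'' ((norm x)\<^sup>2) * (norm x)\<^sup>2) + \<eta> ((norm x)\<^sup>2)
        \<le> V x * U x powr (p - 1)" if x: "x \<in> ball 0 R" for x
  proof -
    define s where "s = bdist R x"
    have s: "s > 0" "s \<le> R\<^sup>2" unfolding s_def using bdist_pos[OF x] bdist_le[of R x] by auto
    have nx: "(norm x)\<^sup>2 = R\<^sup>2 - s" by (simp add: s_def bdist_def)
    have "- (2 * real CARD('n) * \<eta>' ((norm x)\<^sup>2) + 4 * \<eta>'' ((norm x)\<^sup>2) * (norm x)\<^sup>2) + \<eta> ((norm x)\<^sup>2)
      = c * (2 * n - 8 * (A * R\<^sup>2) + (s * (4 * n * A + 8 * A + 1) + A * s\<^sup>2))"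
      unfolding \<eta>_def \<eta>'_def \<eta>''_def nx n_def by (simp add: algebra_simps)
    also have "\<dots> \<le> c * (- 6 * n + s * a1)"
    proof (rule mult_left_mono)
      have "A * s\<^sup>2 \<le> A * (s * R\<^sup>2)" using s A by (simp add: power2_eq_square)
      also have "\<dots> = n * s" using A(2) by (metis mult.assoc mult.commute)
      finally have "A * s\<^sup>2 \<le> n * s" .
      then show "2 * n - 8 * (A * R\<^sup>2) + (s * (4 * n * A + 8 * A + 1) + A * s\<^sup>2) \<le> - 6 * n + s * a1"
        unfolding a1_def using A(2) by (simp add: algebra_simps)
    qed (use c in simp)
    also have "\<dots> \<le> V x * U x powr (p - 1)"
    proof (cases "s0 \<le> s")
      case True
      have xK: "x \<in> K" using x True by (auto simp: K_def s_def)
      have "- 6 * n + s * a1 \<le> C1"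
        using mult_right_mono[OF s(2) less_imp_le[OF a1]] n unfolding C1_def by linarith
      then have "c * (- 6 * n + s * a1) \<le> c * C1" using c by (intro mult_left_mono) auto
      also have "c * C1 = m" using C1 by (simp add: c_def)
      also have "m \<le> V x * U x powr (p - 1)"
        unfolding m_def using mV(2)[OF x] mU(2)[OF xK] mU(1) mV(1) True p V_nonneg[of x]
        by (intro mult_mono powr_mono2) (auto simp: s_def)
      finally show ?thesis .
    next
      case False
      then have "s * a1 \<le> 6 * n" using a1 by (simp add: s0_def field_simps)
      then have "c * (- 6 * n + s * a1) \<le> 0" using c by (simp add: mult_le_0_iff)
      then show ?thesis using V_nonneg[of x] by (meson mult_nonneg_nonneg order_trans powr_ge_zero)
    qed
    finally show ?thesis .
  qed
  show thesis
  proof (rule that[OF c])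
    fix x :: "(real, 'n) vec" assume x: "x \<in> ball 0 R"
    have "\<eta> (R\<^sup>2) = 0" by (simp add: \<eta>_def)
    then have "\<eta> ((norm x)\<^sup>2) \<le> U x"
      using radial_barrier[OF d1 d2 _ _ sub x] by (simp add: \<eta>''_def[abs_def])
    moreover have "c * bdist R x \<le> \<eta> ((norm x)\<^sup>2)"
      using c A by (simp add: \<eta>_def bdist_def)
    ultimately show "c * bdist R x \<le> U x" by linarith
  qed
qed

text \<open>For \<open>p < 2\<close> the ratio \<open>b / U x\<close> lies in \<open>[0, 1]\<close>
  and is at most its power with exponent \<open>p - 1\<close>, so the difference of powers is at
  most \<open>U x powr (p - 2) * (U x - b)\<close>. Inserting \<open>U x \<ge> c * s\<close> and
  \<open>V x \<le> CV * s\<close> leaves \<open>s powr (p - 1)\<close>, which is bounded.\<close>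

lemma V_power_diff_le:
  obtains C where "C > 0" "\<And>x b. x \<in> ball 0 R \<Longrightarrow> 0 \<le> b \<Longrightarrow> b \<le> U x \<Longrightarrow>
     V x * (U x powr (p - 1) - b powr (p - 1)) \<le> C * (U x - b)"
proof (cases "p \<ge> 2")
  case True
  define C where "C = M powr p * kern_mass * ((p - 1) * M powr (p - 2)) + 1"
  have "C > 0" unfolding C_def using kern_mass_nonneg True by (intro add_nonneg_pos) auto
  moreover have "V x * (U x powr (p - 1) - b powr (p - 1)) \<le> C * (U x - b)"
    if x: "x \<in> ball 0 R" and b: "0 \<le> b" "b \<le> U x" for x b
  proof -
    have "U x powr (p - 1) - b powr (p - 1) \<le> (p - 1) * U x powr (p - 1 - 1) * (U x - b)"
      using True b by (intro powr_diff_le) auto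
    also have "\<dots> \<le> (p - 1) * M powr (p - 2) * (U x - b)"
    proof (intro mult_right_mono mult_left_mono)
      show "U x powr (p - 1 - 1) \<le> M powr (p - 2)"
        using powr_mono2[of "p - 2" "U x" M] True U_le[of x] U_nonneg[of x] by (simp add: diff_diff_eq)
    qed (use True b in auto)
    finally have "V x * (U x powr (p - 1) - b powr (p - 1)) \<le> V x * ((p - 1) * M powr (p - 2) * (U x - b))"
      by (rule mult_left_mono[OF _ V_nonneg])
    also have "\<dots> \<le> (M powr p * kern_mass) * ((p - 1) * M powr (p - 2) * (U x - b))"
      using V_bound[of x] True b by (intro mult_right_mono) auto
    also have "\<dots> \<le> C * (U x - b)" using b by (simp add: C_def algebra_simps)
    finally show ?thesis .
  qed
  ultimately show thesis using that by blast
next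
  case False
  obtain CV where CV: "CV > 0" "\<And>x. x \<in> ball 0 R \<Longrightarrow> V x \<le> CV * bdist R x" using V_le_bdist by metis
  obtain c where c: "c > 0" "\<And>x. x \<in> ball 0 R \<Longrightarrow> c * bdist R x \<le> U x" using U_ge_bdist by metis
  define C where "C = CV * c powr (p - 2) * (R\<^sup>2) powr (p - 1)"
  have "C > 0" using CV c R by (simp add: C_def)
  moreover have "V x * (U x powr (p - 1) - b powr (p - 1)) \<le> C * (U x - b)"
    if x: "x \<in> ball 0 R" and b: "0 \<le> b" "b \<le> U x" for x b
  proof -
    define s where "s = bdist R x"
    have s: "s > 0" "s \<le> R\<^sup>2" unfolding s_def using bdist_pos[OF x] bdist_le[of R x] by auto
    note Ux = U_pos[OF x]
    have "b / U x \<le> (b / U x) powr (p - 1)"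
    proof (cases "b = 0")
      case False
      then have "(b / U x) powr 1 \<le> (b / U x) powr (p - 1)"
        using b Ux \<open>\<not> p \<ge> 2\<close> by (intro powr_mono') auto
      then show ?thesis using b Ux False by simp
    qed simp
    also have "\<dots> = b powr (p - 1) / U x powr (p - 1)" using b Ux by (simp add: powr_divide)
    finally have "b / U x * U x powr (p - 1) \<le> b powr (p - 1)" using Ux by (simp add: field_simps)
    moreover have "U x powr (p - 1) = U x powr (p - 2) * U x"
      using Ux powr_add[of "U x" "p - 2" 1] by simp
    ultimately have "U x powr (p - 1) - b powr (p - 1) \<le> U x powr (p - 2) * (U x - b)"
      using Ux by (simp add: algebra_simps)
    also have "\<dots> \<le> (c * s) powr (p - 2) * (U x - b)"
      using c s False b c(2)[OF x] by (intro mult_right_mono powr_mono2') (auto simp: s_def)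
    finally have "V x * (U x powr (p - 1) - b powr (p - 1)) \<le> V x * ((c * s) powr (p - 2) * (U x - b))"
      by (rule mult_left_mono[OF _ V_nonneg])
    also have "\<dots> \<le> (CV * s) * ((c * s) powr (p - 2) * (U x - b))"
      using CV(2)[OF x] b by (intro mult_right_mono) (auto simp: s_def)
    also have "\<dots> = CV * c powr (p - 2) * s powr (p - 1) * (U x - b)"
    proof -
      have "s * (c * s) powr (p - 2) = c powr (p - 2) * s powr (p - 1)"
        using c s powr_add[of s "p - 2" 1] by (simp add: powr_mult)
      then show ?thesis by (simp add: ac_simps)
    qed
    also have "\<dots> \<le> C * (U x - b)" unfolding C_def
      using s CV c b p by (intro mult_right_mono mult_left_mono powr_mono2) auto
    finally show ?thesis .
  qed
  ultimately show thesis using that by blast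
qed

end

section \<open>Moving planes\<close>

text \<open>Translating by \<open>h\<close> moves a point of \<open>A\<close> out of \<open>A\<close> for at least half of all \<open>h\<close> in the ball, so
  averaging the translation estimate over \<open>h\<close> controls the full norm.\<close>
lemma H10_poincare_small:
  fixes \<Gamma> :: "real^'n::idx \<Rightarrow> real"
  assumes H: "H10_grad R \<Gamma> D" and r: "r > 0" and A [measurable]: "A \<in> sets borel"
    and out: "\<And>x. x \<notin> A \<Longrightarrow> \<Gamma> x = 0"
    and small: "emeasure lborel A \<le> ennreal (measure lborel (ball (0::real^'n::idx) r) / 2)"
  shows "l2sq \<Gamma> \<le> ennreal (8 * r\<^sup>2) * l2sq D"
proof -
  let ?B = "ball (0::real^'n::idx) r"
  have [measurable]: "\<Gamma> \<in> borel_measurable borel" "D \<in> borel_measurable borel" using H10_grad_measurable[OF H] by auto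
  define b where "b = measure lborel ?B"
  have b: "b > 0" unfolding b_def using r by (rule content_ball_pos)
  have eb: "emeasure lborel ?B = ennreal b"
    unfolding b_def using emeasure_lborel_ball_finite[of "0::real^'n::idx" r] by (intro emeasure_eq_ennreal_measure) auto
  define f where "f h x = indicator ?B h * (indicator (- A) (x + h) * ennreal ((\<Gamma> x)\<^sup>2))" for h x
  have fm: "(\<lambda>z. f (fst z) (snd z)) \<in> borel_measurable (lborel \<Otimes>\<^sub>M lborel)"
    unfolding f_def by (measurable; simp)
  have upper: "(\<integral>\<^sup>+x. f h x \<partial>lborel) \<le> (ennreal (4 * r\<^sup>2) * l2sq D) * indicator ?B h" for h
  proof (cases "h \<in> ?B")
    \<comment> \<open>If \<open>x + h\<close> misses \<open>A\<close>, then
      \<open>\<Gamma> (x + h)\<close> is 0 and the square of \<open>\<Gamma> x\<close> equals the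
      squared increment.\<close>
    case True
    have "(\<integral>\<^sup>+x. f h x \<partial>lborel) \<le> l2sq (\<lambda>x. \<Gamma> (x + h) - \<Gamma> x)"
      unfolding l2sq_def
    proof (intro nn_integral_mono)
      fix x show "f h x \<le> ennreal ((norm (\<Gamma> (x + h) - \<Gamma> x))\<^sup>2)"
        using out[of "x + h"] by (auto simp: f_def indicator_def)
    qed
    also have "\<dots> \<le> ennreal (4 * (norm h)\<^sup>2) * l2sq D" by (rule H10_grad_translation_estimate[OF H])
    also have "\<dots> \<le> ennreal (4 * r\<^sup>2) * l2sq D"
      using True by (intro mult_right_mono ennreal_leI mult_left_mono power_mono) auto
    finally show ?thesis using True by simp
  qed (simp add: f_def)
  have inner: "ennreal (b / 2) \<le> (\<integral>\<^sup>+h. indicator ?B h * indicator (- A) (x + h) \<partial>lborel)" for x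
  proof -
    define i where "i = (\<integral>\<^sup>+h. indicator ?B h * indicator (- A) (x + h) \<partial>lborel)"
    have "ennreal b = (\<integral>\<^sup>+h. indicator ?B h \<partial>lborel)" using eb by simp
    also have "\<dots> \<le> (\<integral>\<^sup>+h. indicator ?B h * indicator (- A) (x + h) + indicator A (h + x) \<partial>lborel)"
      by (intro nn_integral_mono) (auto simp: indicator_def add.commute)
    also have "\<dots> = i + (\<integral>\<^sup>+h. indicator A (h + x) \<partial>lborel)"
      unfolding i_def by (intro nn_integral_add) (measurable; simp)+
    also have "(\<integral>\<^sup>+h. indicator A (h + x) \<partial>lborel) = emeasure lborel A"
      by (subst nn_integral_translate) auto
    also have "i + emeasure lborel A \<le> i + ennreal (b / 2)" using small by (simp add: b_def add_left_mono)
    finally have le: "ennreal b \<le> i + ennreal (b / 2)" .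
    have "i \<le> (\<integral>\<^sup>+h. indicator ?B h \<partial>lborel)"
      unfolding i_def by (intro nn_integral_mono) (auto simp: indicator_def)
    then have "i \<le> ennreal b" using eb by simp
    then have "i < \<infinity>" using ennreal_less_top le_less_trans by (metis infinity_ennreal_def)
    then obtain j where j: "i = ennreal j" "j \<ge> 0" by (cases i) auto
    have "b \<le> j + b / 2" using le b j by (simp add: ennreal_le_iff flip: ennreal_plus)
    then show ?thesis unfolding i_def[symmetric] j by (intro ennreal_leI) simp
  qed
  have "ennreal (b / 2) * l2sq \<Gamma> = (\<integral>\<^sup>+x. ennreal (b / 2) * ennreal ((\<Gamma> x)\<^sup>2) \<partial>lborel)"
    unfolding l2sq_def by (simp add: nn_integral_cmult)
  also have "\<dots> \<le> (\<integral>\<^sup>+x. (\<integral>\<^sup>+h. f h x \<partial>lborel) \<partial>lborel)"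
  proof (intro nn_integral_mono)
    fix x
    have "(\<integral>\<^sup>+h. f h x \<partial>lborel) = (\<integral>\<^sup>+h. indicator ?B h * indicator (- A) (x + h) \<partial>lborel) * ennreal ((\<Gamma> x)\<^sup>2)"
      unfolding f_def by (subst nn_integral_multc[symmetric]) (auto simp: mult.assoc)
    then show "ennreal (b / 2) * ennreal ((\<Gamma> x)\<^sup>2) \<le> (\<integral>\<^sup>+h. f h x \<partial>lborel)"
      using mult_right_mono[OF inner[of x], of "ennreal ((\<Gamma> x)\<^sup>2)"] by simp
  qed
  also have "\<dots> = (\<integral>\<^sup>+h. (\<integral>\<^sup>+x. f h x \<partial>lborel) \<partial>lborel)"
    by (rule lborel_pair.Fubini') (use fm in \<open>simp add: case_prod_beta'\<close>)
  also have "\<dots> \<le> (\<integral>\<^sup>+h. (ennreal (4 * r\<^sup>2) * l2sq D) * indicator ?B h \<partial>lborel)"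
    by (intro nn_integral_mono upper)
  also have "\<dots> = (ennreal (4 * r\<^sup>2) * l2sq D) * ennreal b"
    using eb by (simp add: nn_integral_cmult_indicator)
  finally have le: "ennreal (b / 2) * l2sq \<Gamma> \<le> (ennreal (4 * r\<^sup>2) * l2sq D) * ennreal b" .
  \<comment> \<open>The translation estimate contributes \<open>4 * r^2\<close>, and the lost half
    of the ball a factor 2.\<close>
  have "l2sq \<Gamma> = ennreal (2 / b) * (ennreal (b / 2) * l2sq \<Gamma>)"
    using b by (simp add: mult.assoc[symmetric] ennreal_mult[symmetric])
  also have "\<dots> \<le> ennreal (2 / b) * ((ennreal (4 * r\<^sup>2) * l2sq D) * ennreal b)"
    using le by (rule mult_left_mono) simp
  also have "\<dots> = (ennreal (2 / b) * ennreal b * ennreal (4 * r\<^sup>2)) * l2sq D" by (simp add: ac_simps)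
  also have "ennreal (2 / b) * ennreal b * ennreal (4 * r\<^sup>2) = ennreal (8 * r\<^sup>2)"
  proof -
    have "ennreal (2 / b) * ennreal b = ennreal 2" using b by (simp add: ennreal_mult[symmetric])
    moreover have "ennreal 2 * ennreal (4 * r\<^sup>2) = ennreal (2 * (4 * r\<^sup>2))" by (rule ennreal_mult[symmetric]) auto
    ultimately show ?thesis by simp
  qed
  finally show ?thesis .
qed

lemma sq_trunc_pos: "M > 0 \<Longrightarrow> t > 0 \<Longrightarrow> sq_trunc M t > 0"
proof -
  assume M: "M > 0" and t: "t > 0"
  show ?thesis
  proof (cases "t \<le> M")
    case True then show ?thesis using t by (simp add: sq_trunc_def)
  next
    case False
    then have "sq_trunc M t = M * (2 * t - M)" using t M by (simp add: sq_trunc_def power2_eq_square algebra_simps)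
    then show ?thesis using False M by simp
  qed
qed

context green_ball
begin

text \<open>Fubini and translation invariance. It integrates the nonlocal term of the cap estimate,
  where \<open>f\<close> is the fourth power of the truncated difference.\<close>

lemma kern_convolution:
  assumes f: "integrable lborel f" "\<And>y. 0 \<le> f y"
  shows "integrable lborel (\<lambda>x. LINT y|lborel. kern (x - y) * f y)"
    "(LINT x|lborel. LINT y|lborel. kern (x - y) * f y) = kern_mass * (LINT y|lborel. f y)"
proof -
  have [measurable]: "f \<in> borel_measurable borel" using borel_measurable_integrable[OF f(1)] by simp
  have k: "integrable lborel (\<lambda>x. kern (x - y))" "(LINT x|lborel. kern (x - y)) = kern_mass" for y
    using kern_shift[of y] by (simp_all add: kern_minus[of _ y])
  have i: "integrable (lborel \<Otimes>\<^sub>M lborel) (\<lambda>(y, x). kern (x - y) * f y)"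
  proof (rule lborel_pair.Fubini_integrable)
    show "(\<lambda>(y, x). kern (x - y) * f y) \<in> borel_measurable (lborel \<Otimes>\<^sub>M lborel)" by measurable
    have "(LINT x|lborel. norm (kern (x - y) * f y)) = kern_mass * f y" for y
      using k[of y] f(2)[of y] kern_nonneg by (simp add: abs_mult)
    then show "integrable lborel (\<lambda>y. LINT x|lborel. norm (case (y, x) of (y, x) \<Rightarrow> kern (x - y) * f y))"
      using f(1) by simp
    show "AE y in lborel. integrable lborel (\<lambda>x. case (y, x) of (y, x) \<Rightarrow> kern (x - y) * f y)"
      using k by simp
  qed
  show "integrable lborel (\<lambda>x. LINT y|lborel. kern (x - y) * f y)"
    using lborel_pair.integrable_snd[OF i] by simp
  have "(LINT x|lborel. LINT y|lborel. kern (x - y) * f y) = (LINT y|lborel. LINT x|lborel. kern (x - y) * f y)"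
    using lborel_pair.Fubini_integral[OF i] by simp
  also have "\<dots> = kern_mass * (LINT y|lborel. f y)" using k by simp
  finally show "(LINT x|lborel. LINT y|lborel. kern (x - y) * f y) = kern_mass * (LINT y|lborel. f y)" .
qed

end

context positive_solution
begin

lemma rhs_meas [measurable]: "(\<lambda>x. V x * U x powr (p - 1)) \<in> borel_measurable borel"
  by (intro borel_measurable_times powr_real_measurable) auto

lemma rhs_test_integrable:
  assumes [measurable]: "\<psi> \<in> borel_measurable borel" and "\<And>x. \<bar>\<psi> x\<bar> \<le> B"
  shows "integrable lborel (\<lambda>x. (V x * U x powr (p - 1)) * \<psi> x)"
proof (rule integrable_bounded_ball)
  show "\<bar>(V x * U x powr (p - 1)) * \<psi> x\<bar> \<le> ((M powr p * kern_mass) * M powr (p - 1)) * B" for x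
    unfolding abs_mult using V_bound[of x] U_nonneg[of x] U_le[of x] p assms(2)[of x] kern_mass_nonneg
    by (intro mult_mono) (auto intro!: powr_mono2)
  show "x \<notin> ball 0 R \<Longrightarrow> (V x * U x powr (p - 1)) * \<psi> x = 0" for x by (simp add: V_outside)
qed measurable

text \<open>The weak equation tested with \<open>\<psi> - \<psi> \<circ> \<sigma>\<close>, after the change of variables \<open>\<sigma>\<close>.\<close>
lemma reflected_weak_equation:
  assumes e: "norm e = 1" and H1: "H10_grad R \<psi> D"
    and H2: "H10_grad R (\<lambda>x. \<psi> (hrefl e l x)) (\<lambda>x. hrefl e 0 (D (hrefl e l x)))"
    and b: "\<And>x. \<bar>\<psi> x\<bar> \<le> B"
  shows "integrable lborel (\<lambda>x. (g x - hrefl e 0 (g (hrefl e l x))) \<bullet> D x)"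
    "integrable lborel (\<lambda>x. (U x - U (hrefl e l x)) * \<psi> x)"
    "integrable lborel (\<lambda>x. (V x * U x powr (p - 1) - V (hrefl e l x) * U (hrefl e l x) powr (p - 1)) * \<psi> x)"
    "(LINT x|lborel. (g x - hrefl e 0 (g (hrefl e l x))) \<bullet> D x) + (LINT x|lborel. (U x - U (hrefl e l x)) * \<psi> x)
      = (LINT x|lborel. (V x * U x powr (p - 1) - V (hrefl e l x) * U (hrefl e l x) powr (p - 1)) * \<psi> x)"
proof -
  let ?s = "hrefl e l"
  define rh where "rh x = V x * U x powr (p - 1)" for x
  have [measurable]: "rh \<in> borel_measurable borel" unfolding rh_def[abs_def] by measurable
  note m1 = H10_grad_measurable[OF H1] and m2 = H10_grad_measurable[OF H2]
  note [measurable] = m1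
  note l1 = H10_grad_l2[OF H1] and l2 = H10_grad_l2[OF H2] and lU = H10_grad_l2[OF U_H10]
  have i1: "integrable lborel (\<lambda>x. g x \<bullet> D x)" by (rule l2_inner_integrable[OF g_meas m1(2) lU(2) l1(2)])
  have i2: "integrable lborel (\<lambda>x. U x * \<psi> x)" using l2_inner_integrable[OF U_meas m1(1) lU(1) l1(1)] by simp
  have i3: "integrable lborel (\<lambda>x. rh x * \<psi> x)" unfolding rh_def by (rule rhs_test_integrable[OF m1(1) b])
  have j1: "integrable lborel (\<lambda>x. g x \<bullet> hrefl e 0 (D (?s x)))" by (rule l2_inner_integrable[OF g_meas m2(2) lU(2) l2(2)])
  have j2: "integrable lborel (\<lambda>x. U x * \<psi> (?s x))" using l2_inner_integrable[OF U_meas m2(1) lU(1) l2(1)] by simp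
  have j3: "integrable lborel (\<lambda>x. rh x * \<psi> (?s x))" unfolding rh_def by (rule rhs_test_integrable[OF m2(1) b])
  have k1: "integrable lborel (\<lambda>x. hrefl e 0 (g (?s x)) \<bullet> D x)"
    using integrable_hrefl[OF e j1, of l] e by (simp add: hrefl_adjoint)
  have k2: "integrable lborel (\<lambda>x. U (?s x) * \<psi> x)"
    using integrable_hrefl[OF e j2, of l] e by simp
  have k3: "integrable lborel (\<lambda>x. rh (?s x) * \<psi> x)"
    using integrable_hrefl[OF e j3, of l] e by simp
  have q1: "(LINT x|lborel. g x \<bullet> hrefl e 0 (D (?s x))) = (LINT x|lborel. hrefl e 0 (g (?s x)) \<bullet> D x)"
    using integral_hrefl[OF e, of "\<lambda>x. g x \<bullet> hrefl e 0 (D (?s x))" l] e by (simp add: hrefl_adjoint)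
  have q2: "(LINT x|lborel. U x * \<psi> (?s x)) = (LINT x|lborel. U (?s x) * \<psi> x)"
    using integral_hrefl[OF e, of "\<lambda>x. U x * \<psi> (?s x)" l] e by simp
  have q3: "(LINT x|lborel. rh x * \<psi> (?s x)) = (LINT x|lborel. rh (?s x) * \<psi> x)"
    using integral_hrefl[OF e, of "\<lambda>x. rh x * \<psi> (?s x)" l] e by simp
  have w1: "(LINT x|lborel. g x \<bullet> D x) + (LINT x|lborel. U x * \<psi> x) = (LINT x|lborel. rh x * \<psi> x)"
    using weak[OF H1 b] by (simp add: rh_def V_def mult.assoc)
  have w2: "(LINT x|lborel. hrefl e 0 (g (?s x)) \<bullet> D x) + (LINT x|lborel. U (?s x) * \<psi> x) = (LINT x|lborel. rh (?s x) * \<psi> x)"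
    using weak[OF H2 b] q1 q2 q3 by (simp add: rh_def V_def mult.assoc)
  show "integrable lborel (\<lambda>x. (g x - hrefl e 0 (g (?s x))) \<bullet> D x)" using i1 k1 by (simp add: inner_diff_left)
  show "integrable lborel (\<lambda>x. (U x - U (?s x)) * \<psi> x)" using i2 k2 by (simp add: left_diff_distrib)
  have "integrable lborel (\<lambda>x. (rh x - rh (?s x)) * \<psi> x)" using i3 k3 by (simp add: left_diff_distrib)
  then show "integrable lborel (\<lambda>x. (V x * U x powr (p - 1) - V (?s x) * U (?s x) powr (p - 1)) * \<psi> x)" by (simp add: rh_def)
  have "(LINT x|lborel. (g x - hrefl e 0 (g (?s x))) \<bullet> D x) + (LINT x|lborel. (U x - U (?s x)) * \<psi> x)
      = (LINT x|lborel. (rh x - rh (?s x)) * \<psi> x)"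
    using i1 i2 i3 k1 k2 k3 w1 w2 by (simp add: inner_diff_left left_diff_distrib)
  then show "(LINT x|lborel. (g x - hrefl e 0 (g (?s x))) \<bullet> D x) + (LINT x|lborel. (U x - U (?s x)) * \<psi> x)
      = (LINT x|lborel. (V x * U x powr (p - 1) - V (?s x) * U (?s x) powr (p - 1)) * \<psi> x)" by (simp add: rh_def)
qed

section \<open>Admissible levels of the hyperplane: the principle for small bad sets and
  strictness\<close>

definition plane_ok :: "(real, 'n) vec \<Rightarrow> real \<Rightarrow> bool" where
  "plane_ok e l \<longleftrightarrow> (\<forall>x\<in>ball 0 R. l < x \<bullet> e \<longrightarrow> U x \<le> U (hrefl e l x))"

lemma hrefl_in_ball: "norm e = 1 \<Longrightarrow> 0 \<le> l \<Longrightarrow> x \<in> ball 0 R \<Longrightarrow> l \<le> x \<bullet> e \<Longrightarrow> hrefl e l x \<in> ball 0 R"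
  for x :: "(real, 'n) vec"
  using norm_hrefl_le[of e l x] by auto

lemma cap_open: "open (ball 0 R \<inter> {x. l < x \<bullet> e})" for e :: "(real, 'n) vec"
  by (intro open_Int open_ball open_Collect_less continuous_intros)

lemma U_hrefl_cont:
  assumes "norm e = 1" "0 \<le> l"
  shows "continuous_on (ball 0 R \<inter> {x. l < x \<bullet> e}) (\<lambda>x. U x - U (hrefl e l x))"
  by (intro continuous_intros continuous_on_subset[OF U_cont] continuous_on_compose2[OF U_cont] continuous_hrefl)
     (use hrefl_in_ball[OF assms] in \<open>auto simp del: mem_ball\<close>)

lemma plane_ok_AE:
  assumes e: "norm e = 1" "0 \<le> l" and ae: "AE x in lborel. x \<in> ball 0 R \<and> l < x \<bullet> e \<longrightarrow> U x \<le> U (hrefl e l x)"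
  shows "plane_ok e l"
  unfolding plane_ok_def
proof (intro ballI impI)
  fix x :: "(real, 'n) vec" assume x: "x \<in> ball 0 R" "l < x \<bullet> e"
  have "AE x in lborel. x \<in> ball 0 R \<inter> {x. l < x \<bullet> e} \<longrightarrow> U x - U (hrefl e l x) \<le> 0"
    using ae by eventually_elim auto
  from AE_continuous_le_0[OF cap_open U_hrefl_cont[OF e] this, of x] x show "U x \<le> U (hrefl e l x)" by simp
qed

text \<open>Testing with the cube of \<open>\<phi> = (U - U \<circ> \<sigma>)\<^sup>+\<close> keeps the test function continuously differentiable; the gradient
  term is then the Dirichlet integral of \<open>\<phi>\<^sup>2\<close>, to which the Poincare inequality applies.\<close>
lemma small_cap_max_principle:
  obtains \<delta> where "\<delta> > 0" "\<And>e l. norm e = 1 \<Longrightarrow> 0 \<le> l \<Longrightarrow>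
    emeasure lborel {x \<in> ball 0 R. l < x \<bullet> e \<and> U (hrefl e l x) < U x} < ennreal \<delta> \<Longrightarrow> plane_ok e l"
proof -
  obtain C1 where C1: "C1 > 0" "\<And>x b. x \<in> ball 0 R \<Longrightarrow> 0 \<le> b \<Longrightarrow> b \<le> U x \<Longrightarrow>
     V x * (U x powr (p - 1) - b powr (p - 1)) \<le> C1 * (U x - b)"
    using V_power_diff_le by metis
  \<comment> \<open>The first two factors are the constant of \<open>V_hrefl_upper\<close>, the last
    one bounds the mirror value of \<open>U\<close> to the power \<open>p - 1\<close>.\<close>
  define C2 where "C2 = p * M powr (p - 1) * M powr (p - 1)"
  have C2: "C2 \<ge> 0" using p by (simp add: C2_def)
  \<comment> \<open>Young's inequality splits the nonlocal term into two parts, each integrating to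
    \<open>kern_mass\<close> times the integral of the fourth power; hence the factor 2.\<close>
  define Ct where "Ct = C1 + 2 * C2 * kern_mass"
  have Ct: "Ct > 0" unfolding Ct_def using C1(1) C2 kern_mass_nonneg by (simp add: add_pos_nonneg)
  \<comment> \<open>The Poincare inequality gives \<open>Y \<le> 8 * r^2 * Z\<close> and the
    equation gives \<open>Z \<le> (4 / 3) * (Ct * Y)\<close>; for this \<open>r\<close> the
    combination reads \<open>Y \<le> (2 / 3) * Y\<close>.\<close>
  define r where "r = sqrt (1 / (16 * Ct))"
  have r: "r > 0" "16 * Ct * r\<^sup>2 = 1" using Ct by (auto simp: r_def)
  define \<delta> where "\<delta> = measure lborel (ball (0::(real, 'n) vec) r) / 2"
  have "\<delta> > 0" unfolding \<delta>_def using content_ball_pos[OF r(1), of "0::(real, 'n) vec"] by simp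
  moreover have "plane_ok e l"
    if e: "norm e = 1" and l: "0 \<le> l" and small: "emeasure lborel {x \<in> ball 0 R. l < x \<bullet> e \<and> U (hrefl e l x) < U x} < ennreal \<delta>" for e l
  proof -
    let ?s = "hrefl e l" and ?H = "{x. l < x \<bullet> e}"
    define A where "A = {x \<in> ball 0 R. l < x \<bullet> e \<and> U (?s x) < U x}"
    have om [measurable]: "?H \<in> sets borel" by (intro borel_open open_Collect_less continuous_intros)
    have Am [measurable]: "A \<in> sets borel"
    proof -
      have "A = ball 0 R \<inter> ?H \<inter> {x. U (?s x) < U x}" by (auto simp: A_def)
      moreover have "{x. U (?s x) < U x} \<in> sets borel" by measurable
      ultimately show ?thesis by auto
    qed
    define \<phi> where "\<phi> x = indicator ?H x * max 0 (U x - U (?s x))" for x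
    have \<phi>m [measurable]: "\<phi> \<in> borel_measurable borel" unfolding \<phi>_def[abs_def] by measurable
    have \<phi>0: "\<phi> x \<ge> 0" for x by (simp add: \<phi>_def)
    have \<phi>M: "\<phi> x \<le> M" for x using U_le[of x] U_nonneg[of "?s x"] M_pos by (auto simp: \<phi>_def indicator_def)
    have \<phi>out: "\<phi> x = 0" if "x \<notin> A" for x
      using that U_out[of x] U_nonneg[of "?s x"] by (cases "x \<in> ball 0 R") (auto simp: \<phi>_def A_def indicator_def)
    have \<phi>B: "\<phi> x = 0" if "x \<notin> ball 0 R" for x using \<phi>out[of x] that by (auto simp: A_def)
    define \<psi> where "\<psi> x = (if x \<in> ?H then cube_trunc M (U x - U (?s x) + 0) else 0)" for x
    define G where "G x = g x - hrefl e 0 (g (?s x)) + 0" for x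
    define D where "D x = (if x \<in> ?H then cube_trunc' M (U x - U (?s x) + 0) *\<^sub>R G x else 0)" for x
    define \<Gamma> where "\<Gamma> x = (if x \<in> ?H then sq_trunc M (U x - U (?s x) + 0) else 0)" for x
    define D\<Gamma> where "D\<Gamma> x = (if x \<in> ?H then sq_trunc' M (U x - U (?s x) + 0) *\<^sub>R G x else 0)" for x
    have z: "C1c_ball R (\<lambda>x::(real, 'n) vec. 0) (\<lambda>x. 0)"
      unfolding C1c_ball_def
      by (auto intro!: exI[of _ "{}"] has_derivative_eq_rhs[OF has_derivative_const] simp: fun_eq_iff)
    note H\<psi> = H10_halfspace[OF e l U_H10 U_pos z _ test_shape_cube_trunc[OF M_pos], folded G_def, folded \<psi>_def D_def, simplified]
    note H\<Gamma> = H10_halfspace(1)[OF e l U_H10 U_pos z _ test_shape_sq_trunc[OF M_pos], folded G_def, folded \<Gamma>_def D\<Gamma>_def, simplified]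
    have le: "U x - U (?s x) \<le> M" for x using U_le[of x] U_nonneg[of "?s x"] by simp
    have \<psi>: "\<psi> x = \<phi> x ^ 3" for x by (auto simp: \<psi>_def \<phi>_def trunc_values[OF le])
    have \<Gamma>: "\<Gamma> x = (\<phi> x)\<^sup>2" for x by (auto simp: \<Gamma>_def \<phi>_def trunc_values[OF le])
    have D: "D x = (3 * (\<phi> x)\<^sup>2) *\<^sub>R G x" for x by (auto simp: D_def \<phi>_def trunc_values[OF le])
    have D\<Gamma>: "D\<Gamma> x = (2 * \<phi> x) *\<^sub>R G x" for x by (auto simp: D\<Gamma>_def \<phi>_def trunc_values[OF le])
    have \<psi>b: "\<bar>\<psi> x\<bar> \<le> M ^ 3" for x unfolding \<psi> using \<phi>0[of x] \<phi>M[of x] by (simp add: power_mono)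
    note I = reflected_weak_equation[OF e H\<psi> \<psi>b]
    have p4: "t ^ 4 = t ^ 3 * t" for t :: real by (simp add: eval_nat_numeral)
    define Y where "Y = (LINT x|lborel. \<phi> x ^ 4)"
    have Yi: "integrable lborel (\<lambda>x. \<phi> x ^ 4)"
      by (rule integrable_bounded_ball[where B = "M ^ 4"]) (auto simp: \<phi>0 \<phi>M \<phi>B power_mono)
    have Y0: "Y \<ge> 0" unfolding Y_def by (intro integral_nonneg_AE) auto
    have l\<Gamma>: "l2sq \<Gamma> = ennreal Y"
    proof -
      have "(\<lambda>x. (norm (\<Gamma> x))\<^sup>2) = (\<lambda>x. \<phi> x ^ 4)" by (simp add: \<Gamma> fun_eq_iff flip: power_mult)
      then show ?thesis using l2sq_integrable(2)[OF H10_grad_measurable(1)[OF H\<Gamma>] H10_grad_l2(1)[OF H\<Gamma>]] by (simp add: Y_def)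
    qed
    define Z where "Z = (LINT x|lborel. (norm (D\<Gamma> x))\<^sup>2)"
    note lD = l2sq_integrable[OF H10_grad_measurable(2)[OF H\<Gamma>] H10_grad_l2(2)[OF H\<Gamma>]]
    have Z0: "Z \<ge> 0" unfolding Z_def by (intro integral_nonneg_AE) auto
    have YZ: "Y \<le> 8 * r\<^sup>2 * Z"
    proof -
      have "l2sq \<Gamma> \<le> ennreal (8 * r\<^sup>2) * l2sq D\<Gamma>"
        using small \<phi>out by (intro H10_poincare_small[OF H\<Gamma> r(1) Am]) (auto simp: \<Gamma> \<delta>_def A_def less_imp_le)
      then have "ennreal Y \<le> ennreal (8 * r\<^sup>2 * Z)"
        unfolding l\<Gamma> lD(2) Z_def[symmetric] using Z0 by (simp add: ennreal_mult)
      then show ?thesis using Z0 by (simp add: ennreal_le_iff)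
    qed
    \<comment> \<open>The factor \<open>3 * (\<phi> x)^2\<close> from the cube is
      \<open>3 / 4\<close> of the square of \<open>2 * \<phi> x\<close>, the factor in the gradient
      of the square.\<close>
    have i1: "(\<lambda>x. (g x - hrefl e 0 (g (?s x))) \<bullet> D x) = (\<lambda>x. (3 / 4) * (norm (D\<Gamma> x))\<^sup>2)"
      by (auto simp: fun_eq_iff D D\<Gamma> G_def power_mult_distrib power2_norm_eq_inner power2_eq_square[of "\<phi> _"])
    have i2: "0 \<le> (LINT x|lborel. (U x - U (?s x)) * \<psi> x)"
    proof (intro integral_nonneg_AE AE_I2)
      fix x show "0 \<le> (U x - U (?s x)) * \<psi> x"
        by (cases "U x - U (?s x) \<ge> 0") (auto simp: \<psi> \<phi>_def)
    qed
    define c where "c x = (LINT y|lborel. kern (x - y) * \<phi> y ^ 4)" for x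
    have ci: "integrable lborel c" "(LINT x|lborel. c x) = kern_mass * Y"
      unfolding c_def[abs_def] Y_def by (rule kern_convolution[OF Yi], simp)+
    have "(LINT x|lborel. (V x * U x powr (p - 1) - V (?s x) * U (?s x) powr (p - 1)) * \<psi> x)
      \<le> (LINT x|lborel. (C1 + C2 * kern_mass) * \<phi> x ^ 4 + C2 * c x)"
    proof (rule integral_mono[OF I(3)])
      show "integrable lborel (\<lambda>x. (C1 + C2 * kern_mass) * \<phi> x ^ 4 + C2 * c x)" using Yi ci by simp
      fix x
      have c0: "c x \<ge> 0" unfolding c_def using kern_nonneg by (intro integral_nonneg_AE) auto
      show "(V x * U x powr (p - 1) - V (?s x) * U (?s x) powr (p - 1)) * \<psi> x \<le> (C1 + C2 * kern_mass) * \<phi> x ^ 4 + C2 * c x"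
      proof (cases "x \<in> A")
        case True
        then have x: "x \<in> ball 0 R" "l < x \<bullet> e" and W: "U (?s x) < U x" by (auto simp: A_def)
        have \<phi>x: "\<phi> x = U x - U (?s x)" using x W by (simp add: \<phi>_def)
        have bi: "integrable lborel (\<lambda>y. kern (x - y) * \<phi> y)"
        proof (rule Bochner_Integration.integrable_bound[of _ "\<lambda>y. kern (x - y) * M"])
          show "integrable lborel (\<lambda>y. kern (x - y) * M)" using kern_shift(1) by simp
          show "AE y in lborel. norm (kern (x - y) * \<phi> y) \<le> norm (kern (x - y) * M)"
            using kern_nonneg \<phi>0 \<phi>M M_pos by (intro AE_I2) (auto simp: abs_mult intro!: mult_left_mono)
        qed measurable
        have ci': "integrable lborel (\<lambda>y. kern (x - y) * \<phi> y ^ 4)"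
        proof (rule Bochner_Integration.integrable_bound[of _ "\<lambda>y. kern (x - y) * M ^ 4"])
          show "integrable lborel (\<lambda>y. kern (x - y) * M ^ 4)" using kern_shift(1) by simp
          show "AE y in lborel. norm (kern (x - y) * \<phi> y ^ 4) \<le> norm (kern (x - y) * M ^ 4)"
            using kern_nonneg \<phi>0 \<phi>M M_pos by (intro AE_I2) (auto simp: abs_mult intro!: mult_left_mono power_mono)
        qed measurable
        define J where "J = (LINT y|lborel. kern (x - y) * \<phi> y)"
        have J0: "J \<ge> 0" unfolding J_def using kern_nonneg \<phi>0 by (intro integral_nonneg_AE) auto
        have Vd: "V x - V (?s x) \<le> p * M powr (p - 1) * J"
          using V_hrefl_upper[OF e l x] by (simp add: J_def \<phi>_def)
        have young: "\<phi> x ^ 3 * J \<le> kern_mass * \<phi> x ^ 4 + c x"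
        proof -
          have "\<phi> x ^ 3 * J = (LINT y|lborel. \<phi> x ^ 3 * (kern (x - y) * \<phi> y))" by (simp add: J_def)
          also have "\<dots> \<le> (LINT y|lborel. kern (x - y) * \<phi> x ^ 4 + kern (x - y) * \<phi> y ^ 4)"
          proof (rule integral_mono)
            fix y
            have "\<phi> x ^ 3 * \<phi> y \<le> \<phi> x ^ 4 + \<phi> y ^ 4"
            proof (cases "\<phi> y \<le> \<phi> x")
              case True
              then have "\<phi> x ^ 3 * \<phi> y \<le> \<phi> x ^ 3 * \<phi> x" using \<phi>0 by (intro mult_left_mono) auto
              then show ?thesis using p4[of "\<phi> x"] zero_le_power[OF \<phi>0, of y 4] by linarith
            next
              case False
              then have "\<phi> x ^ 3 * \<phi> y \<le> \<phi> y ^ 3 * \<phi> y" using \<phi>0 by (intro mult_right_mono power_mono) auto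
              then show ?thesis using p4[of "\<phi> y"] zero_le_power[OF \<phi>0, of x 4] by linarith
            qed
            from mult_left_mono[OF this kern_nonneg[of "x - y"]]
            show "\<phi> x ^ 3 * (kern (x - y) * \<phi> y) \<le> kern (x - y) * \<phi> x ^ 4 + kern (x - y) * \<phi> y ^ 4"
              by (simp add: algebra_simps)
          qed (use bi ci' kern_shift(1) in auto)
          also have "\<dots> = kern_mass * \<phi> x ^ 4 + c x" using ci' kern_shift by (simp add: c_def)
          finally show ?thesis .
        qed
        \<comment> \<open>The factor \<open>V x\<close> stays with the difference of powers, which
          need not be Lipschitz by itself; the difference of potentials is multiplied by a bounded
          power.\<close>
        have "V x * U x powr (p - 1) - V (?s x) * U (?s x) powr (p - 1)
          = V x * (U x powr (p - 1) - U (?s x) powr (p - 1)) + (V x - V (?s x)) * U (?s x) powr (p - 1)"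
          by (simp add: algebra_simps)
        also have "\<dots> \<le> C1 * \<phi> x + (p * M powr (p - 1) * J) * M powr (p - 1)"
        proof (rule add_mono)
          show "V x * (U x powr (p - 1) - U (?s x) powr (p - 1)) \<le> C1 * \<phi> x"
            unfolding \<phi>x using W U_nonneg by (intro C1(2) x) auto
          have "(V x - V (?s x)) * U (?s x) powr (p - 1) \<le> (p * M powr (p - 1) * J) * U (?s x) powr (p - 1)"
            by (rule mult_right_mono[OF Vd]) simp
          also have "\<dots> \<le> (p * M powr (p - 1) * J) * M powr (p - 1)"
            using J0 p U_nonneg[of "?s x"] U_le[of "?s x"] by (intro mult_left_mono powr_mono2) auto
          finally show "(V x - V (?s x)) * U (?s x) powr (p - 1) \<le> (p * M powr (p - 1) * J) * M powr (p - 1)" .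
        qed
        finally have "(V x * U x powr (p - 1) - V (?s x) * U (?s x) powr (p - 1)) * \<psi> x
           \<le> (C1 * \<phi> x + (p * M powr (p - 1) * J) * M powr (p - 1)) * \<phi> x ^ 3"
          unfolding \<psi> using \<phi>0[of x] by (intro mult_right_mono) auto
        also have "\<dots> = C1 * \<phi> x ^ 4 + C2 * (\<phi> x ^ 3 * J)"
          by (simp add: C2_def p4 algebra_simps)
        also have "\<dots> \<le> C1 * \<phi> x ^ 4 + C2 * (kern_mass * \<phi> x ^ 4 + c x)"
          using young C2 by (intro add_left_mono mult_left_mono) auto
        finally show ?thesis by (simp add: algebra_simps)
      next
        case False
        then show ?thesis using C2 c0 \<phi>out[of x] by (simp add: \<psi>)
      qed
    qed
    also have "\<dots> = Ct * Y" using Yi ci by (simp add: Y_def[symmetric] Ct_def algebra_simps)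
    finally have "(3 / 4) * Z \<le> Ct * Y"
      using I(4) i2 lD(1) unfolding i1 by (simp add: Z_def)
    then have "Z \<le> (4 / 3) * (Ct * Y)" by simp
    then have "8 * r\<^sup>2 * Z \<le> 8 * r\<^sup>2 * ((4 / 3) * (Ct * Y))" by (intro mult_left_mono) auto
    also have "\<dots> = (16 * Ct * r\<^sup>2) * ((2 / 3) * Y)" by (simp add: ac_simps)
    also have "\<dots> = (2 / 3) * Y" unfolding r(2) by simp
    finally have "Y = 0" using YZ Y0 by linarith
    then have "AE x in lborel. \<phi> x ^ 4 = 0"
      using integral_nonneg_eq_0_iff_AE[OF Yi] by (simp add: Y_def)
    then have "AE x in lborel. x \<in> ball 0 R \<and> l < x \<bullet> e \<longrightarrow> U x \<le> U (?s x)"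
      by eventually_elim (auto simp: \<phi>_def indicator_def max_def split: if_splits)
    then show ?thesis by (rule plane_ok_AE[OF e l])
  qed
  ultimately show thesis using that by blast
qed

text \<open>The potential is strictly larger at the reflected point because the cap does not exhaust the ball;
  this replaces the strong maximum principle by a comparison with an explicit bump function.\<close>
lemma plane_strict:
  assumes e: "norm e = 1" and l: "0 < l" and ok: "plane_ok e l" and x0: "x0 \<in> ball 0 R" "l < x0 \<bullet> e"
  shows "U x0 < U (hrefl e l x0)"
proof -
  let ?s = "hrefl e l" and ?H = "{x. l < x \<bullet> e}"
  have l0: "0 \<le> l" using l by simp
  \<comment> \<open>Half the height of \<open>x0\<close> above the plane, so that a whole
    neighbourhood of \<open>x0\<close> lies in the region where the gain \<open>m\<close> is
    available.\<close>
  define \<eta>0 where "\<eta>0 = (x0 \<bullet> e - l) / 2"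
  have \<eta>0: "\<eta>0 > 0" using x0 by (simp add: \<eta>0_def)
  have le: "U y \<le> U (?s y)" if "l < y \<bullet> e" for y
    using ok that U_out[of y] U_nonneg[of "?s y"] by (cases "y \<in> ball 0 R") (auto simp: plane_ok_def)
  obtain m where m: "m > 0" "\<And>x. x \<in> ball 0 R \<Longrightarrow> l + \<eta>0 \<le> x \<bullet> e \<Longrightarrow> m \<le> V (?s x) - V x"
    by (rule V_hrefl_strict[OF e l \<eta>0 le]) blast+
  obtain r where r: "r > 0" and rB: "cball x0 r \<subseteq> ball 0 R \<inter> {x. l + \<eta>0 < x \<bullet> e}"
  proof -
    have "open (ball 0 R \<inter> {x. l + \<eta>0 < x \<bullet> e})" by (rule cap_open)
    moreover have "x0 \<in> ball 0 R \<inter> {x. l + \<eta>0 < x \<bullet> e}" using x0 by (simp add: \<eta>0_def field_simps)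
    ultimately show thesis using open_contains_cball that by meson
  qed
  have cne: "cball x0 r \<noteq> {}" using r by simp
  have cU: "continuous_on (cball x0 r) U" by (rule continuous_on_subset[OF U_cont]) (use rB in auto)
  obtain z where z: "z \<in> cball x0 r" "\<And>y. y \<in> cball x0 r \<Longrightarrow> U z \<le> U y"
    using continuous_attains_inf[OF compact_cball cne cU] by blast
  define m' where "m' = U z powr (p - 1)"
  have m': "m' > 0" using U_pos[of z] z rB by (auto simp: m'_def)
  define n where "n = real CARD('n)"
  have n: "n > 0" using dim3 by (simp add: n_def)
  define d where "d = 6 * n * (r\<^sup>2)\<^sup>2 + (r\<^sup>2) ^ 3"
  \<comment> \<open>Chosen so that \<open>- lap x + h x\<close> is at most
    \<open>m * m' / 2\<close>, half of the gain in the nonlinearity.\<close>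
  define c where "c = m * m' / (2 * d)"
  have den: "d > 0" unfolding d_def using n r by (intro add_pos_pos) auto
  have c: "c > 0" using m m' den by (simp add: c_def)
  have cden: "c * (6 * n * (r\<^sup>2)\<^sup>2 + (r\<^sup>2) ^ 3) = m * m' / 2"
    unfolding d_def[symmetric] using den by (simp add: c_def)
  \<comment> \<open>The cube of the positive part still has a continuous second derivative, as
    integration by parts against the Laplacian requires.\<close>
  define \<eta> where "\<eta> t = c * (max 0 (r\<^sup>2 - t)) ^ 3" for t
  define \<eta>' where "\<eta>' t = - 3 * c * (max 0 (r\<^sup>2 - t))\<^sup>2" for t
  define \<eta>'' where "\<eta>'' t = 6 * c * max 0 (r\<^sup>2 - t)" for t
  have rd: "((\<lambda>t. (max 0 (r\<^sup>2 - t)) ^ Suc k) has_real_derivative - (real (Suc k) * (max 0 (r\<^sup>2 - t)) ^ k)) (at t)" if "k \<ge> 1" for k t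
  proof -
    have "((\<lambda>t. r\<^sup>2 - t) has_real_derivative - 1) (at t)" by (auto intro!: derivative_eq_intros)
    from DERIV_chain2[OF pos_part_power_deriv[OF that] this] show ?thesis by simp
  qed
  have d1: "(\<eta> has_real_derivative \<eta>' t) (at t)" for t
    using DERIV_cmult[OF rd[of 2 t], of c] unfolding \<eta>_def[abs_def] \<eta>'_def by (simp add: numeral_3_eq_3 numeral_2_eq_2 algebra_simps)
  have d2: "(\<eta>' has_real_derivative \<eta>'' t) (at t)" for t
    using DERIV_cmult[OF rd[of 1 t], of "- 3 * c"] unfolding \<eta>'_def[abs_def] \<eta>''_def by (simp add: numeral_2_eq_2 algebra_simps)
  have c\<eta>'': "continuous_on UNIV \<eta>''" unfolding \<eta>''_def[abs_def] by (intro continuous_intros)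
  have c\<eta>': "continuous_on UNIV \<eta>'" unfolding \<eta>'_def[abs_def] by (intro continuous_intros)
  define T where "T x = (norm (x - x0))\<^sup>2" for x
  define h where "h x = \<eta> (T x)" for x
  define Dh where "Dh x = (2 * \<eta>' (T x)) *\<^sub>R (x - x0)" for x
  define lap where "lap x = 2 * real CARD('n) * \<eta>' (T x) + 4 * \<eta>'' (T x) * T x" for x
  have T0: "T x \<ge> 0" for x by (simp add: T_def)
  have h0: "h x \<ge> 0" for x using c by (simp add: h_def \<eta>_def)
  have hout: "h x = 0" if "x \<notin> cball x0 r" for x
  proof -
    have "r < norm (x - x0)" using that by (simp add: dist_norm norm_minus_commute)
    then have "r\<^sup>2 \<le> T x" unfolding T_def using r by (intro power_mono) auto
    then show ?thesis by (simp add: h_def \<eta>_def)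
  qed
  have hH: "h x = 0" if "x \<bullet> e \<le> l" for x
    using hout[of x] rB \<eta>0 that by fastforce
  have Ch: "C1c_ball R h Dh"
    unfolding C1c_ball_def
  proof (intro conjI allI exI[of _ "cball x0 r"])
    show "(h has_derivative (\<lambda>v. Dh x \<bullet> v)) (at x)" for x
      unfolding h_def[abs_def] Dh_def T_def by (rule radial_gradient[OF d1])
    show "continuous_on UNIV Dh" unfolding Dh_def[abs_def] T_def
      by (intro continuous_intros continuous_on_compose2[OF c\<eta>']) auto
    show "x \<notin> cball x0 r \<longrightarrow> h x = 0" for x using hout by simp
  qed (use rB in auto)
  have clap: "continuous_on UNIV lap" unfolding lap_def[abs_def] T_def
    by (intro continuous_intros continuous_on_compose2[OF c\<eta>'] continuous_on_compose2[OF c\<eta>'']) auto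
  have [measurable]: "lap \<in> borel_measurable borel" "h \<in> borel_measurable borel" "Dh \<in> borel_measurable borel"
    using clap C1c_ballD[OF Ch] by (auto intro: borel_measurable_continuous_onI)
  have lap_le: "- lap x + h x \<le> m * m' / 2" for x
  proof -
    define s where "s = max 0 (r\<^sup>2 - T x)"
    have s: "0 \<le> s" "s \<le> r\<^sup>2" using T0[of x] by (auto simp: s_def)
    have "- lap x + h x = c * (6 * n * s\<^sup>2 + s ^ 3) - 24 * c * s * T x"
      by (simp add: lap_def h_def \<eta>_def \<eta>'_def \<eta>''_def n_def algebra_simps flip: s_def)
    also have "\<dots> \<le> c * (6 * n * s\<^sup>2 + s ^ 3)" using c s T0[of x] by simp
    also have "\<dots> \<le> c * (6 * n * (r\<^sup>2)\<^sup>2 + (r\<^sup>2) ^ 3)"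
      using c n s by (intro mult_left_mono add_mono power_mono) auto
    finally show ?thesis unfolding cden .
  qed
  define \<beta> where "\<beta> = sq_trunc 1"
  define \<beta>' where "\<beta>' = sq_trunc' 1"
  have \<beta>: "test_shape \<beta> \<beta>' (2 * 1)" unfolding \<beta>_def \<beta>'_def by (rule test_shape_sq_trunc) simp
  note TS = test_shapeD[OF \<beta>]
  define w where "w x = U x - U (?s x) + h x" for x
  define G where "G x = g x - hrefl e 0 (g (?s x)) + Dh x" for x
  define \<psi> where "\<psi> x = (if x \<in> ?H then \<beta> (w x) else 0)" for x
  define D where "D x = (if x \<in> ?H then \<beta>' (w x) *\<^sub>R G x else 0)" for x
  note H\<psi> = H10_halfspace[OF e l0 U_H10 U_pos Ch hH \<beta>, folded w_def G_def, folded \<psi>_def D_def]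
  note [measurable] = H10_grad_measurable[OF H\<psi>(1)]
  have \<psi>0: "\<psi> x \<ge> 0" for x using TS(9) by (simp add: \<psi>_def)
  \<comment> \<open>Since \<open>U\<close> does not exceed its mirror value beyond the plane,
    \<open>w\<close> can be positive only where \<open>h\<close> is.\<close>
  have supp: "x \<in> cball x0 r \<and> l < x \<bullet> e \<and> w x > 0" if "\<psi> x \<noteq> 0" for x
  proof -
    have H: "l < x \<bullet> e" and w: "w x > 0" using that TS(4)[of "w x"] by (auto simp: \<psi>_def split: if_splits intro: ccontr)
    have "h x \<noteq> 0" using w le[OF H] by (auto simp: w_def)
    then show ?thesis using hout[of x] H w by auto
  qed
  obtain Bh where Bh: "\<And>x. \<bar>h x\<bar> \<le> Bh" using C1c_bounded[OF Ch] by metis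
  have \<psi>b: "\<bar>\<psi> x\<bar> \<le> 2 * (M + Bh)" for x
  proof (cases "\<psi> x = 0")
    case True then show ?thesis using M_pos Bh[of x] by simp
  next
    case False
    note s = supp[OF False]
    have "\<bar>\<beta> (w x) - \<beta> 0\<bar> \<le> 2 * 1 * \<bar>w x - 0\<bar>" by (rule TS(8))
    moreover have "\<bar>w x\<bar> \<le> M + Bh" using s U_le[of x] U_nonneg[of "?s x"] Bh[of x] by (auto simp: w_def)
    ultimately show ?thesis using s TS(4)[of 0] by (simp add: \<psi>_def)
  qed
  note I = reflected_weak_equation[OF e H\<psi> \<psi>b]
  have lp: "(LINT x|lborel. Dh x \<bullet> D x) = - (LINT x|lborel. lap x * \<psi> x)"
    using H10_radial_laplacian[OF H\<psi>(1) d2 c\<eta>'', of x0] by (simp add: Dh_def lap_def T_def)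
  have iD: "integrable lborel (\<lambda>x. Dh x \<bullet> D x)"
    by (rule l2_inner_integrable[OF _ _ C1c_l2(2)[OF Ch] H10_grad_l2(2)[OF H\<psi>(1)]]) measurable
  obtain Bl where Bl: "\<And>x. x \<in> cball 0 R \<Longrightarrow> norm (lap x) \<le> Bl"
    using continuous_bounded_ball[OF continuous_on_subset[OF clap subset_UNIV]] by metis
  have \<psi>B: "\<psi> x = 0" if "x \<notin> ball 0 R" for x using supp[of x] rB that by blast
  have i\<psi>: "integrable lborel \<psi>" by (rule integrable_bounded_ball[OF _ \<psi>b \<psi>B]) measurable
  have il: "integrable lborel (\<lambda>x. lap x * \<psi> x)"
  proof (rule integrable_bounded_ball[where B = "\<bar>Bl\<bar> * (2 * (M + Bh))"])
    show "\<bar>lap x * \<psi> x\<bar> \<le> \<bar>Bl\<bar> * (2 * (M + Bh))" for x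
    proof (cases "x \<in> ball 0 R")
      case True
      then show ?thesis unfolding abs_mult using Bl[of x] \<psi>b[of x] by (intro mult_mono) auto
    next
      case False
      then show ?thesis using \<psi>B \<psi>b[of x] by simp
    qed
  qed (use \<psi>B in auto)
  let ?F = "\<lambda>x. (V x * U x powr (p - 1) - V (?s x) * U (?s x) powr (p - 1)) * \<psi> x"
  let ?W = "\<lambda>x. (U x - U (?s x)) * \<psi> x"
  have "0 \<le> (LINT x|lborel. (g x - hrefl e 0 (g (?s x))) \<bullet> D x + Dh x \<bullet> D x)"
  proof (intro integral_nonneg_AE AE_I2)
    fix x
    have "(g x - hrefl e 0 (g (?s x))) \<bullet> D x + Dh x \<bullet> D x = G x \<bullet> D x" by (simp add: G_def inner_add_left)
    also have "\<dots> \<ge> 0" using TS(6)[of "w x"] by (simp add: D_def)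
    finally show "0 \<le> (g x - hrefl e 0 (g (?s x))) \<bullet> D x + Dh x \<bullet> D x" .
  qed
  also have "\<dots> = (LINT x|lborel. (g x - hrefl e 0 (g (?s x))) \<bullet> D x) + (LINT x|lborel. Dh x \<bullet> D x)"
    using I(1) iD by simp
  also have "\<dots> = (LINT x|lborel. ?F x) - (LINT x|lborel. ?W x) - (LINT x|lborel. lap x * \<psi> x)"
    using I(4) lp by linarith
  also have "\<dots> = (LINT x|lborel. ?F x - ?W x - lap x * \<psi> x)"
    using I(2,3) il by simp
  also have "\<dots> \<le> (LINT x|lborel. - (m * m' / 2) * \<psi> x)"
  proof (rule integral_mono)
    fix x
    show "?F x - ?W x - lap x * \<psi> x \<le> - (m * m' / 2) * \<psi> x"
    proof (cases "\<psi> x = 0")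
      case False
      note s = supp[OF False]
      then have xB: "x \<in> ball 0 R" "l + \<eta>0 \<le> x \<bullet> e" using rB by auto
      have Vx: "m \<le> V (?s x) - V x" by (rule m(2)[OF xB])
      have Up: "m' \<le> U x powr (p - 1)"
        unfolding m'_def using z(2)[of x] s U_pos[of z] z(1) rB p by (intro powr_mono2) auto
      \<comment> \<open>\<open>V\<close> is nonnegative at the mirror point, so replacing the mirror
        value of \<open>U\<close> by the smaller \<open>U x\<close> only raises the right-hand
        side.\<close>
      have "V x * U x powr (p - 1) - V (?s x) * U (?s x) powr (p - 1) \<le> V x * U x powr (p - 1) - V (?s x) * U x powr (p - 1)"
        using le[of x] s U_nonneg[of x] p V_nonneg[of "?s x"] by (intro diff_left_mono mult_left_mono powr_mono2) auto
      also have "\<dots> = - ((V (?s x) - V x) * U x powr (p - 1))" by (simp add: algebra_simps)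
      also have "\<dots> \<le> - (m * m')" using Vx Up m(1) m' by (intro le_imp_neg_le mult_mono) auto
      \<comment> \<open>On the support \<open>w x > 0\<close> means that
        \<open>- (U x - U (?s x))\<close> is less than \<open>h x\<close>, and
        \<open>h x - lap x\<close> is at most \<open>m * m' / 2\<close>; half of the gain
        remains.\<close>
      finally have "V x * U x powr (p - 1) - V (?s x) * U (?s x) powr (p - 1) - (U x - U (?s x)) - lap x \<le> - (m * m' / 2)"
        using lap_le[of x] s by (auto simp: w_def)
      from mult_right_mono[OF this \<psi>0[of x]] show ?thesis by (simp add: left_diff_distrib)
    qed simp
  qed (use I(2,3) il i\<psi> in auto)
  also have "\<dots> = - (m * m' / 2) * (LINT x|lborel. \<psi> x)" using i\<psi> by simp
  finally have "(m * m' / 2) * (LINT x|lborel. \<psi> x) \<le> 0" by simp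
  then have "(LINT x|lborel. \<psi> x) \<le> 0" using m m' by (simp add: mult_le_0_iff)
  moreover have "(LINT x|lborel. \<psi> x) \<ge> 0" using \<psi>0 by (intro integral_nonneg_AE) auto
  ultimately have "(LINT x|lborel. \<psi> x) = 0" by (rule antisym)
  then have "AE x in lborel. \<psi> x = 0" using integral_nonneg_eq_0_iff_AE[OF i\<psi>] \<psi>0 by simp
  then have "AE x in lborel. x \<in> ball 0 R \<inter> ?H \<longrightarrow> w x \<le> 0"
  proof eventually_elim
    fix x assume z: "\<psi> x = 0"
    show "x \<in> ball 0 R \<inter> ?H \<longrightarrow> w x \<le> 0"
    proof (intro impI, rule ccontr)
      assume "x \<in> ball 0 R \<inter> ?H" "\<not> w x \<le> 0"
      then show False using z sq_trunc_pos[of 1 "w x"] by (simp add: \<psi>_def \<beta>_def)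
    qed
  qed
  moreover have "continuous_on (ball 0 R \<inter> ?H) w" unfolding w_def[abs_def]
    by (intro continuous_on_add U_hrefl_cont[OF e l0] continuous_on_subset[OF C1c_ballD(3)[OF Ch]]) auto
  ultimately have "w x0 \<le> 0" using x0 by (intro AE_continuous_le_0[OF cap_open]) auto
  moreover have "h x0 > 0" using c r by (simp add: h_def \<eta>_def T_def)
  ultimately show ?thesis by (simp add: w_def)
qed

section \<open>Moving the hyperplane to the origin\<close>

lemma hrefl_level_tendsto:
  assumes "k \<longlonglongrightarrow> l"
  shows "(\<lambda>n. hrefl e (k n) x) \<longlonglongrightarrow> hrefl e l x"
  unfolding hrefl_def by (intro tendsto_intros assms)

lemma U_level_tendsto:
  assumes "k \<longlonglongrightarrow> l" "hrefl e l x \<in> ball 0 R"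
  shows "(\<lambda>n. U (hrefl e (k n) x)) \<longlonglongrightarrow> U (hrefl e l x)"
proof -
  have "isCont U (hrefl e l x)" using U_cont assms(2) by (simp add: continuous_on_eq_continuous_at)
  then show ?thesis using hrefl_level_tendsto[OF assms(1)] by (rule isCont_tendsto_compose)
qed

text \<open>Closedness of the set of admissible levels: a point strictly above the limiting plane is
  eventually above the approximating ones, and \<open>U\<close> is continuous at its mirror
  point.\<close>

lemma plane_ok_limit:
  assumes e: "norm e = 1" and l: "0 \<le> l" and k: "k \<longlonglongrightarrow> l" "\<And>n. plane_ok e (k n)"
  shows "plane_ok e l"
  unfolding plane_ok_def
proof (intro ballI impI)
  fix x :: "(real, 'n) vec" assume x: "x \<in> ball 0 R" "l < x \<bullet> e"
  have "\<forall>\<^sub>F n in sequentially. k n < x \<bullet> e" using order_tendstoD(2)[OF k(1) x(2)] .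
  then have "\<forall>\<^sub>F n in sequentially. U x \<le> U (hrefl e (k n) x)"
    by eventually_elim (use k(2) x in \<open>auto simp: plane_ok_def\<close>)
  moreover have "(\<lambda>n. U (hrefl e (k n) x)) \<longlonglongrightarrow> U (hrefl e l x)"
    using x l by (intro U_level_tendsto[OF k(1)] hrefl_in_ball e) auto
  ultimately show "U x \<le> U (hrefl e l x)" by (intro tendsto_lowerbound) auto
qed

text \<open>The bad sets shrink to a null set: inside the cap the strict inequality persists for
  nearby levels, points below the plane leave the caps, and the plane itself is null. Once the
  measure is under the threshold, which is the same for all levels, the principle for small bad sets
  applies.\<close>

lemma plane_ok_open:
  assumes e: "norm e = 1" and l: "0 < l" and ok: "plane_ok e l" and k: "k \<longlonglongrightarrow> l" "\<And>n. 0 < k n"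
  shows "\<exists>n. plane_ok e (k n)"
proof -
  obtain \<delta> where \<delta>: "\<delta> > 0" "\<And>e l. norm e = 1 \<Longrightarrow> 0 \<le> l \<Longrightarrow>
    emeasure lborel {x \<in> ball 0 R. l < x \<bullet> e \<and> U (hrefl e l x) < U x} < ennreal \<delta> \<Longrightarrow> plane_ok e l"
    by (rule small_cap_max_principle) blast
  define A where "A n = {x \<in> ball 0 R. k n < x \<bullet> e \<and> U (hrefl e (k n) x) < U x}" for n
  have Am [measurable]: "A n \<in> sets borel" for n
  proof -
    have "A n = ball 0 R \<inter> {x. k n < x \<bullet> e} \<inter> {x. U (hrefl e (k n) x) < U x}" by (auto simp: A_def)
    moreover have "{x. U (hrefl e (k n) x) < U x} \<in> sets borel" "{x. k n < x \<bullet> e} \<in> sets borel" by measurable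
    ultimately show ?thesis by auto
  qed
  have "(\<lambda>n. \<integral>\<^sup>+x. indicator (A n) x \<partial>lborel) \<longlonglongrightarrow> (\<integral>\<^sup>+(x::(real, 'n) vec). 0 \<partial>lborel)"
  proof (rule nn_integral_dominated_convergence[where w = "indicator (ball 0 R)"])
    show "AE x in lborel. indicator (A n) x \<le> (indicator (ball 0 R) x :: ennreal)" for n
      by (auto simp: A_def indicator_def)
    show "(\<integral>\<^sup>+x. indicator (ball (0::(real, 'n) vec) R) x \<partial>lborel) < \<infinity>"
      using emeasure_lborel_ball_finite[of "0::(real, 'n) vec" R] by simp
    have "e \<noteq> 0" using e by auto
    from AE_not_hyperplane[OF this, of l]
    show "AE x in lborel. (\<lambda>n. indicator (A n) x) \<longlonglongrightarrow> (0::ennreal)"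
    proof eventually_elim
      fix x :: "(real, 'n) vec" assume x: "x \<bullet> e \<noteq> l"
      have "\<forall>\<^sub>F n in sequentially. x \<notin> A n"
      proof (cases "x \<in> ball 0 R \<and> l < x \<bullet> e")
        case True
        have "U x < U (hrefl e l x)" using plane_strict[OF e l ok] True by blast
        moreover have "(\<lambda>n. U (hrefl e (k n) x)) \<longlonglongrightarrow> U (hrefl e l x)"
          using True l by (intro U_level_tendsto[OF k(1)] hrefl_in_ball e) auto
        ultimately have "\<forall>\<^sub>F n in sequentially. U x < U (hrefl e (k n) x)" by (rule order_tendstoD(1)[rotated])
        then show ?thesis by eventually_elim (auto simp: A_def)
      next
        case False
        show ?thesis
        proof (cases "x \<in> ball 0 R")
          case True
          then have "x \<bullet> e < l" using False x by auto
          from order_tendstoD(1)[OF k(1) this] show ?thesis by eventually_elim (auto simp: A_def)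
        qed (simp add: A_def)
      qed
      then have "\<forall>\<^sub>F n in sequentially. indicator (A n) x = (0::ennreal)" by eventually_elim simp
      then show "(\<lambda>n. indicator (A n) x) \<longlonglongrightarrow> (0::ennreal)" by (rule tendsto_eventually)
    qed
  qed (measurable; simp)+
  then have "(\<lambda>n. emeasure lborel (A n)) \<longlonglongrightarrow> 0" by simp
  then have "\<forall>\<^sub>F n in sequentially. emeasure lborel (A n) < ennreal \<delta>"
    using \<delta>(1) by (intro order_tendstoD(2)) auto
  then obtain n where "emeasure lborel (A n) < ennreal \<delta>" by (auto dest: eventually_happens)
  then show ?thesis using \<delta>(2)[OF e less_imp_le[OF k(2)], of n] by (auto simp: A_def)
qed

text \<open>The supremum of the bad levels cannot be good, since bad levels would accumulate at a
  good one; nor can it be bad, since it would then be below \<open>R\<close> and a limit of good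
  levels from above. At level \<open>R\<close> the cap is empty.\<close>

lemma plane_ok_all:
  assumes e: "norm e = 1" and l: "0 < l" "l \<le> R"
  shows "plane_ok e l"
proof (rule ccontr)
  assume no: "\<not> plane_ok e l"
  have okR: "plane_ok e R"
    unfolding plane_ok_def
  proof (intro ballI impI)
    fix x :: "(real, 'n) vec" assume "x \<in> ball 0 R" "R < x \<bullet> e"
    moreover have "x \<bullet> e \<le> norm x" using norm_cauchy_schwarz[of x e] e by simp
    ultimately show "U x \<le> U (hrefl e R x)" by simp
  qed
  define N where "N = {k \<in> {0<..R}. \<not> plane_ok e k}"
  have lN: "l \<in> N" using no l by (simp add: N_def)
  have bdd: "bdd_above N" by (rule bdd_aboveI[of _ R]) (simp add: N_def)
  define s where "s = Sup N"
  have s: "l \<le> s" unfolding s_def by (rule cSup_upper[OF lN bdd])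
  have sR: "s \<le> R" unfolding s_def using lN by (intro cSup_least) (auto simp: N_def)
  have s0: "0 < s" using s l by simp
  show False
  proof (cases "plane_ok e s")
    case True
    have "\<exists>y\<in>N. s - 1 / real (Suc n) < y" for n
      unfolding s_def using less_cSup_iff[of N "Sup N - 1 / real (Suc n)"] lN bdd by auto
    then obtain k where k: "\<And>n. k n \<in> N" "\<And>n. s - 1 / real (Suc n) < k n" by metis
    have "k \<longlonglongrightarrow> s"
    proof (rule tendsto_sandwich[OF _ _ _ tendsto_const])
      show "\<forall>\<^sub>F n in sequentially. s - 1 / real (Suc n) \<le> k n" using k(2) by (auto simp: less_imp_le)
      show "\<forall>\<^sub>F n in sequentially. k n \<le> s" unfolding s_def using cSup_upper[OF k(1) bdd] by auto
      have "(\<lambda>n. s - 1 / real (Suc n)) \<longlonglongrightarrow> s - 0"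
        using LIMSEQ_inverse_real_of_nat by (intro tendsto_intros) (simp add: inverse_eq_divide)
      then show "(\<lambda>n. s - 1 / real (Suc n)) \<longlonglongrightarrow> s" by simp
    qed
    from plane_ok_open[OF e s0 True this] k(1) show False by (auto simp: N_def)
  next
    case False
    then have "s \<noteq> R" using okR by auto
    then have sR': "s < R" using sR by simp
    define k where "k n = s + (R - s) / real (Suc n)" for n
    have kok: "plane_ok e (k n)" for n
    proof (rule ccontr)
      assume c: "\<not> plane_ok e (k n)"
      have "(R - s) / real (Suc n) \<le> R - s" "0 < (R - s) / real (Suc n)" using sR' by (auto simp: divide_le_eq mult_le_cancel_left1)
      then have "k n \<in> N" using c s0 by (auto simp: N_def k_def)
      then have "k n \<le> s" unfolding s_def by (rule cSup_upper[OF _ bdd])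
      then show False using \<open>0 < (R - s) / real (Suc n)\<close> by (simp add: k_def)
    qed
    have "k \<longlonglongrightarrow> s"
    proof -
      have "(\<lambda>n. s + (R - s) * inverse (real (Suc n))) \<longlonglongrightarrow> s + (R - s) * 0"
        by (intro tendsto_intros LIMSEQ_inverse_real_of_nat)
      then show ?thesis by (simp add: k_def[abs_def] divide_inverse)
    qed
    then have "plane_ok e s" using plane_ok_limit[OF e less_imp_le[OF s0]] kok by blast
    then show False using False by simp
  qed
qed

text \<open>Strictness rests on \<open>l > 0\<close>, so level 0 is reached only as a limit of
  positive levels.\<close>

lemma plane_ok_zero:
  assumes e: "norm e = 1"
  shows "plane_ok e 0"
proof (rule plane_ok_limit[OF e])
  have "(\<lambda>n. R * inverse (real (Suc n))) \<longlonglongrightarrow> R * 0"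
    by (intro tendsto_intros LIMSEQ_inverse_real_of_nat)
  then show "(\<lambda>n. R * inverse (real (Suc n))) \<longlonglongrightarrow> 0" by simp
  show "plane_ok e (R * inverse (real (Suc n)))" for n
    using R by (intro plane_ok_all[OF e]) (auto simp: field_simps)
qed simp

text \<open>Two points of equal norm are exchanged by the reflection in the hyperplane through the
  origin orthogonal to \<open>x - y\<close>, and \<open>x\<close> lies on its positive side.\<close>

lemma U_radial_le:
  assumes x: "x \<in> ball 0 R" and y: "norm x = norm y"
  shows "U x \<le> U y"
proof (cases "x = y")
  case False
  define e where "e = (1 / norm (x - y)) *\<^sub>R (x - y)"
  have n: "norm (x - y) > 0" using False by simp
  have e: "norm e = 1" using n by (simp add: e_def)
  have xy: "(norm (x - y))\<^sup>2 = 2 * (x \<bullet> (x - y))"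
  proof -
    have "x \<bullet> x = y \<bullet> y" using y by (simp add: norm_eq_sqrt_inner)
    then show ?thesis by (simp add: power2_norm_eq_inner inner_diff_left inner_diff_right inner_commute)
  qed
  have xe: "x \<bullet> e = norm (x - y) / 2"
  proof -
    have "x \<bullet> e = (1 / norm (x - y)) * (x \<bullet> (x - y))" unfolding e_def by (rule inner_scaleR_right)
    moreover have "x \<bullet> (x - y) = norm (x - y) * norm (x - y) / 2" using xy by (simp add: power2_eq_square)
    ultimately show ?thesis using n by simp
  qed
  have "hrefl e 0 x = x - norm (x - y) *\<^sub>R e" by (simp add: hrefl_def xe)
  also have "\<dots> = y" using n by (simp add: e_def)
  finally have y': "hrefl e 0 x = y" .
  have "0 < x \<bullet> e" unfolding xe using n by (rule half_gt_zero)
  with plane_ok_zero[OF e] x have "U x \<le> U (hrefl e 0 x)" unfolding plane_ok_def by blast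
  then show ?thesis unfolding y' .
qed simp

lemma U_radial:
  assumes x: "x \<in> ball 0 R" and n: "norm x = norm y"
  shows "U x = U y"
proof (rule antisym)
  show "U x \<le> U y" by (rule U_radial_le[OF x n])
  have "y \<in> ball 0 R" using x unfolding mem_ball_0 n .
  then show "U y \<le> U x" by (rule U_radial_le[OF _ n[symmetric]])
qed

end

section \<open>From the ground state to radial symmetry on the closed ball\<close>

theorem theorem4p1:
  fixes u :: "real^'n::idx \<Rightarrow> real" and R p :: real
  assumes "CARD('n::idx) \<ge> 3"
    and "R > 0"
    and "(real CARD('n::idx) + 2) / real CARD('n::idx) < p"
    and "p < (real CARD('n::idx) + 2) / (real CARD('n::idx) - 2)"
    and "ground_state R p u"
    and "\<forall>x\<in>ball 0 R. u x > 0"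
    and "continuous_on (cball 0 R) u"
  shows "(\<forall>x\<in>cball 0 R. \<forall>y\<in>cball 0 R. norm x = norm y \<longrightarrow> u x = u y)
    \<or> (\<exists>M::real^'n::idx^'n::idx. orthogonal_matrix M \<and>
         (\<forall>x\<in>cball 0 R. \<forall>y\<in>cball 0 R.
            norm x = norm y \<and> x $ last_idx = y $ last_idx \<longrightarrow> rotate_fun M u x = rotate_fun M u y) \<and>
         (\<forall>\<alpha>. 0 < \<alpha> \<and> \<alpha> \<le> R \<longrightarrow>
            (\<forall>\<theta>1 \<theta>2. pi/2 \<le> \<theta>1 \<and> \<theta>1 \<le> \<theta>2 \<and> \<theta>2 \<le> 3*pi/2 \<longrightarrow>
               rotate_fun M u (\<chi> i. if i = first_idx then \<alpha> * cos \<theta>2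
                                     else if i = last_idx then \<alpha> * sin \<theta>2 else 0)
               \<le> rotate_fun M u (\<chi> i. if i = first_idx then \<alpha> * cos \<theta>1
                                     else if i = last_idx then \<alpha> * sin \<theta>1 else 0))))"
proof (rule disjI1)
  have N: "CARD('n) \<ge> 3" and R: "R > 0" and pos: "\<And>x. x \<in> ball 0 R \<Longrightarrow> u x > 0"
    and cont: "continuous_on (cball 0 R) u" and crit: "critical_point R p u"
    using assms by (auto simp: ground_state_def)
  have p: "p > 1"
  proof -
    have "1 < (real CARD('n) + 2) / real CARD('n)" using N by (simp add: field_simps)
    then show ?thesis using assms(3) by linarith
  qed
  obtain g where H: "H10_grad R u g" using crit by (auto simp: critical_point_def H10_def)
  obtain M where M: "M > 0" "\<And>x. x \<in> cball 0 R \<Longrightarrow> norm (u x) \<le> M"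
    using continuous_bounded_ball[OF cont] by metis
  let ?I = "\<lambda>x. indicator (ball (0::real^'n::idx) R) x :: real"
  \<comment> \<open>The weak gradient determines \<open>u\<close> outside the ball only up to a null
    set; setting it to 0 there changes it on a null set and gives the pointwise vanishing used in
    the reflections.\<close>
  define U where "U x = ?I x * u x" for x
  have [measurable]: "u \<in> borel_measurable borel" "g \<in> borel_measurable borel" using H10_grad_measurable[OF H] by auto
  have Um [measurable]: "U \<in> borel_measurable borel" unfolding U_def[abs_def] by (measurable; simp)
  have UE: "AE x in lborel. U x = u x"
    using H10_grad_outside[OF H] by eventually_elim (auto simp: U_def indicator_def)
  have HU: "H10_grad R U g"
  proof -
    obtain \<phi> D where C: "\<And>k::nat. C1c_ball R (\<phi> k) (D k)"
      and l: "(\<lambda>k. l2sq (\<lambda>x. \<phi> k x - u x)) \<longlonglongrightarrow> 0" "(\<lambda>k. l2sq (\<lambda>x. D k x - g x)) \<longlonglongrightarrow> 0"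
      and ae: "AE x in lborel. (\<lambda>k. \<phi> k x) \<longlonglongrightarrow> u x" "AE x in lborel. (\<lambda>k. D k x) \<longlonglongrightarrow> g x"
      by (rule H10_gradE[OF H]) blast
    have "l2sq (\<lambda>x. \<phi> k x - U x) = l2sq (\<lambda>x. \<phi> k x - u x)" for k
      unfolding l2sq_def by (rule nn_integral_cong_AE) (use UE in eventually_elim, simp)
    then show ?thesis using l by (intro H10_gradI[OF _ _ C]) auto
  qed
  interpret green_ball R "TYPE('n)" using R N by unfold_locales
  have uM: "0 < u x \<and> u x \<le> M" if "x \<in> ball 0 R" for x using pos[OF that] M(2)[of x] that by auto
  interpret positive_solution R "TYPE('n)" U g p M
  proof unfold_locales
    show "p > 1" by (rule p)
    show "0 < U x" if "x \<in> ball 0 R" for x using pos[OF that] that by (simp add: U_def)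
    show "U x \<le> M" for x using uM[of x] M(1) by (cases "x \<in> ball 0 R") (auto simp: U_def)
    show "U x = 0" if "x \<notin> ball 0 R" for x using that by (simp add: U_def)
    show "continuous_on (ball 0 R) U"
      by (rule continuous_on_eq[OF continuous_on_subset[OF cont ball_subset_cball]]) (simp add: U_def)
    show "H10_grad R U g" by (rule HU)
    fix v :: "real^'n::idx \<Rightarrow> real" and gv :: "real^'n::idx \<Rightarrow> real^'n::idx" and B assume Hv: "H10_grad R v gv" and b: "\<And>x. \<bar>v x\<bar> \<le> B"
    have [measurable]: "v \<in> borel_measurable borel" using H10_grad_measurable[OF Hv] by auto
    have "(LINT x|lborel. U x * v x) = (LINT x|lborel. u x * v x)"
      by (rule integral_cong_AE) (use UE in \<open>auto elim: AE_mp\<close>)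
    moreover have "?I x * u x powr q = U x powr q" for x q
      by (auto simp: U_def indicator_def)
    ultimately show "(LINT x|lborel. g x \<bullet> gv x) + (LINT x|lborel. U x * v x)
        = (LINT x|lborel. pot (\<lambda>y. U y powr p) x * (U x powr (p - 1) * v x))"
      using weak_equation[OF p crit H Hv uM b] by simp
  qed
  have inner: "u x = u y" if "x \<in> ball 0 R" "norm x = norm y" for x y
    using U_radial[OF that] that by (simp add: U_def)
  show "\<forall>x\<in>cball 0 R. \<forall>y\<in>cball 0 R. norm x = norm y \<longrightarrow> u x = u y"
  proof (intro ballI impI)
    fix x y :: "real^'n::idx" assume x: "x \<in> cball 0 R" and y: "y \<in> cball 0 R" and n: "norm x = norm y"
    \<comment> \<open>Symmetry is known in the open ball. Contracting both points by factors below 1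
      that tend to 1 extends it to the sphere by continuity.\<close>
    define t where "t k = 1 - inverse (real (Suc (Suc k)))" for k
    have t: "0 \<le> t k" "t k < 1" for k by (auto simp: t_def field_simps)
    have "t \<longlonglongrightarrow> 1 - 0"
      unfolding t_def by (intro tendsto_intros LIMSEQ_Suc[OF LIMSEQ_inverse_real_of_nat])
    then have t1: "t \<longlonglongrightarrow> 1" by simp
    have lim: "(\<lambda>k. u (t k *\<^sub>R z)) \<longlonglongrightarrow> u z" if z: "z \<in> cball 0 R" for z
    proof (rule continuous_on_tendsto_compose[OF cont])
      have "(\<lambda>k. t k *\<^sub>R z) \<longlonglongrightarrow> 1 *\<^sub>R z" by (intro tendsto_intros t1)
      then show "(\<lambda>k. t k *\<^sub>R z) \<longlonglongrightarrow> z" by simp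
      have "norm (t k *\<^sub>R z) \<le> R" for k
        using t[of k] z mult_left_le_one_le[of "norm z" "t k"] by auto
      then show "\<forall>\<^sub>F k in sequentially. t k *\<^sub>R z \<in> cball 0 R" by simp
    qed (use z in simp)
    have "u (t k *\<^sub>R x) = u (t k *\<^sub>R y)" for k
    proof (rule inner)
      have "t k * norm x < R"
      proof (cases "x = 0")
        case False
        then have "t k * norm x < 1 * norm x" using t(2)[of k] by (intro mult_strict_right_mono) auto
        then show ?thesis using x by simp
      qed (use R in simp)
      then show "t k *\<^sub>R x \<in> ball 0 R" using t[of k] by simp
      show "norm (t k *\<^sub>R x) = norm (t k *\<^sub>R y)" using n by simp
    qed
    then show "u x = u y" using LIMSEQ_unique[OF lim[OF x]] lim[OF y] by simp
  qed
qed

end
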